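(* Let $n\ge2$, let $\Omega\subset\mathbb{R}^2$ be a simply connected domain, let $\mathbf{\Phi}(x,y)=(x,y,f_1(x,y),\dots,f_n(x,y))$ be the minimal graph in $\mathbb{R}^{n+2}$ of a positive area-angle map $f=(f_1,\dots,f_n):\Omega\to\mathbb{R}^n$, and let $\widehat{\mathbf{\Phi}}(x,y)=(x,y,g_1(x,y),\dots,g_n(x,y))$ be its twin maximal graph in $\mathbb{R}^{n+2}_n$ of a positive area-angle map $g=(g_1,\dots,g_n):\Omega\to\mathbb{R}^n$. (a) There exists a simultaneous conformal coordinate $\xi=\xi_1+i\xi_2$ for the minimal graph $\mathbf{\Phi}(x,y)$ in $\mathbb{R}^{n+2}$ and its twin maximal graph $\widehat{\mathbf{\Phi}}(x,y)$ in $\mathbb{R}^{n+2}_n$. (b) Letting $\Psi:(x,y)\mapsto(\xi_1,\xi_2)$ be the coordinate transformation in (a), the conformal harmonic immersion $\mathbf{\Phi}\circ\Psi^{-1}$ induces the holomorphic null curve $$2\frac{\partial}{\partial\xi}\left(\mathbf{\Phi}\circ\Psi^{-1}\right)=(\phi_1,\phi_2,\phi_3,\dots,\phi_{n+2}),$$ and the conformal harmonic immersion $\widehat{\mathbf{\Phi}}\circ\Psi^{-1}$ induces the holomorphic null curve $$2\frac{\partial}{\partial\xi}\left(\widehat{\mathbf{\Phi}}\circ\Psi^{-1}\right)=(\widehat{\phi}_1,\widehat{\phi}_2,\widehat{\phi}_3,\dots,\widehat{\phi}_{n+2}).$$ Then they obey the twin relation $$\phi_1=\widehat{\phi}_1,\qquad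 \phi_2=\widehat{\phi}_2,\qquad \phi_{k+2}=-i\,\widehat{\phi}_{k+2},\quad k\in\{1,\dots,n\}.$$
   Context: All real-valued functions are of class at least $C^2$. $\mathbb{R}^{n+2}$ carries the Euclidean metric, and $\mathbb{R}^{n+2}_n$ is the pseudo-Euclidean space with the metric $dx_1^2+dx_2^2-dx_3^2-\cdots-dx_{n+2}^2$. A map $\varphi=(\varphi_1,\dots,\varphi_n):\Omega\to\mathbb{R}^n$ is a positive area-angle map if $\sum_{1\le i<j\le n}\left(\frac{\partial(\varphi_i,\varphi_j)}{\partial(x,y)}\right)^2<1$ on $\Omega$. A maximal surface in $\mathbb{R}^{n+2}_n$ is a spacelike surface (induced metric positive definite) of zero mean curvature. Twin: given a minimal graph $\mathbf{\Phi}$ of a positive area-angle map $f$ over $\Omega$, put $E=1+\sum_k(\partial_x f_k)^2$, $F=\sum_k\partial_x f_k\,\partial_y f_k$, $G=1+\sum_k(\partial_y f_k)^2$, $\omega=\sqrt{EG-F^2}$. Its twin is the graph $\widehat{\mathbf{\Phi}}$ of the map $g=(g_1,\dots,g_n):\Omega\to\mathbb{R}^n$, determined up to additive constants (vertical translations), with $$\left(\frac{\partial g_k}{\partial x},\frac{\partial g_k}{\partial y}\right)=\left(-\frac{E}{\omega}\frac{\partial f_k}{\partial y}+\frac{F}{\omega}\frac{\partial f_k}{\partial x},\;\frac{G}{\omega}\frac{\partial f_k}{\partial x}-\frac{F}{\omega}\frac{\partial f_k}{\partial y}\right),\quad k=1,\dots,n;$$ then $g$ is again a positive area-angle map and $\widehat{\mathbf{\Phi}}$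 is a maximal surface in $\mathbb{R}^{n+2}_n$. A conformal coordinate $\xi=\xi_1+i\xi_2$ is one in which the induced metric is a positive function times $d\xi_1^2+d\xi_2^2$; it is simultaneous if this holds for both induced metrics. $\frac{\partial}{\partial\xi}=\frac12\left(\frac{\partial}{\partial\xi_1}-i\frac{\partial}{\partial\xi_2}\right)$. A holomorphic curve $(\psi_1,\dots,\psi_{n+2})$ is null when $\psi_1^2+\psi_2^2+\psi_3^2+\cdots+\psi_{n+2}^2=0$ in the case of $\mathbb{R}^{n+2}$, respectively $\psi_1^2+\psi_2^2-\psi_3^2-\cdots-\psi_{n+2}^2=0$ in the case of $\mathbb{R}^{n+2}_n$. *)

theory Defs
  imports "HOL-Complex_Analysis.Complex_Analysis"
begin

text \<open>
  Points of the parameter planes are pairs of reals.  A vector of $m$ components, and a map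
  into $m$-space, is a family indexed by \<^typ>\<open>nat\<close> of which only the indices
  $1, \dots, m$ are ever used.
\<close>

definition pdx :: "(real \<times> real \<Rightarrow> real) \<Rightarrow> real \<times> real \<Rightarrow> real" where
  "pdx h p = deriv (\<lambda>t. h (t, snd p)) (fst p)"

definition pdy :: "(real \<times> real \<Rightarrow> real) \<Rightarrow> real \<times> real \<Rightarrow> real" where
  "pdy h p = deriv (\<lambda>t. h (fst p, t)) (snd p)"

definition C1_on :: "(real \<times> real) set \<Rightarrow> (real \<times> real \<Rightarrow> real) \<Rightarrow> bool" where
  "C1_on D h \<longleftrightarrow> (\<forall>p\<in>D. h differentiable (at p)) \<and>
     continuous_on D (pdx h) \<and> continuous_on D (pdy h)"

definition C2_on :: "(real \<times> real) set \<Rightarrow> (real \<times> real \<Rightarrow> real) \<Rightarrow> bool" where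
  "C2_on D h \<longleftrightarrow> C1_on D h \<and> C1_on D (pdx h) \<and> C1_on D (pdy h)"

text \<open>
  The ambient metric on $m$-space is $\sum_j \varepsilon_j\, dx_j^2$, where the signature
  \<open>\<epsilon>\<close> is one of the following two.
\<close>

definition euclidean_sig :: "nat \<Rightarrow> real" where
  "euclidean_sig j = 1"

definition pseudo_sig :: "nat \<Rightarrow> real" where
  "pseudo_sig j = (if j \<le> 2 then 1 else - 1)"

definition ambient :: "(nat \<Rightarrow> real) \<Rightarrow> nat \<Rightarrow> (nat \<Rightarrow> real) \<Rightarrow> (nat \<Rightarrow> real) \<Rightarrow> real" where
  "ambient \<epsilon> m u v = (\<Sum>j=1..m. \<epsilon> j * u j * v j)"

definition tan_x :: "(nat \<Rightarrow> real \<times> real \<Rightarrow> real) \<Rightarrow> real \<times> real \<Rightarrow> nat \<Rightarrow> real" where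
  "tan_x X p = (\<lambda>j. pdx (X j) p)"

definition tan_y :: "(nat \<Rightarrow> real \<times> real \<Rightarrow> real) \<Rightarrow> real \<times> real \<Rightarrow> nat \<Rightarrow> real" where
  "tan_y X p = (\<lambda>j. pdy (X j) p)"

definition first_E ::
  "(nat \<Rightarrow> real) \<Rightarrow> nat \<Rightarrow> (nat \<Rightarrow> real \<times> real \<Rightarrow> real) \<Rightarrow> real \<times> real \<Rightarrow> real" where
  "first_E \<epsilon> m X p = ambient \<epsilon> m (tan_x X p) (tan_x X p)"

definition first_F ::
  "(nat \<Rightarrow> real) \<Rightarrow> nat \<Rightarrow> (nat \<Rightarrow> real \<times> real \<Rightarrow> real) \<Rightarrow> real \<times> real \<Rightarrow> real" where
  "first_F \<epsilon> m X p = ambient \<epsilon> m (tan_x X p) (tan_y X p)"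

definition first_G ::
  "(nat \<Rightarrow> real) \<Rightarrow> nat \<Rightarrow> (nat \<Rightarrow> real \<times> real \<Rightarrow> real) \<Rightarrow> real \<times> real \<Rightarrow> real" where
  "first_G \<epsilon> m X p = ambient \<epsilon> m (tan_y X p) (tan_y X p)"

definition spacelike_on ::
  "(nat \<Rightarrow> real) \<Rightarrow> nat \<Rightarrow> (nat \<Rightarrow> real \<times> real \<Rightarrow> real) \<Rightarrow> (real \<times> real) set \<Rightarrow> bool" where
  "spacelike_on \<epsilon> m X D \<longleftrightarrow> (\<forall>p\<in>D. \<forall>a b. (a, b) \<noteq> (0, 0) \<longrightarrow>
     first_E \<epsilon> m X p * a\<^sup>2 + 2 * first_F \<epsilon> m X p * a * b + first_G \<epsilon> m X p * b\<^sup>2 > 0)"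

text \<open>
  The component of an ambient vector \<open>v\<close> that is orthogonal to the tangent plane at \<open>p\<close>; the
  coefficients of $X_x$ and $X_y$ solve the $2 \times 2$ Gram system.
\<close>

definition normal_part ::
  "(nat \<Rightarrow> real) \<Rightarrow> nat \<Rightarrow> (nat \<Rightarrow> real \<times> real \<Rightarrow> real) \<Rightarrow> real \<times> real \<Rightarrow>
     (nat \<Rightarrow> real) \<Rightarrow> nat \<Rightarrow> real" where
  "normal_part \<epsilon> m X p v j =
    (let E = first_E \<epsilon> m X p; F = first_F \<epsilon> m X p; G = first_G \<epsilon> m X p;
         a = ambient \<epsilon> m v (tan_x X p); b = ambient \<epsilon> m v (tan_y X p)
     in v j - (G * a - F * b) / (E * G - F\<^sup>2) * tan_x X p j
            - (E * b - F * a) / (E * G - F\<^sup>2) * tan_y X p j)"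

text \<open>
  Half the trace, with respect to the induced metric, of the vector-valued second fundamental
  form (the normal part of the second derivatives).
\<close>

definition mean_curvature ::
  "(nat \<Rightarrow> real) \<Rightarrow> nat \<Rightarrow> (nat \<Rightarrow> real \<times> real \<Rightarrow> real) \<Rightarrow> real \<times> real \<Rightarrow> nat \<Rightarrow> real" where
  "mean_curvature \<epsilon> m X p j =
    (let E = first_E \<epsilon> m X p; F = first_F \<epsilon> m X p; G = first_G \<epsilon> m X p;
         hxx = normal_part \<epsilon> m X p (\<lambda>i. pdx (pdx (X i)) p) j;
         hxy = normal_part \<epsilon> m X p (\<lambda>i. pdy (pdx (X i)) p) j;
         hyy = normal_part \<epsilon> m X p (\<lambda>i. pdy (pdy (X i)) p) j
     in (G * hxx - 2 * F * hxy + E * hyy) / (2 * (E * G - F\<^sup>2)))"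

definition zero_mean_curvature_surface ::
  "(nat \<Rightarrow> real) \<Rightarrow> nat \<Rightarrow> (nat \<Rightarrow> real \<times> real \<Rightarrow> real) \<Rightarrow> (real \<times> real) set \<Rightarrow> bool" where
  "zero_mean_curvature_surface \<epsilon> m X D \<longleftrightarrow>
     (\<forall>j\<in>{1..m}. C2_on D (X j)) \<and> spacelike_on \<epsilon> m X D \<and>
     (\<forall>p\<in>D. \<forall>j\<in>{1..m}. mean_curvature \<epsilon> m X p j = 0)"

definition minimal_surface ::
  "nat \<Rightarrow> (nat \<Rightarrow> real \<times> real \<Rightarrow> real) \<Rightarrow> (real \<times> real) set \<Rightarrow> bool" where
  "minimal_surface = zero_mean_curvature_surface euclidean_sig"

definition maximal_surface ::
  "nat \<Rightarrow> (nat \<Rightarrow> real \<times> real \<Rightarrow> real) \<Rightarrow> (real \<times> real) set \<Rightarrow> bool" where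
  "maximal_surface = zero_mean_curvature_surface pseudo_sig"

definition graph_of ::
  "(nat \<Rightarrow> real \<times> real \<Rightarrow> real) \<Rightarrow> nat \<Rightarrow> real \<times> real \<Rightarrow> real" where
  "graph_of f j p = (if j = 1 then fst p else if j = 2 then snd p else f (j - 2) p)"

definition jacobian ::
  "(real \<times> real \<Rightarrow> real) \<Rightarrow> (real \<times> real \<Rightarrow> real) \<Rightarrow> real \<times> real \<Rightarrow> real" where
  "jacobian u v p = pdx u p * pdy v p - pdy u p * pdx v p"

definition positive_area_angle ::
  "nat \<Rightarrow> (nat \<Rightarrow> real \<times> real \<Rightarrow> real) \<Rightarrow> (real \<times> real) set \<Rightarrow> bool" where
  "positive_area_angle n f D \<longleftrightarrow>
     (\<forall>k\<in>{1..n}. C2_on D (f k)) \<and>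
     (\<forall>p\<in>D. (\<Sum>(i, j) \<in> {(i, j). 1 \<le> i \<and> i < j \<and> j \<le> n}. (jacobian (f i) (f j) p)\<^sup>2) < 1)"

definition is_twin ::
  "nat \<Rightarrow> (nat \<Rightarrow> real \<times> real \<Rightarrow> real) \<Rightarrow> (nat \<Rightarrow> real \<times> real \<Rightarrow> real) \<Rightarrow>
     (real \<times> real) set \<Rightarrow> bool" where
  "is_twin n f g D \<longleftrightarrow> (\<forall>p\<in>D. \<forall>k\<in>{1..n}.
     let E = 1 + (\<Sum>l=1..n. (pdx (f l) p)\<^sup>2);
         F = (\<Sum>l=1..n. pdx (f l) p * pdy (f l) p);
         G = 1 + (\<Sum>l=1..n. (pdy (f l) p)\<^sup>2);
         \<omega> = sqrt (E * G - F\<^sup>2)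
     in pdx (g k) p = - (E / \<omega>) * pdy (f k) p + F / \<omega> * pdx (f k) p \<and>
        pdy (g k) p = G / \<omega> * pdx (f k) p - F / \<omega> * pdy (f k) p)"

definition C2_diffeo_on :: "(real \<times> real) set \<Rightarrow> (real \<times> real \<Rightarrow> real \<times> real) \<Rightarrow> bool" where
  "C2_diffeo_on D \<Psi> \<longleftrightarrow> inj_on \<Psi> D \<and> open (\<Psi> ` D) \<and>
     C2_on D (fst \<circ> \<Psi>) \<and> C2_on D (snd \<circ> \<Psi>) \<and>
     C2_on (\<Psi> ` D) (fst \<circ> inv_into D \<Psi>) \<and> C2_on (\<Psi> ` D) (snd \<circ> inv_into D \<Psi>)"

definition reparam ::
  "(nat \<Rightarrow> real \<times> real \<Rightarrow> real) \<Rightarrow> (real \<times> real) set \<Rightarrow> (real \<times> real \<Rightarrow> real \<times> real) \<Rightarrow>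
     nat \<Rightarrow> real \<times> real \<Rightarrow> real" where
  "reparam X D \<Psi> j = X j \<circ> inv_into D \<Psi>"

definition conformal_on ::
  "(nat \<Rightarrow> real) \<Rightarrow> nat \<Rightarrow> (nat \<Rightarrow> real \<times> real \<Rightarrow> real) \<Rightarrow> (real \<times> real) set \<Rightarrow> bool" where
  "conformal_on \<epsilon> m Y W \<longleftrightarrow> (\<exists>\<rho>::real \<times> real \<Rightarrow> real. \<forall>w\<in>W. \<rho> w > 0 \<and>
     first_E \<epsilon> m Y w = \<rho> w \<and> first_F \<epsilon> m Y w = 0 \<and> first_G \<epsilon> m Y w = \<rho> w)"

definition conformal_coordinate ::
  "(nat \<Rightarrow> real) \<Rightarrow> nat \<Rightarrow> (nat \<Rightarrow> real \<times> real \<Rightarrow> real) \<Rightarrow> (real \<times> real) set \<Rightarrow>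
     (real \<times> real \<Rightarrow> real \<times> real) \<Rightarrow> bool" where
  "conformal_coordinate \<epsilon> m X D \<Psi> \<longleftrightarrow>
     C2_diffeo_on D \<Psi> \<and> conformal_on \<epsilon> m (reparam X D \<Psi>) (\<Psi> ` D)"

definition harmonic_on :: "(real \<times> real) set \<Rightarrow> (real \<times> real \<Rightarrow> real) \<Rightarrow> bool" where
  "harmonic_on W u \<longleftrightarrow> C2_on W u \<and> (\<forall>w\<in>W. pdx (pdx u) w + pdy (pdy u) w = 0)"

definition immersion_on ::
  "nat \<Rightarrow> (nat \<Rightarrow> real \<times> real \<Rightarrow> real) \<Rightarrow> (real \<times> real) set \<Rightarrow> bool" where
  "immersion_on m Y W \<longleftrightarrow> (\<forall>w\<in>W. \<forall>a b.
     (\<forall>j\<in>{1..m}. a * tan_x Y w j + b * tan_y Y w j = 0) \<longrightarrow> a = 0 \<and> b = 0)"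

definition conformal_harmonic_immersion ::
  "(nat \<Rightarrow> real) \<Rightarrow> nat \<Rightarrow> (nat \<Rightarrow> real \<times> real \<Rightarrow> real) \<Rightarrow> (real \<times> real) set \<Rightarrow> bool" where
  "conformal_harmonic_immersion \<epsilon> m Y W \<longleftrightarrow>
     immersion_on m Y W \<and> conformal_on \<epsilon> m Y W \<and> (\<forall>j\<in>{1..m}. harmonic_on W (Y j))"

definition complex_region :: "(real \<times> real) set \<Rightarrow> complex set" where
  "complex_region W = {z. (Re z, Im z) \<in> W}"

text \<open>The operator $\partial/\partial\xi$, its value regarded as a function of $\xi = \xi_1 + i\xi_2$.\<close>

definition d_xi :: "(real \<times> real \<Rightarrow> real) \<Rightarrow> complex \<Rightarrow> complex" where
  "d_xi u z = 1 / 2 * (complex_of_real (pdx u (Re z, Im z)) - \<i> * complex_of_real (pdy u (Re z, Im z)))"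

definition induced_curve ::
  "(nat \<Rightarrow> real \<times> real \<Rightarrow> real) \<Rightarrow> nat \<Rightarrow> complex \<Rightarrow> complex" where
  "induced_curve Y j z = 2 * d_xi (Y j) z"

definition holomorphic_null_curve ::
  "(nat \<Rightarrow> real) \<Rightarrow> nat \<Rightarrow> (nat \<Rightarrow> complex \<Rightarrow> complex) \<Rightarrow> complex set \<Rightarrow> bool" where
  "holomorphic_null_curve \<epsilon> m \<psi> U \<longleftrightarrow>
     (\<forall>j\<in>{1..m}. \<psi> j holomorphic_on U) \<and>
     (\<forall>z\<in>U. (\<Sum>j=1..m. complex_of_real (\<epsilon> j) * (\<psi> j z)\<^sup>2) = 0)"

end

(*
  Put E, F, G, omega as in the definition of the twin. The minimal surface equation says that the
  forms (E dx + F dy)/omega and (F dx + G dy)/omega are closed; let a and b be potentials. With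
  T = (x + a) - i (y + b), which is locally injective (the Jacobian of (x + a, y + b) is the identity
  plus a positive definite symmetric matrix), x - i b, y + i a and all f_k - i g_k are holomorphic
  functions of the local coordinate T, and the sum of the squares of their n + 2 differentials
  vanishes. Any injective holomorphic function on the domain is therefore the desired simultaneous
  conformal coordinate; the minus sign in T produces the sign in the twin relation.

  T itself need not be injective when the domain is not convex, so a uniformization theorem is needed.
  The derivative of (x - a) + i (y - b) with respect to T is holomorphic of modulus below 1. If it is
  constant, T is injective. Otherwise there is a bounded nonconstant holomorphic function, and
  Perron's method (written multiplicatively: the infimum over continuous majorants sigma of
  holomorphic functions stands for exp (- Green's function)) gives for each p a holomorphic F_p into
  the unit disc vanishing only at p that dominates all holomorphic functions into the disc vanishing
  at p. Composing F_p with the disc automorphism that moves F_p(q) to 0 and comparing with F_q, and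
  conversely, gives equality, whence F_p takes the value F_p(q) only at q.
*)

theory Submission
  imports Defs
begin

section \<open>The Dirichlet problem on a disc\<close>

text \<open>Holomorphy always refers to the equation E h_y = (F - i \<omega>) h_x, the
  Cauchy-Riemann equation of the metric of the minimal graph, with orientation opposite to (x, y).
  Solutions are compared through their gradients: \<open>T\<close> solves it with nonvanishing
  gradient, so every other solution has a derivative with respect to \<open>T\<close>. This makes
  the domain a Riemann surface spread over the plane, although the metric is only known to be of
  class C1. The obstacle is global. The potentials, and the functions of modulus exp (- Green's
  function), exist locally and are unique up to constants (additive, respectively unimodular), so
  one gluing theorem serves both; simple connectedness enters there. A bounded nonconstant function
  keeps the Perron envelope positive off the pole. If the derivative of S = (x - a) + i (y - b) with
  respect to T is a constant k, then S - k T is constant, and T and S together determine x and y. In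
  the indefinite space the induced metric is not a sum of squares, so the positivity of its
  conformal factor is taken from spacelikeness.\<close>

lemma poisson_kernel:
  assumes "cmod e = 1" "cmod z < 1"
  shows "Re ((e + z) / (e - z)) = (1 - (cmod z)\<^sup>2) / (cmod (e - z))\<^sup>2"
proof -
  have "e - z \<noteq> 0" using assms by auto
  have "(e + z) / (e - z) = (e + z) * cnj (e - z) / of_real ((cmod (e - z))\<^sup>2)"
    using complex_div_cnj[of "e + z" "e - z"] by simp
  moreover have "Re ((e + z) * cnj (e - z)) = (cmod e)\<^sup>2 - (cmod z)\<^sup>2"
    unfolding cmod_power2 by (simp add: algebra_simps power2_eq_square)
  ultimately show ?thesis using assms(1) by (metis Re_divide_of_real one_power2)
qed

text \<open>Since (e + z) / (e - z) = 2 e / (e - z) - 1, the Schwarz integral is the combination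
  \<open>(2 * K z - K 0) / (2 * of_real pi * \<i>)\<close> of Cauchy integrals, which are
  holomorphic for merely continuous boundary data. The last clause is there to give the Poisson
  kernel total mass 1.\<close>

lemma schwarz_integral:
  fixes u :: "complex \<Rightarrow> real"
  assumes u: "continuous_on (sphere 0 1) u"
  obtains h where "h holomorphic_on ball 0 1"
    "\<And>z. z \<in> ball 0 1 \<Longrightarrow>
      ((\<lambda>t. u (exp (2 * of_real pi * \<i> * of_real t)) * Re ((exp (2 * of_real pi * \<i> * of_real t) + z) / (exp (2 * of_real pi * \<i> * of_real t) - z))) has_integral Re (h z)) {0..1}"
    "(\<forall>z. u z = 1) \<longrightarrow> (\<forall>z\<in>ball 0 1. h z = 1)"
proof -
  define U where "U = (\<lambda>z. complex_of_real (u z))"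
  have cU: "continuous_on (path_image (circlepath 0 1)) U"
    using u unfolding U_def by (auto intro!: continuous_intros)
  define K where "K = (\<lambda>z. contour_integral (circlepath 0 1) (\<lambda>\<zeta>. U \<zeta> / (\<zeta> - z)))"
  have int: "((\<lambda>\<zeta>. U \<zeta> / (\<zeta> - z)) has_contour_integral K z) (circlepath 0 1)" if "z \<in> ball 0 1" for z
    unfolding K_def
    apply (rule has_contour_integral_integral)
    apply (rule contour_integrable_continuous_circlepath)
    using cU that by (auto intro!: continuous_intros)
  have "K holomorphic_on ball 0 1"
    unfolding holomorphic_on_open[OF open_ball]
    using Cauchy_next_derivative_circlepath(2)[OF cU, of 1 K] int by fastforce
  define h where "h = (\<lambda>z. (2 * K z - K 0) / (2 * of_real pi * \<i>))"
  have hol: "h holomorphic_on ball 0 1" unfolding h_def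
    by (intro holomorphic_intros \<open>K holomorphic_on _\<close>) auto
  define e where "e = (\<lambda>t. exp (2 * of_real pi * \<i> * complex_of_real t))"
  have e1: "cmod (e t) = 1" for t by (simp add: e_def norm_exp_eq_Re)
  have I: "((\<lambda>t. U (e t) * (2 * of_real pi * \<i> * e t) / (e t - z)) has_integral K z) {0..1}" if "z \<in> ball 0 1" for z
  proof -
    have "((\<lambda>t. U (circlepath 0 1 t) / (circlepath 0 1 t - z) * vector_derivative (circlepath 0 1) (at t within {0..1})) has_integral K z) {0..1}"
      using int[OF that] by (simp add: has_contour_integral_def)
    then show ?thesis
    proof (rule has_integral_eq[rotated])
      fix t :: real assume "t \<in> {0..1}"
      then have "vector_derivative (circlepath 0 1) (at t within {0..1}) = 2 * of_real pi * \<i> * e t"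
        by (simp add: vector_derivative_circlepath01 e_def)
      moreover have "circlepath 0 1 t = e t" by (simp add: circlepath e_def)
      ultimately show "U (circlepath 0 1 t) / (circlepath 0 1 t - z) * vector_derivative (circlepath 0 1) (at t within {0..1}) = U (e t) * (2 * of_real pi * \<i> * e t) / (e t - z)"
        by simp
    qed
  qed
  have main: "((\<lambda>t. u (e t) * Re ((e t + z) / (e t - z))) has_integral Re (h z)) {0..1}" if z: "z \<in> ball 0 1" for z
  proof -
    have "((\<lambda>t. (2 * (U (e t) * (2 * of_real pi * \<i> * e t) / (e t - z)) - U (e t) * (2 * of_real pi * \<i> * e t) / (e t - 0)) / (2 * of_real pi * \<i>)) has_integral h z) {0..1}"
      unfolding h_def
      by (intro has_integral_divide has_integral_diff has_integral_mult_right I z) auto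
    then have "((\<lambda>t. U (e t) * ((e t + z) / (e t - z))) has_integral h z) {0..1}"
    proof (rule has_integral_eq[rotated])
      fix t
      have ez: "e t \<noteq> 0" "e t - z \<noteq> 0" using e1[of t] z by auto
      show "(2 * (U (e t) * (2 * of_real pi * \<i> * e t) / (e t - z)) - U (e t) * (2 * of_real pi * \<i> * e t) / (e t - 0)) / (2 * of_real pi * \<i>) = U (e t) * ((e t + z) / (e t - z))"
        using ez by (simp add: divide_simps) (simp add: algebra_simps)
    qed
    from has_integral_linear[OF this bounded_linear_Re]
    show ?thesis by (rule has_integral_eq[rotated]) (simp add: U_def del: Re_divide times_divide_eq_right)
  qed
  have one: "h z = 1" if "\<And>z. u z = 1" and z: "z \<in> ball 0 1" for z
  proof -
    have "K w = 2 * of_real pi * \<i>" if "w \<in> ball 0 1" for w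
    proof -
      have "((\<lambda>\<zeta>. 1 / (\<zeta> - w)) has_contour_integral 2 * of_real pi * \<i> * 1) (circlepath 0 1)"
        by (rule Cauchy_integral_circlepath_simple) (use that in auto)
      then show ?thesis unfolding K_def using \<open>\<And>z. u z = 1\<close>
        by (simp add: contour_integral_unique U_def)
    qed
    then show ?thesis unfolding h_def using z by simp
  qed
  show ?thesis using that[OF hol] main one unfolding e_def by blast
qed

text \<open>The Poisson kernel is an approximate identity: it is nonnegative, has mass 1, and at
  boundary points of distance at least \<eta> from \<open>z0\<close> it is at most 8 q / \<eta>^2,
  with q the distance from z to \<open>z0\<close>. The extension \<open>v\<close> is kept apart from
  \<open>h\<close>, whose imaginary part may have no boundary values.\<close>

lemma poisson_unit_disc:
  fixes u :: "complex \<Rightarrow> real"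
  assumes u: "continuous_on (sphere 0 1) u"
  obtains h v where "h holomorphic_on ball 0 1" "continuous_on (cball 0 1) v"
    "\<And>z. z \<in> ball 0 1 \<Longrightarrow> v z = Re (h z)" "\<And>z. z \<in> sphere 0 1 \<Longrightarrow> v z = u z"
proof -
  define e where "e = (\<lambda>t. exp (2 * of_real pi * \<i> * complex_of_real t))"
  have e1: "cmod (e t) = 1" for t by (simp add: e_def norm_exp_eq_Re)
  define P where "P = (\<lambda>z t. Re ((e t + z) / (e t - z)))"
  obtain h where hol: "h holomorphic_on ball 0 1"
    and h: "\<And>z. z \<in> ball 0 1 \<Longrightarrow> ((\<lambda>t. u (e t) * P z t) has_integral Re (h z)) {0..1}"
    unfolding e_def P_def by (rule schwarz_integral[OF u]) blast
  have P1: "(P z has_integral 1) {0..1}" if "z \<in> ball 0 1" for z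
  proof -
    obtain h1 where "\<And>z. z \<in> ball 0 1 \<Longrightarrow> ((\<lambda>t. 1 * P z t) has_integral Re (h1 z)) {0..1}"
      "\<And>z. z \<in> ball 0 1 \<Longrightarrow> h1 z = 1"
      unfolding e_def P_def by (rule schwarz_integral[of "\<lambda>_. 1"]) auto
    then show ?thesis using that by fastforce
  qed
  have Pk: "P z t = (1 - (cmod z)\<^sup>2) / (cmod (e t - z))\<^sup>2" if "z \<in> ball 0 1" for z t
    unfolding P_def using poisson_kernel e1 that by simp
  define v where "v = (\<lambda>z. if cmod z < 1 then Re (h z) else u z)"
  have "compact (u ` sphere 0 1)" using u by (intro compact_continuous_image) auto
  then obtain M where M: "\<And>x. x \<in> sphere 0 1 \<Longrightarrow> \<bar>u x\<bar> \<le> M"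
    unfolding real_norm_def[symmetric] by (meson compact_imp_bounded bounded_iff imageI)
  have M0: "M \<ge> 0" using M[of 1] by simp
  have "continuous_on (cball 0 1) v"
    unfolding continuous_on_iff
  proof (intro ballI allI impI)
    fix z0 \<epsilon> assume z0: "z0 \<in> cball (0::complex) 1" and "\<epsilon> > (0::real)"
    show "\<exists>d>0. \<forall>z\<in>cball 0 1. dist z z0 < d \<longrightarrow> dist (v z) (v z0) < \<epsilon>"
    proof (cases "cmod z0 < 1")
      case True
      have "continuous_on (ball 0 1) (\<lambda>z. Re (h z))"
        using hol holomorphic_on_imp_continuous_on by (intro continuous_intros) auto
      then obtain d where d: "d > 0" "\<And>z. z \<in> ball 0 1 \<Longrightarrow> dist z z0 < d \<Longrightarrow> dist (Re (h z)) (Re (h z0)) < \<epsilon>"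
        using True \<open>\<epsilon> > 0\<close> unfolding continuous_on_iff by fastforce
      show ?thesis
      proof (intro exI[of _ "min d (1 - cmod z0)"] conjI ballI impI)
        fix z assume "z \<in> cball 0 1" "dist z z0 < min d (1 - cmod z0)"
        then have "cmod z < 1" using norm_triangle_ineq2[of z z0] by (simp add: dist_norm)
        then show "dist (v z) (v z0) < \<epsilon>" using d \<open>dist z z0 < _\<close> True by (simp add: v_def)
      qed (use d True in auto)
    next
      case False
      then have z0s: "cmod z0 = 1" using z0 by simp
      obtain \<eta> where \<eta>: "\<eta> > 0" "\<And>x. x \<in> sphere 0 1 \<Longrightarrow> dist x z0 < \<eta> \<Longrightarrow> dist (u x) (u z0) < \<epsilon> / 2"
        using u[unfolded continuous_on_iff, rule_format, of z0 "\<epsilon> / 2"] z0s \<open>\<epsilon> > 0\<close> by auto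
      \<comment> \<open>The bound \<eta> / 2 keeps z at distance at least \<eta> / 2 from the far
        boundary points; the other one makes their contribution 16 M q / \<eta>^2 smaller than
        \<epsilon> / 2, with M + 1 instead of M to allow M = 0.\<close>
      define d where "d = min (\<eta> / 2) (\<epsilon> * \<eta>\<^sup>2 / (32 * (M + 1)))"
      have d0: "d > 0" unfolding d_def using \<eta> \<open>\<epsilon> > 0\<close> M0 by auto
      have "dist (v z) (v z0) < \<epsilon>" if z: "z \<in> cball 0 1" "dist z z0 < d" for z
      proof (cases "cmod z < 1")
        case False
        then show ?thesis using \<eta>(2)[of z] z z0s \<open>\<epsilon> > 0\<close> \<eta>(1) by (auto simp: v_def d_def)
      next
        case True
        then have zb: "z \<in> ball 0 1" by simp
        define q where "q = cmod (z - z0)"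
        have q: "q < d" using z by (simp add: q_def dist_norm)
        have "((\<lambda>t. u (e t) * P z t - u z0 * P z t) has_integral Re (h z) - u z0 * 1) {0..1}"
          by (intro has_integral_diff h P1 zb has_integral_mult_right)
        then have A: "((\<lambda>t. (u (e t) - u z0) * P z t) has_integral Re (h z) - u z0) {0..1}"
          by (simp add: algebra_simps)
        have B: "((\<lambda>t. \<epsilon> / 2 * P z t + 16 * M * q / \<eta>\<^sup>2) has_integral \<epsilon> / 2 * 1 + 16 * M * q / \<eta>\<^sup>2) {0..1}"
          using has_integral_add[OF has_integral_mult_right[OF P1[OF zb], of "\<epsilon> / 2"] has_integral_const_real[of "16 * M * q / \<eta>\<^sup>2" 0 1]] by simp
        have "\<bar>(u (e t) - u z0) * P z t\<bar> \<le> \<epsilon> / 2 * P z t + 16 * M * q / \<eta>\<^sup>2" for t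
        proof -
          have P0: "P z t \<ge> 0" using Pk[OF zb] True by (simp add: abs_square_le_1)
          have c: "16 * M * q / \<eta>\<^sup>2 \<ge> 0" using M0 by (simp add: q_def)
          show ?thesis
          proof (cases "dist (e t) z0 < \<eta>")
            case True
            have "dist (u (e t)) (u z0) < \<epsilon> / 2" using \<eta>(2)[of "e t"] True e1 by simp
            then have "\<bar>u (e t) - u z0\<bar> * P z t \<le> \<epsilon> / 2 * P z t"
              using P0 by (intro mult_right_mono) (auto simp: dist_norm)
            then show ?thesis using c P0 by (simp add: abs_mult)
          next
            case False
            have "cmod (e t - z) \<ge> \<eta> / 2"
            proof -
              have "\<eta> \<le> cmod (e t - z0)" using False by (simp add: dist_norm)
              also have "\<dots> \<le> cmod (e t - z) + q" unfolding q_def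
                using norm_triangle_ineq[of "e t - z" "z - z0"] by simp
              finally show ?thesis using q by (simp add: d_def)
            qed
            then have E: "(cmod (e t - z))\<^sup>2 \<ge> \<eta>\<^sup>2 / 4"
              using power_mono[of "\<eta>/2" "cmod (e t - z)" 2] \<eta> by (simp add: power_divide)
            have N: "1 - (cmod z)\<^sup>2 \<le> 2 * q"
            proof -
              have "1 - cmod z \<le> q" using norm_triangle_ineq2[of z0 z] z0s by (simp add: q_def norm_minus_commute)
              moreover have "1 - (cmod z)\<^sup>2 = (1 - cmod z) * (1 + cmod z)" by (simp add: algebra_simps power2_eq_square)
              moreover have "\<dots> \<le> q * 2" using True \<open>1 - cmod z \<le> q\<close>
                by (intro mult_mono) (auto simp: q_def)
              ultimately show ?thesis by simp
            qed
            have "P z t \<le> (2 * q) / (\<eta>\<^sup>2 / 4)" unfolding Pk[OF zb]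
              using N E \<eta> by (intro frac_le) (auto simp: q_def)
            then have "\<bar>u (e t) - u z0\<bar> * P z t \<le> (2 * M) * ((2 * q) / (\<eta>\<^sup>2 / 4))"
              using M[of "e t"] M[of z0] e1 z0s P0 M0 by (intro mult_mono) auto
            also have "\<dots> = 16 * M * q / \<eta>\<^sup>2" by simp
            moreover have "0 \<le> \<epsilon> / 2 * P z t" using P0 \<open>\<epsilon> > 0\<close> by simp
            ultimately show ?thesis using P0 unfolding abs_mult by linarith
          qed
        qed
        then have "\<bar>Re (h z) - u z0\<bar> \<le> \<epsilon> / 2 * 1 + 16 * M * q / \<eta>\<^sup>2"
          using integral_norm_bound_integral[OF has_integral_integrable[OF A] has_integral_integrable[OF B]]
          unfolding integral_unique[OF A] integral_unique[OF B] real_norm_def by blast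
        also have "\<dots> < \<epsilon>"
        proof -
          have "q < \<epsilon> * \<eta>\<^sup>2 / (32 * (M + 1))" using q by (simp add: d_def)
          then have "q * (32 * (M + 1)) < \<epsilon> * \<eta>\<^sup>2" using M0 by (simp add: pos_less_divide_eq)
          then have "32 * M * q \<le> q * (32 * (M + 1))" by (simp add: algebra_simps q_def)
          then have "16 * M * q < \<epsilon> / 2 * \<eta>\<^sup>2" using \<open>q * (32 * (M + 1)) < _\<close> by simp
          then have "16 * M * q / \<eta>\<^sup>2 < \<epsilon> / 2" using \<eta>(1) by (simp only: pos_divide_less_eq zero_less_power)
          then show ?thesis by simp
        qed
        finally show ?thesis using True z0s by (simp add: v_def dist_norm)
      qed
      then show ?thesis using d0 by blast
    qed
  qed
  then show ?thesis using that[OF hol] by (simp add: v_def)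
qed

text \<open>Exponentiating the Schwarz integral of \<open>ln (u w)\<close> turns prescribed boundary
  modulus into a Dirichlet problem and excludes zeros. Only the modulus is claimed to extend
  continuously to the circle.\<close>

lemma outer_function:
  fixes u :: "complex \<Rightarrow> real"
  assumes "r > 0" and u: "continuous_on (sphere c r) u" "\<And>w. w \<in> sphere c r \<Longrightarrow> u w > 0"
  obtains \<phi> v where "\<phi> holomorphic_on ball c r" "\<And>w. w \<in> ball c r \<Longrightarrow> \<phi> w \<noteq> 0"
    "continuous_on (cball c r) v" "\<And>w. w \<in> ball c r \<Longrightarrow> v w = cmod (\<phi> w)"
    "\<And>w. w \<in> sphere c r \<Longrightarrow> v w = u w" "\<And>w. w \<in> cball c r \<Longrightarrow> v w > 0"
proof -
  have s: "c + of_real r * z \<in> sphere c r" if "z \<in> sphere 0 1" for z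
    using that \<open>r > 0\<close> by (simp add: dist_norm norm_mult)
  have "continuous_on (sphere 0 1) (\<lambda>z. ln (u (c + of_real r * z)))"
  proof (intro continuous_on_ln continuous_on_compose2[OF u(1)] continuous_intros)
    show "(\<lambda>z. c + of_real r * z) ` sphere 0 1 \<subseteq> sphere c r" using s by auto
    show "\<forall>x\<in>sphere 0 1. u (c + complex_of_real r * x) \<noteq> 0" using s u(2) by force
  qed
  then obtain h v where h: "h holomorphic_on ball 0 1" "continuous_on (cball 0 1) v"
    "\<And>z. z \<in> ball 0 1 \<Longrightarrow> v z = Re (h z)" "\<And>z. z \<in> sphere 0 1 \<Longrightarrow> v z = ln (u (c + of_real r * z))"
    using poisson_unit_disc by blast
  define m where "m = (\<lambda>w. (w - c) / of_real r)"
  have mb: "m w \<in> ball 0 1" if "w \<in> ball c r" for w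
    using that \<open>r > 0\<close> by (simp add: m_def norm_divide dist_norm norm_minus_commute)
  have mc: "m w \<in> cball 0 1" if "w \<in> cball c r" for w
    using that \<open>r > 0\<close> by (simp add: m_def norm_divide dist_norm norm_minus_commute)
  have ms: "m w \<in> sphere 0 1" if "w \<in> sphere c r" for w
    using that \<open>r > 0\<close> by (simp add: m_def norm_divide dist_norm norm_minus_commute)
  show ?thesis
  proof
    show "(\<lambda>w. exp (h (m w))) holomorphic_on ball c r"
      using mb \<open>r > 0\<close> unfolding m_def
      by (intro holomorphic_intros holomorphic_on_compose_gen[OF _ h(1), unfolded o_def]) auto
    show "continuous_on (cball c r) (\<lambda>w. exp (v (m w)))"
      using mc \<open>r > 0\<close> unfolding m_def
      by (intro continuous_intros continuous_on_compose2[OF h(2)]) auto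
    show "exp (v (m w)) = cmod (exp (h (m w)))" if "w \<in> ball c r" for w
      using h(3)[OF mb[OF that]] by simp
    show "exp (v (m w)) = u w" if "w \<in> sphere c r" for w
      using h(4)[OF ms[OF that]] \<open>r > 0\<close> u(2)[OF that] by (simp add: m_def)
  qed auto
qed

section \<open>Gluing local sections over a simply connected plane domain\<close>

text \<open>The Riemann mapping theorem is used here for topology alone: the plane can be exhausted
  by squares that are easy to glue along. The map is conformal for the flat metric of the domain,
  not for that of the graph, so it is not the coordinate sought.\<close>

lemma simply_connected_homeomorphic_plane:
  fixes X :: "(real \<times> real) set"
  assumes "open X" "simply_connected X" "X \<noteq> {}"
  shows "(UNIV :: (real \<times> real) set) homeomorphic X"
proof -
  define c where "c = (\<lambda>p::real \<times> real. Complex (fst p) (snd p))"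
  define c' where "c' = (\<lambda>z. (Re z, Im z))"
  have cc: "c' (c p) = p" "c (c' z) = z" for p z by (auto simp: c_def c'_def)
  have cont: "continuous_on S c" "continuous_on S' c'" for S S'
    unfolding c_def c'_def Complex_eq by (auto intro!: continuous_intros)
  have hom: "S homeomorphic c ` S" for S
    unfolding homeomorphic_def homeomorphism_def
    by (rule exI[of _ c], rule exI[of _ c']) (auto simp: cc cont image_iff)
  have "c ` X = c' -` X"
  proof (intro set_eqI iffI)
    fix z assume "z \<in> c' -` X"
    then show "z \<in> c ` X" using cc(2)[of z] by (metis imageI vimageD)
  qed (auto simp: cc)
  then have op: "open (c ` X)"
    using assms(1) continuous_open_vimage[of X c'] cont by (metis continuous_on_eq_continuous_at open_UNIV UNIV_I)
  have "simply_connected (c ` X)"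
    using hom[of X] assms(2) homeomorphic_simply_connected by blast
  then have "c ` X homeomorphic ball (0::complex) 1"
    using simply_connected_eq_homeomorphic_to_disc[OF op] assms(3) by auto
  moreover have "ball (0::complex) 1 homeomorphic (UNIV :: complex set)"
    by (simp add: homeomorphic_ball_UNIV)
  moreover have "c ` UNIV = UNIV" using cc by (metis surjI)
  then have "(UNIV :: complex set) homeomorphic (UNIV :: (real \<times> real) set)"
    using hom[of UNIV] by (metis homeomorphic_sym)
  ultimately show ?thesis
    using hom[of X] by (meson homeomorphic_sym homeomorphic_trans)
qed

text \<open>Monodromy in a bare form. \<open>Q x u\<close> says that u is a valid local solution
  near x, and \<open>A\<close> collects the changes of solution: translations for potentials,
  unimodular factors for the functions with modulus exp (- Green's function).\<close>

locale local_sections =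
  fixes X :: "'a::topological_space set"
    and Q :: "'a \<Rightarrow> ('a \<Rightarrow> 'b) \<Rightarrow> bool"
    and A :: "('b \<Rightarrow> 'b) set"
  assumes open_X: "open X"
    and germ: "\<And>x u v N. Q x u \<Longrightarrow> open N \<Longrightarrow> x \<in> N \<Longrightarrow> (\<And>y. y \<in> N \<Longrightarrow> v y = u y) \<Longrightarrow> Q x v"
    and local: "\<And>x. x \<in> X \<Longrightarrow> \<exists>N u. open N \<and> x \<in> N \<and> (\<forall>y\<in>N. Q y u)"
    and act: "\<And>\<alpha> x u. \<alpha> \<in> A \<Longrightarrow> Q x u \<Longrightarrow> Q x (\<lambda>y. \<alpha> (u y))"
    and trans: "\<And>U u v. open U \<Longrightarrow> connected U \<Longrightarrow> U \<noteq> {} \<Longrightarrow> U \<subseteq> X \<Longrightarrow>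
      (\<And>y. y \<in> U \<Longrightarrow> Q y u) \<Longrightarrow> (\<And>y. y \<in> U \<Longrightarrow> Q y v) \<Longrightarrow> \<exists>\<alpha>\<in>A. \<forall>y\<in>U. \<alpha> (u y) = v y"
begin

text \<open>An element of \<open>A\<close> moves the second section onto the first over the
  connected overlap, and \<open>germ\<close> accepts the function glued from both. That
  \<open>u\<close> itself is left unchanged on \<open>U\<close> is what makes the later exhaustion
  consistent.\<close>

lemma extend_section:
  assumes "open U" "open V" "U \<subseteq> X" "V \<subseteq> X" "connected (U \<inter> V)"
    and u: "\<And>y. y \<in> U \<Longrightarrow> Q y u" and v: "\<And>y. y \<in> V \<Longrightarrow> Q y v"
  obtains w where "\<And>y. y \<in> U \<Longrightarrow> w y = u y" "\<And>y. y \<in> U \<union> V \<Longrightarrow> Q y w"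
proof -
  obtain v' where v': "\<And>y. y \<in> V \<Longrightarrow> Q y v'" "\<And>y. y \<in> U \<inter> V \<Longrightarrow> v' y = u y"
  proof (cases "U \<inter> V = {}")
    case True
    then show ?thesis using that v by blast
  next
    case False
    have "\<exists>\<alpha>\<in>A. \<forall>y\<in>U \<inter> V. \<alpha> (v y) = u y"
      using trans[of "U \<inter> V" v u, OF open_Int[OF assms(1,2)] assms(5) False le_infI1[OF \<open>U \<subseteq> X\<close>]] u v by auto
    then obtain \<alpha> where "\<alpha> \<in> A" "\<forall>y\<in>U \<inter> V. \<alpha> (v y) = u y" by blast
    then show ?thesis using that[of "\<lambda>y. \<alpha> (v y)"] act v by blast
  qed
  define w where "w = (\<lambda>y. if y \<in> U then u y else v' y)"
  show ?thesis
  proof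
    show "w y = u y" if "y \<in> U" for y using that by (simp add: w_def)
    fix y assume "y \<in> U \<union> V"
    then show "Q y w"
    proof
      assume "y \<in> U"
      then show ?thesis using germ[OF u[of y] \<open>open U\<close>] by (simp add: w_def)
    next
      assume "y \<in> V"
      then show ?thesis using germ[OF v'(1)[of y] \<open>open V\<close>, of w] v'(2) by (simp add: w_def)
    qed
  qed
qed

text \<open>In plane coordinates, bisection in one coordinate and then in the other yields sections
  over all boxes; an increasing sequence of squares then yields one over everything.\<close>

theorem global_section:
  assumes "(UNIV :: (real \<times> real) set) homeomorphic X"
  shows "\<exists>u. \<forall>x\<in>X. Q x u"
proof -
  obtain \<theta> \<kappa> where hom: "homeomorphism (UNIV :: (real \<times> real) set) X \<theta> \<kappa>"
    using assms unfolding homeomorphic_def by blast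
  have \<theta>X: "\<theta> p \<in> X" and \<kappa>\<theta>: "\<kappa> (\<theta> p) = p" for p
    using hom unfolding homeomorphism_def by blast+
  have \<theta>\<kappa>: "\<theta> (\<kappa> x) = x" if "x \<in> X" for x using hom that by (auto simp: homeomorphism_def)
  have c\<theta>: "continuous_on S \<theta>" for S
    using hom by (auto simp: homeomorphism_def intro: continuous_on_subset)
  have c\<kappa>: "continuous_on X \<kappa>" using hom by (auto simp: homeomorphism_def)
  have op: "open (\<theta> ` B)" if "open B" for B
  proof -
    have "\<theta> ` B = X \<inter> \<kappa> -` B" using \<theta>X \<kappa>\<theta> \<theta>\<kappa> by force
    then show ?thesis using continuous_open_preimage[OF c\<kappa> open_X that] by simp
  qed
  have con: "connected (\<theta> ` B)" if "connected B" for B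
    using connected_continuous_image[OF c\<theta> that] .
  have int: "\<theta> ` (B \<inter> C) = \<theta> ` B \<inter> \<theta> ` C" for B C using \<kappa>\<theta> by (metis image_Int injI)
  define S where "S = (\<lambda>B. \<exists>u. \<forall>y\<in>\<theta> ` B. Q y u)"
  have S_mono: "S C" if "S B" "C \<subseteq> B" for B C using that unfolding S_def by blast
  have S_Un: "S (B \<union> C)" if S: "S B" "S C" and opBC: "open B" "open C" and conBC: "connected (B \<inter> C)" for B C
  proof -
    obtain u v where u: "\<forall>y\<in>\<theta> ` B. Q y u" and v: "\<forall>y\<in>\<theta> ` C. Q y v"
      using \<open>S B\<close> \<open>S C\<close> unfolding S_def by blast
    have "connected (\<theta> ` B \<inter> \<theta> ` C)" using con[OF conBC] int by simp
    then obtain w where "\<And>y. y \<in> \<theta> ` B \<union> \<theta> ` C \<Longrightarrow> Q y w"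
      using extend_section[of "\<theta> ` B" "\<theta> ` C" u v] op opBC \<theta>X u v by (metis image_subset_iff)
    then show ?thesis unfolding S_def image_Un by blast
  qed
  note loc = local
  have con_box: "connected ({a<..<b} \<times> {c<..<d})" for a b c d :: real
    by (intro connected_Times) auto
  have op_box: "open ({a<..<b} \<times> {c<..<d})" for a b c d :: real
    by (intro open_Times) auto
  \<comment> \<open>The margin \<epsilon> on all sides makes the boxes over two adjacent intervals
    meet in an open box, which is connected, so that \<open>S_Un\<close> applies.\<close>
  have strip: "\<exists>\<epsilon>>0. S ({s - \<epsilon><..<s + \<epsilon>} \<times> {c - \<epsilon><..<d + \<epsilon>})" if "c \<le> d" for s c d :: real
    using that
  proof (induction rule: Bolzano)
    case (trans a b c)
    then obtain \<epsilon>1 \<epsilon>2 where e: "\<epsilon>1 > 0" "\<epsilon>2 > 0" "S ({s - \<epsilon>1<..<s + \<epsilon>1} \<times> {a - \<epsilon>1<..<b + \<epsilon>1})"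
      "S ({s - \<epsilon>2<..<s + \<epsilon>2} \<times> {b - \<epsilon>2<..<c + \<epsilon>2})" by blast
    define \<epsilon> where "\<epsilon> = min \<epsilon>1 \<epsilon>2"
    have "S ({s - \<epsilon><..<s + \<epsilon>} \<times> {a - \<epsilon><..<b + \<epsilon>})" "S ({s - \<epsilon><..<s + \<epsilon>} \<times> {b - \<epsilon><..<c + \<epsilon>})"
      by (rule S_mono[OF e(3)], force simp: \<epsilon>_def) (rule S_mono[OF e(4)], force simp: \<epsilon>_def)
    moreover have "({s - \<epsilon><..<s + \<epsilon>} \<times> {a - \<epsilon><..<b + \<epsilon>}) \<inter> ({s - \<epsilon><..<s + \<epsilon>} \<times> {b - \<epsilon><..<c + \<epsilon>}) = {s - \<epsilon><..<s + \<epsilon>} \<times> {b - \<epsilon><..<b + \<epsilon>}"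
      using trans by auto
    ultimately have "S ({s - \<epsilon><..<s + \<epsilon>} \<times> {a - \<epsilon><..<b + \<epsilon>} \<union> {s - \<epsilon><..<s + \<epsilon>} \<times> {b - \<epsilon><..<c + \<epsilon>})"
      by (intro S_Un op_box) (auto simp: con_box)
    moreover have "\<epsilon> > 0" using e by (simp add: \<epsilon>_def)
    moreover have "{s - \<epsilon><..<s + \<epsilon>} \<times> {a - \<epsilon><..<c + \<epsilon>} \<subseteq> {s - \<epsilon><..<s + \<epsilon>} \<times> {a - \<epsilon><..<b + \<epsilon>} \<union> {s - \<epsilon><..<s + \<epsilon>} \<times> {b - \<epsilon><..<c + \<epsilon>}"
      using \<open>\<epsilon> > 0\<close> trans by auto
    ultimately show ?case using S_mono by blast
  next
    case (local x)
    obtain N u where N: "open N" "\<theta> (s, x) \<in> N" "\<forall>y\<in>N. Q y u" using loc[OF \<theta>X[of "(s, x)"]] by blast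
    have "open (\<theta> -` N)"
      using continuous_open_preimage[OF c\<theta>[of UNIV] open_UNIV \<open>open N\<close>] by simp
    then obtain U V where UV: "open U" "open V" "s \<in> U" "x \<in> V" "U \<times> V \<subseteq> \<theta> -` N"
      by (rule open_prod_elim[of "\<theta> -` N" "(s, x)"]) (use N(2) in auto)
    obtain e1 where e1: "e1 > 0" "ball s e1 \<subseteq> U" using UV openE by blast
    obtain e2 where e2: "e2 > 0" "ball x e2 \<subseteq> V" using UV openE by blast
    \<comment> \<open>An interval of length below e around x, enlarged by e, reaches less than 2 e
      from x; hence half of \<open>e2\<close>.\<close>
    define e where "e = min e1 (e2 / 2)"
    show ?case
    proof (rule exI[of _ e], intro conjI allI impI)
      fix a b assume ab: "a \<le> x \<and> x \<le> b \<and> b - a < e"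
      have "{s - e<..<s + e} \<times> {a - e<..<b + e} \<subseteq> ball s e1 \<times> ball x e2"
        using ab by (auto simp: e_def dist_real_def)
      then have "\<theta> ` ({s - e<..<s + e} \<times> {a - e<..<b + e}) \<subseteq> N" using UV e1 e2 by blast
      then have "S ({s - e<..<s + e} \<times> {a - e<..<b + e})"
        using N unfolding S_def by blast
      then show "\<exists>\<epsilon>>0. S ({s - \<epsilon><..<s + \<epsilon>} \<times> {a - \<epsilon><..<b + \<epsilon>})"
        using e1 e2 by (intro exI[of _ e]) (auto simp: e_def)
    qed (use e1 e2 in \<open>auto simp: e_def\<close>)
  qed
  \<comment> \<open>The same bisection in the first coordinate. The local step is now a whole strip,
    whose vertical margin can be given up.\<close>
  have boxes: "\<exists>\<epsilon>>0. S ({a - \<epsilon><..<b + \<epsilon>} \<times> {c<..<d})" if "a \<le> b" "c < d" for a b c d :: real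
    using that(1)
  proof (induction rule: Bolzano)
    case (trans a b b')
    then obtain \<epsilon>1 \<epsilon>2 where e: "\<epsilon>1 > 0" "\<epsilon>2 > 0" "S ({a - \<epsilon>1<..<b + \<epsilon>1} \<times> {c<..<d})"
      "S ({b - \<epsilon>2<..<b' + \<epsilon>2} \<times> {c<..<d})" by blast
    define \<epsilon> where "\<epsilon> = min \<epsilon>1 \<epsilon>2"
    have "S ({a - \<epsilon><..<b + \<epsilon>} \<times> {c<..<d})" "S ({b - \<epsilon><..<b' + \<epsilon>} \<times> {c<..<d})"
      by (rule S_mono[OF e(3)], force simp: \<epsilon>_def) (rule S_mono[OF e(4)], force simp: \<epsilon>_def)
    moreover have "({a - \<epsilon><..<b + \<epsilon>} \<times> {c<..<d}) \<inter> ({b - \<epsilon><..<b' + \<epsilon>} \<times> {c<..<d}) = {b - \<epsilon><..<b + \<epsilon>} \<times> {c<..<d}"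
      using trans by auto
    ultimately have "S ({a - \<epsilon><..<b + \<epsilon>} \<times> {c<..<d} \<union> {b - \<epsilon><..<b' + \<epsilon>} \<times> {c<..<d})"
      by (intro S_Un op_box) (auto simp: con_box)
    moreover have "\<epsilon> > 0" using e by (simp add: \<epsilon>_def)
    moreover have "{a - \<epsilon><..<b' + \<epsilon>} \<times> {c<..<d} \<subseteq> {a - \<epsilon><..<b + \<epsilon>} \<times> {c<..<d} \<union> {b - \<epsilon><..<b' + \<epsilon>} \<times> {c<..<d}"
      using \<open>\<epsilon> > 0\<close> trans by auto
    ultimately show ?case using S_mono by blast
  next
    case (local x)
    obtain \<epsilon> where \<epsilon>: "\<epsilon> > 0" "S ({x - \<epsilon><..<x + \<epsilon>} \<times> {c - \<epsilon><..<d + \<epsilon>})"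
      using strip[of c d x] \<open>c < d\<close> by auto
    show ?case
    proof (rule exI[of _ "\<epsilon> / 2"], intro conjI allI impI)
      fix a b assume ab: "a \<le> x \<and> x \<le> b \<and> b - a < \<epsilon> / 2"
      then have "{a - \<epsilon> / 2<..<b + \<epsilon> / 2} \<times> {c<..<d} \<subseteq> {x - \<epsilon><..<x + \<epsilon>} \<times> {c - \<epsilon><..<d + \<epsilon>}"
        using \<open>\<epsilon> > 0\<close> by auto
      then show "\<exists>\<epsilon>>0. S ({a - \<epsilon><..<b + \<epsilon>} \<times> {c<..<d})"
        using \<epsilon> S_mono by (intro exI[of _ "\<epsilon> / 2"]) auto
    qed (use \<epsilon> in auto)
  qed
  define B where "B = (\<lambda>n. {- real n - 1<..<real n + 1} \<times> {- real n - 1<..<real n + 1})"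
  have B_mono: "B m \<subseteq> B n" if "m \<le> n" for m n using that by (auto simp: B_def)
  have SB: "S (B n)" for n
  proof -
    obtain \<epsilon> where \<epsilon>: "\<epsilon> > 0" "S ({- real n - 1 - \<epsilon><..<real n + 1 + \<epsilon>} \<times> {- real n - 1<..<real n + 1})"
      using boxes[of "- real n - 1" "real n + 1" "- real n - 1" "real n + 1"] by auto
    show ?thesis by (rule S_mono[OF \<epsilon>(2)]) (use \<epsilon>(1) in \<open>auto simp: B_def\<close>)
  qed
  \<comment> \<open>Sections over successive squares need not agree, so each is corrected to extend
    its predecessor; the values at a fixed point are then eventually constant.\<close>
  have "\<exists>F. \<forall>n. (\<forall>y\<in>\<theta> ` B n. Q y (F n)) \<and> (\<forall>y\<in>\<theta> ` B n. F (Suc n) y = F n y)"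
  proof (rule dependent_nat_choice)
    show "\<exists>u. \<forall>y\<in>\<theta> ` B 0. Q y u" using SB[of 0] unfolding S_def .
  next
    fix u n assume u: "\<forall>y\<in>\<theta> ` B n. Q y u"
    obtain v where v: "\<forall>y\<in>\<theta> ` B (Suc n). Q y v" using SB[of "Suc n"] unfolding S_def ..
    have eq: "\<theta> ` B n \<inter> \<theta> ` B (Suc n) = \<theta> ` B n" using B_mono[of n "Suc n"] by auto
    obtain w where "\<And>y. y \<in> \<theta> ` B n \<Longrightarrow> w y = u y" "\<And>y. y \<in> \<theta> ` B n \<union> \<theta> ` B (Suc n) \<Longrightarrow> Q y w"
    proof (rule extend_section[of "\<theta> ` B n" "\<theta> ` B (Suc n)" u v])
      show "connected (\<theta> ` B n \<inter> \<theta> ` B (Suc n))" unfolding eq by (intro con) (simp add: B_def con_box)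
    qed (use u v \<theta>X in \<open>auto intro!: op simp: B_def op_box\<close>)
    then show "\<exists>w. (\<forall>y\<in>\<theta> ` B (Suc n). Q y w) \<and> (\<forall>y\<in>\<theta> ` B n. w y = u y)" by blast
  qed
  then obtain F where F: "\<And>n y. y \<in> \<theta> ` B n \<Longrightarrow> Q y (F n)" "\<And>n y. y \<in> \<theta> ` B n \<Longrightarrow> F (Suc n) y = F n y"
    by blast
  have F_eq: "F (m + k) y = F m y" if "y \<in> \<theta> ` B m" for m k y
  proof (induction k)
    case (Suc k)
    have "y \<in> \<theta> ` B (m + k)" using that B_mono[of m "m + k"] by auto
    then show ?case using Suc F(2) by simp
  qed simp
  define u where "u = (\<lambda>x. F (LEAST n. x \<in> \<theta> ` B n) x)"
  have u: "u y = F n y" if "y \<in> \<theta> ` B n" for n y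
  proof -
    let ?m = "LEAST n. y \<in> \<theta> ` B n"
    have "y \<in> \<theta> ` B ?m" using that by (rule LeastI)
    moreover have "?m \<le> n" using that by (rule Least_le)
    ultimately show ?thesis using F_eq[of y ?m "n - ?m"] by (simp add: u_def)
  qed
  show ?thesis
  proof (intro exI[of _ u] ballI)
    fix x assume "x \<in> X"
    obtain n where n: "max \<bar>fst (\<kappa> x)\<bar> \<bar>snd (\<kappa> x)\<bar> < real n" using reals_Archimedean2 by blast
    then have "\<kappa> x \<in> B n" by (auto simp: B_def mem_Times_iff)
    then have "x \<in> \<theta> ` B n" using \<theta>\<kappa>[OF \<open>x \<in> X\<close>] by force
    then show "Q x u" using germ[OF F(1) op[of "B n"]] u by (simp add: B_def op_box)
  qed
qed

end

section \<open>Functions holomorphic with respect to a locally injective map\<close>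

text \<open>A Riemann surface spread over the complex plane: \<open>T\<close> is a coordinate near
  every point but may take the same value at distant points. Dimension 2 serves invariance of domain
  and the connectedness of a punctured domain.\<close>

locale flat_surface =
  fixes X :: "'a::euclidean_space set" and T :: "'a \<Rightarrow> complex"
  assumes dim_X: "DIM('a) = 2"
    and plane: "(UNIV :: (real \<times> real) set) homeomorphic X"
    and open_X: "open X" and connected_X: "connected X"
    and cont_T: "continuous_on X T"
    and inj_T: "\<And>q. q \<in> X \<Longrightarrow> \<exists>N. open N \<and> q \<in> N \<and> N \<subseteq> X \<and> inj_on T N"
begin

text \<open>A chart is a section of \<open>T\<close> over a disc. Its coordinate is always
  \<open>T\<close> itself, so no transition maps occur.\<close>

definition chart :: "'a \<Rightarrow> real \<Rightarrow> (complex \<Rightarrow> 'a) \<Rightarrow> bool" where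
  "chart q r s \<longleftrightarrow> r > 0 \<and> continuous_on (ball (T q) r) s \<and> s (T q) = q \<and>
     s ` ball (T q) r \<subseteq> X \<and> (\<forall>w\<in>ball (T q) r. T (s w) = w) \<and> open (s ` ball (T q) r)"

text \<open>Differentiability with respect to the local coordinate \<open>T\<close>.\<close>

definition hol :: "'a set \<Rightarrow> ('a \<Rightarrow> complex) \<Rightarrow> bool" where
  "hol U f \<longleftrightarrow> (\<forall>q\<in>U. \<exists>l. ((\<lambda>x. (f x - f q) / (T x - T q)) \<longlongrightarrow> l) (at q))"

section \<open>Charts, and transfer of holomorphy between the surface and discs\<close>

lemma chartD:
  assumes "chart q r s"
  shows "r > 0" "continuous_on (ball (T q) r) s" "s (T q) = q" "open (s ` ball (T q) r)"
    "w \<in> ball (T q) r \<Longrightarrow> s w \<in> X" "w \<in> ball (T q) r \<Longrightarrow> T (s w) = w"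
    "x \<in> s ` ball (T q) r \<Longrightarrow> s (T x) = x" "x \<in> s ` ball (T q) r \<Longrightarrow> T x \<in> ball (T q) r"
    "q \<in> s ` ball (T q) r"
proof -
  show "q \<in> s ` ball (T q) r"
    using assms unfolding chart_def by (metis centre_in_ball imageI)
qed (use assms in \<open>force simp: chart_def\<close>)+

lemma T_tendsto: "q \<in> X \<Longrightarrow> (T \<longlongrightarrow> T q) (at q)"
  using cont_T open_X by (metis at_within_open continuous_on_def)

text \<open>Invariance of domain makes a continuous injective \<open>T\<close> open on a
  neighbourhood, with continuous inverse; the chart is that inverse over a small disc.\<close>

lemma exists_chart:
  assumes "q \<in> X" "open U" "q \<in> U"
  obtains r s where "chart q r s" "s ` ball (T q) r \<subseteq> U"
proof -
  obtain N where N: "open N" "q \<in> N" "N \<subseteq> X" "inj_on T N" using inj_T[OF assms(1)] by blast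
  define B where "B = N \<inter> U"
  have B: "open B" "q \<in> B" "B \<subseteq> X" "inj_on T B" "B \<subseteq> U"
    using N assms unfolding B_def by (auto intro: inj_on_subset)
  have contB: "continuous_on B T" using cont_T B(3) continuous_on_subset by blast
  have "open (T ` B)" using invariance_of_domain_gen[OF B(1) contB] B(4) dim_X by simp
  then obtain r where r: "r > 0" "ball (T q) r \<subseteq> T ` B" using B(2) openE by blast
  define s where "s = inv_into B T"
  have sT: "s (T x) = x" if "x \<in> B" for x using B(4) that by (simp add: s_def)
  have cs: "continuous_on (T ` B) s"
    by (rule continuous_on_inverse_open[OF B(1) contB _ sT]) (auto simp: dim_X)
  have sB: "s ` ball (T q) r \<subseteq> B" using r(2) sT by auto
  have Ts: "T (s w) = w" if "w \<in> ball (T q) r" for w using r(2) sT that by auto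
  have "s ` ball (T q) r = B \<inter> T -` ball (T q) r"
  proof (intro set_eqI iffI)
    fix x assume "x \<in> B \<inter> T -` ball (T q) r"
    then show "x \<in> s ` ball (T q) r" using sT[of x] by (intro image_eqI[of _ _ "T x"]) auto
  next
    fix x assume "x \<in> s ` ball (T q) r"
    then show "x \<in> B \<inter> T -` ball (T q) r" using sB Ts by auto
  qed
  then have "open (s ` ball (T q) r)"
    using continuous_open_preimage[OF contB B(1) open_ball] by simp
  then have "chart q r s"
    unfolding chart_def using r cs sB B sT Ts by (auto intro: continuous_on_subset)
  then show ?thesis using that sB B(5) by blast
qed

lemma chart_shrink:
  assumes "chart q r s" "w \<in> ball (T q) r" "ball w \<rho> \<subseteq> ball (T q) r" "\<rho> > 0"
  shows "chart (s w) \<rho> s"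
proof -
  note c = chartD[OF assms(1)]
  have "s ` ball w \<rho> = s ` ball (T q) r \<inter> T -` ball w \<rho>"
    using assms(3) c(6) by (auto simp: image_iff subset_iff)
  moreover have "continuous_on (s ` ball (T q) r) T"
    using cont_T c(5) by (meson continuous_on_subset image_subsetI)
  ultimately have "open (s ` ball w \<rho>)" using continuous_open_preimage c(4) open_ball by metis
  then show ?thesis
    unfolding chart_def using c(6)[OF assms(2)] assms c by (auto intro: continuous_on_subset)
qed

lemma hol_subset: "hol U f \<Longrightarrow> V \<subseteq> U \<Longrightarrow> hol V f"
  unfolding hol_def by blast

lemma hol_UnionI: "(\<And>x. x \<in> U \<Longrightarrow> \<exists>V. x \<in> V \<and> hol V f) \<Longrightarrow> hol U f"
  unfolding hol_def by blast

lemma chart_field_derivative: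
  assumes "chart q r s" "w \<in> ball (T q) r"
    and l: "((\<lambda>x. (f x - f (s w)) / (T x - T (s w))) \<longlongrightarrow> l) (at (s w))"
  shows "((\<lambda>w. f (s w)) has_field_derivative l) (at w)"
proof -
  note c = chartD[OF assms(1)] note w = assms(2)
  have "isCont s w" using c(2) w continuous_on_eq_continuous_at open_ball by blast
  moreover have ev: "\<forall>\<^sub>F v in at w. v \<in> ball (T q) r \<and> v \<noteq> w"
    using eventually_at_in_open[OF open_ball w] by eventually_elim auto
  then have "\<forall>\<^sub>F v in at w. s v \<noteq> s w"
    by eventually_elim (use c(6) w in metis)
  ultimately have "filterlim s (at (s w)) (at w)"
    by (auto simp: filterlim_at isCont_def)
  then have "((\<lambda>v. (f (s v) - f (s w)) / (T (s v) - T (s w))) \<longlongrightarrow> l) (at w)"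
    using filterlim_compose[OF l] by blast
  moreover have "\<forall>\<^sub>F v in at w. (f (s v) - f (s w)) / (T (s v) - T (s w)) = (f (s v) - f (s w)) / (v - w)"
    using ev by eventually_elim (use c(6) w in auto)
  ultimately have "((\<lambda>v. (f (s v) - f (s w)) / (v - w)) \<longlongrightarrow> l) (at w)"
    by (rule Lim_transform_eventually)
  then show ?thesis unfolding has_field_derivative_iff .
qed

lemma hol_chart:
  assumes "chart q r s" "hol U f" "s ` ball (T q) r \<subseteq> U"
  shows "(\<lambda>w. f (s w)) holomorphic_on ball (T q) r"
  unfolding holomorphic_on_open[OF open_ball]
proof
  fix w assume w: "w \<in> ball (T q) r"
  then have "s w \<in> U" using assms(3) by blast
  then show "\<exists>f'. ((\<lambda>w. f (s w)) has_field_derivative f') (at w)"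
    using assms(2) chart_field_derivative[OF assms(1) w] unfolding hol_def by blast
qed

lemma hol_from_chart:
  assumes "chart q r s" "(\<lambda>w. f (s w)) holomorphic_on ball (T q) r"
  shows "hol (s ` ball (T q) r) f"
  unfolding hol_def
proof
  note c = chartD[OF assms(1)]
  fix x assume x: "x \<in> s ` ball (T q) r"
  then have w: "T x \<in> ball (T q) r" "s (T x) = x" "x \<in> X" using c by auto
  obtain l where "((\<lambda>w. f (s w)) has_field_derivative l) (at (T x))"
    using assms(2) w holomorphic_on_open[OF open_ball] by blast
  then have l: "((\<lambda>v. (f (s v) - f x) / (v - T x)) \<longlongrightarrow> l) (at (T x))"
    unfolding has_field_derivative_iff using w(2) by simp
  have ev: "\<forall>\<^sub>F y in at x. y \<in> s ` ball (T q) r \<and> y \<noteq> x"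
    using eventually_at_in_open[OF c(4) x] by eventually_elim auto
  then have "\<forall>\<^sub>F y in at x. T y \<noteq> T x"
    by eventually_elim (use c(7) w in metis)
  then have "filterlim T (at (T x)) (at x)"
    using T_tendsto[OF w(3)] by (auto simp: filterlim_at)
  then have "((\<lambda>y. (f (s (T y)) - f x) / (T y - T x)) \<longlongrightarrow> l) (at x)"
    using filterlim_compose[OF l] by blast
  moreover have "\<forall>\<^sub>F y in at x. (f (s (T y)) - f x) / (T y - T x) = (f y - f x) / (T y - T x)"
    using ev by eventually_elim (use c(7) in auto)
  ultimately have "((\<lambda>y. (f y - f x) / (T y - T x)) \<longlongrightarrow> l) (at x)"
    by (rule Lim_transform_eventually)
  then show "\<exists>l. ((\<lambda>y. (f y - f x) / (T y - T x)) \<longlongrightarrow> l) (at x)" ..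
qed

lemma hol_chartI:
  assumes "open U" "U \<subseteq> X"
    and "\<And>q r s. q \<in> U \<Longrightarrow> chart q r s \<Longrightarrow> s ` ball (T q) r \<subseteq> U \<Longrightarrow> (\<lambda>w. f (s w)) holomorphic_on ball (T q) r"
  shows "hol U f"
proof (rule hol_UnionI)
  fix x assume "x \<in> U"
  have "x \<in> X" using \<open>x \<in> U\<close> assms(2) by blast
  from exists_chart[OF this assms(1) \<open>x \<in> U\<close>]
  obtain r s where c: "chart x r s" "s ` ball (T x) r \<subseteq> U" .
  then show "\<exists>V. x \<in> V \<and> hol V f"
    using hol_from_chart[OF c(1) assms(3)[OF \<open>x \<in> U\<close> c]] chartD(9)[OF c(1)] by blast
qed

lemma hol_cong:
  assumes "open U" "U \<subseteq> X" "hol U f" "\<And>x. x \<in> U \<Longrightarrow> f x = g x"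
  shows "hol U g"
proof (rule hol_chartI[OF assms(1,2)])
  fix q r s assume *: "q \<in> U" "chart q r s" "s ` ball (T q) r \<subseteq> U"
  have "f (s w) = g (s w)" if "w \<in> ball (T q) r" for w using assms(4) *(3) that by blast
  then show "(\<lambda>w. g (s w)) holomorphic_on ball (T q) r"
    using hol_chart[OF *(2) assms(3) *(3)] holomorphic_cong by (metis (no_types, lifting))
qed

lemma hol_T: "hol X T"
proof (rule hol_chartI[OF open_X order_refl])
  fix q r s assume "chart q r s"
  then show "(\<lambda>w. T (s w)) holomorphic_on ball (T q) r"
    using chartD(6) by (metis (no_types, lifting) holomorphic_cong holomorphic_on_ident)
qed

lemma hol_compose:
  assumes "open U" "U \<subseteq> X" "hol U f" "h holomorphic_on V" "f ` U \<subseteq> V"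
  shows "hol U (\<lambda>x. h (f x))"
proof (rule hol_chartI[OF assms(1,2)])
  fix q r s assume *: "q \<in> U" "chart q r s" "s ` ball (T q) r \<subseteq> U"
  show "(\<lambda>w. h (f (s w))) holomorphic_on ball (T q) r"
    using holomorphic_on_compose_gen[OF hol_chart[OF *(2) assms(3) *(3)] assms(4)] assms(5) *(3)
    by (auto simp: o_def)
qed

lemma hol_divide:
  assumes "open U" "U \<subseteq> X" "hol U f" "hol U g" "\<And>x. x \<in> U \<Longrightarrow> g x \<noteq> 0"
  shows "hol U (\<lambda>x. f x / g x)"
proof (rule hol_chartI[OF assms(1,2)])
  fix q r s assume *: "q \<in> U" "chart q r s" "s ` ball (T q) r \<subseteq> U"
  show "(\<lambda>w. f (s w) / g (s w)) holomorphic_on ball (T q) r"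
    using hol_chart[OF *(2) assms(3) *(3)] hol_chart[OF *(2) assms(4) *(3)]
    by (rule holomorphic_on_divide) (use assms(5) *(3) in blast)
qed

lemma hol_continuous:
  assumes "open U" "U \<subseteq> X" "hol U f"
  shows "continuous_on U f"
proof -
  have "isCont f x" if x: "x \<in> U" for x
  proof -
    obtain r s where rs: "chart x r s" "s ` ball (T x) r \<subseteq> U" by (rule exists_chart[of x U]) (use assms(1,2) x in blast)+
    note c = chartD[OF rs(1)]
    have "continuous_on (s ` ball (T x) r) T" using cont_T rs(2) assms(2) continuous_on_subset by (metis subset_trans)
    moreover have "continuous_on (ball (T x) r) (\<lambda>w. f (s w))"
      using hol_chart[OF rs(1) assms(3) rs(2)] holomorphic_on_imp_continuous_on by blast
    ultimately have "continuous_on (s ` ball (T x) r) (\<lambda>y. f (s (T y)))"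
      using continuous_on_compose2[of "ball (T x) r" "\<lambda>w. f (s w)" _ T] c(8) by blast
    then have "continuous_on (s ` ball (T x) r) f"
      by (rule continuous_on_eq) (use c(7) in auto)
    then show ?thesis using c(4,9) continuous_on_eq_continuous_at by blast
  qed
  then show ?thesis by (simp add: continuous_at_imp_continuous_on)
qed

text \<open>The difference quotient converges, hence is bounded near q. The resulting linear bound
  is the condition that the maximum principle imposes at the pole.\<close>

lemma hol_bound_near:
  assumes "q \<in> U" "U \<subseteq> X" "hol U f" "f q = 0"
  shows "\<exists>C. \<forall>\<^sub>F x in at q. cmod (f x) \<le> C * cmod (T x - T q)"
proof -
  obtain l where l: "((\<lambda>x. (f x - f q) / (T x - T q)) \<longlongrightarrow> l) (at q)"
    using assms(1,3) unfolding hol_def by blast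
  have "q \<in> X" using assms(1,2) by blast
  then obtain N where N: "open N" "q \<in> N" "N \<subseteq> X" "inj_on T N" using inj_T[of q] by blast
  have "\<forall>\<^sub>F x in at q. cmod ((f x - f q) / (T x - T q)) < cmod l + 1"
    by (rule order_tendstoD(2)[OF tendsto_norm[OF l]]) simp
  moreover have "\<forall>\<^sub>F x in at q. x \<in> N \<and> x \<noteq> q"
    using eventually_at_in_open[OF N(1,2)] by eventually_elim auto
  ultimately have "\<forall>\<^sub>F x in at q. cmod (f x) \<le> (cmod l + 1) * cmod (T x - T q)"
  proof eventually_elim
    case (elim x)
    then have "T x - T q \<noteq> 0" using N(2,4) by (auto dest: inj_onD)
    then show ?case using elim assms(4) by (simp add: norm_divide pos_divide_less_eq)
  qed
  then show ?thesis by blast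
qed

text \<open>The set where f takes the value \<open>f x0\<close> is closed by continuity and open by
  the classical principle in charts, because the modulus is maximal at each of its points.\<close>

lemma max_modulus_constant:
  assumes "open U" "connected U" "U \<subseteq> X" "hol U f" "\<And>x. x \<in> U \<Longrightarrow> cmod (f x) \<le> 1"
    "x0 \<in> U" "cmod (f x0) = 1" "x \<in> U"
  shows "f x = f x0"
proof -
  have cont: "continuous_on U f" by (rule hol_continuous[OF assms(1,3,4)])
  have cl: "closedin (top_of_set U) {x \<in> U. f x = f x0}"
    by (rule continuous_closedin_preimage_constant[OF cont])
  have "open {x \<in> U. f x = f x0}"
  proof (rule openI)
    fix y assume "y \<in> {x \<in> U. f x = f x0}"
    then have y: "y \<in> U" "f y = f x0" by auto
    obtain r s where rs: "chart y r s" "s ` ball (T y) r \<subseteq> U"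
      by (rule exists_chart[of y U]) (use assms(1,3) y(1) in blast)+
    note c = chartD[OF rs(1)]
    have "(\<lambda>w. f (s w)) constant_on ball (T y) r"
    proof (rule maximum_modulus_principle[OF hol_chart[OF rs(1) assms(4) rs(2)] open_ball _ open_ball order_refl])
      show "T y \<in> ball (T y) r" using c by simp
      show "cmod (f (s z)) \<le> cmod (f (s (T y)))" if "z \<in> ball (T y) r" for z
      proof -
        have "s z \<in> U" using rs(2) that by blast
        then show ?thesis using assms(5,7) y c(3) by simp
      qed
    qed auto
    have "s ` ball (T y) r \<subseteq> {x \<in> U. f x = f x0}"
    proof -
      obtain k where k: "\<And>w. w \<in> ball (T y) r \<Longrightarrow> f (s w) = k"
        using \<open>(\<lambda>w. f (s w)) constant_on ball (T y) r\<close> unfolding constant_on_def by blast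
      have "k = f x0" using k[of "T y"] y c(1,3) by simp
      then show ?thesis using k rs(2) by blast
    qed
    then show "\<exists>e>0. ball y e \<subseteq> {x \<in> U. f x = f x0}" using c(4,9) by (meson openE subset_trans)
  qed
  then have "openin (top_of_set U) {x \<in> U. f x = f x0}" by (intro open_subset) auto
  then have "{x \<in> U. f x = f x0} = U" using cl assms(2,6) connected_clopen by blast
  then show ?thesis using assms(8) by blast
qed

text \<open>Identity theorem. The set \<open>Z\<close> of points near which f vanishes identically
  is open; so is its complement, because zeros are isolated in any chart on which f is not
  identically zero. As f is not constant, connectedness leaves \<open>Z\<close> empty.\<close>

lemma chart_eventually_nonzero:
  assumes f: "hol X f" "\<not> f constant_on X" "f p = 0" "p \<in> X" and "chart q r s"
  shows "\<forall>\<^sub>F w in at (T q). f (s w) \<noteq> 0"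
proof -
  define Z where "Z = {x. \<exists>N. open N \<and> x \<in> N \<and> N \<subseteq> X \<and> (\<forall>y\<in>N. f y = 0)}"
  have nz: "\<forall>\<^sub>F w in at (T x). f (s w) \<noteq> 0" if ch: "chart x r s" and ne: "\<not> (\<forall>w\<in>ball (T x) r. f (s w) = 0)" for x r s
  proof -
    have sX: "s ` ball (T x) r \<subseteq> X" using chartD(5)[OF ch] by blast
    obtain \<beta> where \<beta>: "\<beta> \<in> ball (T x) r" "f (s \<beta>) \<noteq> 0" using ne by blast
    have "\<forall>\<^sub>F w in at (T x). f (s w) \<noteq> 0 \<and> w \<in> ball (T x) r"
      by (rule non_zero_neighbour_alt[OF hol_chart[OF ch f(1) sX] _ _ _ \<beta>]) (use chartD(1)[OF ch] in auto)
    then show ?thesis by eventually_elim simp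
  qed
  have "openin (top_of_set X) Z"
  proof (rule open_subset)
    have "Z = \<Union>{N. open N \<and> N \<subseteq> X \<and> (\<forall>y\<in>N. f y = 0)}" unfolding Z_def by blast
    then show "open Z" by (metis (mono_tags, lifting) mem_Collect_eq open_Union)
  qed (auto simp: Z_def)
  moreover have "open (X - Z)"
  proof (rule openI)
    fix x assume x: "x \<in> X - Z"
    obtain r s where rs: "chart x r s" "s ` ball (T x) r \<subseteq> X" by (rule exists_chart[of x X]) (use open_X x in blast)+
    note c = chartD[OF rs(1)]
    have "\<not> (\<forall>w\<in>ball (T x) r. f (s w) = 0)"
    proof
      assume "\<forall>w\<in>ball (T x) r. f (s w) = 0"
      then have "x \<in> Z" unfolding Z_def using rs(2) c(4,9) by (intro CollectI exI[of _ "s ` ball (T x) r"]) blast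
      then show False using x by simp
    qed
    from nz[OF rs(1) this] obtain d where d: "d > 0" "\<And>w. w \<noteq> T x \<Longrightarrow> dist w (T x) < d \<Longrightarrow> f (s w) \<noteq> 0"
      unfolding eventually_at by auto
    define d' where "d' = min d r"
    have d'0: "d' > 0" "ball (T x) d' \<subseteq> ball (T x) r" "T x \<in> ball (T x) r"
      using c(1) d(1) unfolding d'_def by auto
    have "chart x d' s" using chart_shrink[OF rs(1) d'0(3,2,1)] c(3) by simp
    from chartD(4,9)[OF this] have op: "open (s ` ball (T x) d')" "x \<in> s ` ball (T x) d'" .
    have "y \<notin> Z" if y: "y \<in> s ` ball (T x) d'" "y \<noteq> x" for y
    proof
      assume "y \<in> Z"
      then have "f y = 0" unfolding Z_def by blast
      obtain w where w: "w \<in> ball (T x) d'" "y = s w" using y by blast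
      then have "w \<noteq> T x" using y c(3) by auto
      then show False using d w \<open>f y = 0\<close> by (auto simp: d'_def dist_commute)
    qed
    moreover have "s ` ball (T x) d' \<subseteq> X" using rs(2) d'0(2) by blast
    ultimately have "s ` ball (T x) d' \<subseteq> X - Z" using x by blast
    then show "\<exists>e>0. ball x e \<subseteq> X - Z" using op by (meson openE subset_trans)
  qed
  then have "closedin (top_of_set X) Z"
    using open_X unfolding closedin_def by (auto simp: openin_open_eq Z_def)
  ultimately consider "Z = {}" | "Z = X" using connected_X connected_clopen by blast
  then have "Z = {}"
  proof cases
    case 2
    then have "\<forall>x\<in>X. f x = 0" by (auto simp: Z_def)
    then show ?thesis using f(2) unfolding constant_on_def by blast
  qed
  have "\<not> (\<forall>w\<in>ball (T q) r. f (s w) = 0)"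
  proof
    assume "\<forall>w\<in>ball (T q) r. f (s w) = 0"
    then have "q \<in> Z" unfolding Z_def using chartD(4,5,9)[OF assms(5)]
      by (intro CollectI exI[of _ "s ` ball (T q) r"]) blast
    then show False using \<open>Z = {}\<close> by simp
  qed
  then show ?thesis using nz assms(5) by blast
qed

end

section \<open>A maximum principle\<close>

lemma maximum_modulus_cball:
  assumes "f holomorphic_on ball c t" "continuous_on (cball c t) f" "t > 0"
    "\<And>w. w \<in> sphere c t \<Longrightarrow> cmod (f w) \<le> B" "z \<in> cball c t"
  shows "cmod (f z) \<le> B"
proof (rule maximum_modulus_frontier[of f "cball c t"])
  show "f holomorphic_on interior (cball c t)" using assms(1) by (simp add: interior_cball)
  show "continuous_on (closure (cball c t)) f" using assms(2) by simp
  show "cmod (f w) \<le> B" if "w \<in> frontier (cball c t)" for w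
    using assms(4)[of w] that assms(3) by simp
qed (use assms in auto)

context flat_surface
begin

text \<open>\<open>dominates \<sigma> q\<close> is the super-mean-value property of \<open>ln \<sigma>\<close> on small circles around \<open>q\<close>,
  phrased without logarithms and integrals; \<open>\<phi>\<close> may have zeros.\<close>

definition submean :: "('a \<Rightarrow> real) \<Rightarrow> 'a \<Rightarrow> (complex \<Rightarrow> 'a) \<Rightarrow> real \<Rightarrow> bool" where
  "submean \<sigma> q s t \<longleftrightarrow> (\<forall>\<phi>. \<phi> holomorphic_on ball (T q) t \<longrightarrow> continuous_on (cball (T q) t) \<phi> \<longrightarrow>
     (\<forall>w\<in>sphere (T q) t. cmod (\<phi> w) \<le> \<sigma> (s w)) \<longrightarrow> cmod (\<phi> (T q)) \<le> \<sigma> q)"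

definition dominates :: "('a \<Rightarrow> real) \<Rightarrow> 'a \<Rightarrow> bool" where
  "dominates \<sigma> q \<longleftrightarrow> (\<forall>r s. chart q r s \<longrightarrow> (\<exists>\<rho>>0. \<forall>t. 0 < t \<longrightarrow> t < \<rho> \<longrightarrow> t < r \<longrightarrow> submean \<sigma> q s t))"

lemma submeanD:
  assumes "submean \<sigma> q s t" "\<phi> holomorphic_on ball (T q) t" "continuous_on (cball (T q) t) \<phi>"
    "\<And>w. w \<in> sphere (T q) t \<Longrightarrow> cmod (\<phi> w) \<le> \<sigma> (s w)"
  shows "cmod (\<phi> (T q)) \<le> \<sigma> q"
  using assms unfolding submean_def by simp

lemma dominatesD:
  assumes "dominates \<sigma> q" "chart q r s"
  obtains \<rho> where "\<rho> > 0" "\<And>t. 0 < t \<Longrightarrow> t < \<rho> \<Longrightarrow> t < r \<Longrightarrow> submean \<sigma> q s t"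
  using assms unfolding dominates_def by blast

lemma dominatesI:
  assumes "\<And>r s. chart q r s \<Longrightarrow> \<exists>\<rho>>0. \<forall>t. 0 < t \<longrightarrow> t < \<rho> \<longrightarrow> t < r \<longrightarrow> submean \<sigma> q s t"
  shows "dominates \<sigma> q"
  using assms unfolding dominates_def by blast

section \<open>Stability of the super-mean-value property\<close>

lemma chart_near:
  assumes "chart q r s" "open N" "q \<in> N"
  obtains \<rho> where "\<rho> > 0" "\<rho> \<le> r" "s ` ball (T q) \<rho> \<subseteq> N" "chart q \<rho> s"
proof -
  note c = chartD[OF assms(1)]
  have "open (ball (T q) r \<inter> s -` N)"
    using continuous_open_preimage[OF c(2) open_ball assms(2)] .
  moreover have "T q \<in> ball (T q) r \<inter> s -` N" using c(1,3) assms(3) by simp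
  ultimately obtain e where e: "e > 0" "ball (T q) e \<subseteq> ball (T q) r \<inter> s -` N"
    using openE by blast
  define \<rho> where "\<rho> = min e r"
  have \<rho>: "\<rho> > 0" "\<rho> \<le> r" "ball (T q) \<rho> \<subseteq> ball (T q) r" "ball (T q) \<rho> \<subseteq> ball (T q) e"
    using e(1) c(1) unfolding \<rho>_def by auto
  have "chart q \<rho> s" using chart_shrink[OF assms(1) _ \<rho>(3,1)] c(1,3) by simp
  moreover have "s ` ball (T q) \<rho> \<subseteq> N" using \<rho>(4) e(2) by blast
  ultimately show ?thesis using that \<rho> by blast
qed

text \<open>Touching from below: a test function below \<tau> on a small circle is below \<sigma>
  there, hence at the centre below the common value. This handles the seams of functions glued from
  two formulas.\<close>

lemma dominates_mono:
  assumes "dominates \<sigma> q" "open N" "q \<in> N" "\<And>x. x \<in> N \<Longrightarrow> \<tau> x \<le> \<sigma> x" "\<tau> q = \<sigma> q"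
  shows "dominates \<tau> q"
proof (rule dominatesI)
  fix r s assume c: "chart q r s"
  obtain \<rho>1 where \<rho>1: "\<rho>1 > 0" "\<And>t. 0 < t \<Longrightarrow> t < \<rho>1 \<Longrightarrow> t < r \<Longrightarrow> submean \<sigma> q s t" using dominatesD[OF assms(1) c] by blast
  obtain \<rho>2 where \<rho>2: "\<rho>2 > 0" "\<rho>2 \<le> r" "s ` ball (T q) \<rho>2 \<subseteq> N" "chart q \<rho>2 s"
    by (rule chart_near[OF c assms(2,3)])
  show "\<exists>\<rho>>0. \<forall>t. 0 < t \<longrightarrow> t < \<rho> \<longrightarrow> t < r \<longrightarrow> submean (\<tau>) q s t"
  proof (rule exI[of _ "min \<rho>1 \<rho>2"], intro conjI allI impI)
    fix t assume h0: "0 < t" "t < min \<rho>1 \<rho>2" "t < r"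
    show "submean (\<tau>) q s t" unfolding submean_def
    proof (intro allI impI)
      fix \<phi> assume h1: "\<phi> holomorphic_on ball (T q) t"
        "continuous_on (cball (T q) t) \<phi>" "\<forall>w\<in>sphere (T q) t. cmod (\<phi> w) \<le> \<tau> (s w)"
      note h = h0 h1
      have "cmod (\<phi> w) \<le> \<sigma> (s w)" if w: "w \<in> sphere (T q) t" for w
      proof -
        have "w \<in> ball (T q) \<rho>2" using w h(2) by simp
        then have "s w \<in> N" using \<rho>2(3) by blast
        then show ?thesis using assms(4) h(6) w order_trans by blast
      qed
      then show "cmod (\<phi> (T q)) \<le> \<tau> q" using submeanD[OF \<rho>1(2)[of t] h(4,5)] h(1-3) assms(5) by simp
    qed
  qed (use \<rho>1 \<rho>2 in simp)
qed

lemma dominates_min: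
  assumes "dominates \<sigma> q" "dominates \<tau> q"
  shows "dominates (\<lambda>x. min (\<sigma> x) (\<tau> x)) q"
proof (rule dominatesI)
  fix r s assume c: "chart q r s"
  obtain \<rho>1 where \<rho>1: "\<rho>1 > 0" "\<And>t. 0 < t \<Longrightarrow> t < \<rho>1 \<Longrightarrow> t < r \<Longrightarrow> submean \<sigma> q s t" using dominatesD[OF assms(1) c] by blast
  obtain \<rho>2 where \<rho>2: "\<rho>2 > 0" "\<And>t. 0 < t \<Longrightarrow> t < \<rho>2 \<Longrightarrow> t < r \<Longrightarrow> submean \<tau> q s t" using dominatesD[OF assms(2) c] by blast
  show "\<exists>\<rho>>0. \<forall>t. 0 < t \<longrightarrow> t < \<rho> \<longrightarrow> t < r \<longrightarrow> submean (\<lambda>x. min (\<sigma> x) (\<tau> x)) q s t"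
  proof (rule exI[of _ "min \<rho>1 \<rho>2"], intro conjI allI impI)
    fix t assume h0: "0 < t" "t < min \<rho>1 \<rho>2" "t < r"
    show "submean (\<lambda>x. min (\<sigma> x) (\<tau> x)) q s t" unfolding submean_def
    proof (intro allI impI)
      fix \<phi> assume h1: "\<phi> holomorphic_on ball (T q) t"
        "continuous_on (cball (T q) t) \<phi>" "\<forall>w\<in>sphere (T q) t. cmod (\<phi> w) \<le> min (\<sigma> (s w)) (\<tau> (s w))"
      note h = h0 h1
      show "cmod (\<phi> (T q)) \<le> min (\<sigma> q) (\<tau> q)"
        using submeanD[OF \<rho>1(2)[of t] h(4,5)] submeanD[OF \<rho>2(2)[of t] h(4,5)] h(1-3,6) by simp
    qed
  qed (use \<rho>1 \<rho>2 in simp)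
qed

text \<open>Where \<theta> has no zeros, a test function \<phi> may be divided by it, and the
  maximum modulus principle applies to the quotient.\<close>

lemma dominates_cmod:
  assumes "open N" "q \<in> N" "N \<subseteq> X" "hol N \<theta>" "\<And>x. x \<in> N \<Longrightarrow> \<theta> x \<noteq> 0"
  shows "dominates (\<lambda>x. cmod (\<theta> x)) q"
proof (rule dominatesI)
  fix r s assume c: "chart q r s"
  obtain \<rho> where \<rho>: "\<rho> > 0" "\<rho> \<le> r" "s ` ball (T q) \<rho> \<subseteq> N" "chart q \<rho> s"
    by (rule chart_near[OF c assms(1,2)])
  note hs = hol_chart[OF \<rho>(4) assms(4) \<rho>(3)]
  have nz: "\<theta> (s w) \<noteq> 0" if "w \<in> ball (T q) \<rho>" for w using that \<rho>(3) assms(5) by blast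
  show "\<exists>\<rho>>0. \<forall>t. 0 < t \<longrightarrow> t < \<rho> \<longrightarrow> t < r \<longrightarrow> submean (\<lambda>x. cmod (\<theta> x)) q s t"
  proof (rule exI[of _ \<rho>], intro conjI allI impI)
    fix t assume h0: "0 < t" "t < \<rho>" "t < r"
    show "submean (\<lambda>x. cmod (\<theta> x)) q s t" unfolding submean_def
    proof (intro allI impI)
      fix \<phi> assume h1: "\<phi> holomorphic_on ball (T q) t"
        "continuous_on (cball (T q) t) \<phi>" "\<forall>w\<in>sphere (T q) t. cmod (\<phi> w) \<le> cmod (\<theta> (s w))"
      note h = h0 h1
      have sub: "cball (T q) t \<subseteq> ball (T q) \<rho>" "ball (T q) t \<subseteq> ball (T q) \<rho>" "sphere (T q) t \<subseteq> ball (T q) \<rho>"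
        using h(2) by auto
      have "cmod (\<phi> (T q) / \<theta> (s (T q))) \<le> 1"
      proof (rule maximum_modulus_cball[of "\<lambda>w. \<phi> w / \<theta> (s w)" "T q" t 1 "T q"])
        show "(\<lambda>w. \<phi> w / \<theta> (s w)) holomorphic_on ball (T q) t"
          using holomorphic_on_subset[OF hs sub(2)] nz sub(2) h(4) by (intro holomorphic_on_divide) auto
        show "continuous_on (cball (T q) t) (\<lambda>w. \<phi> w / \<theta> (s w))"
          using continuous_on_subset[OF holomorphic_on_imp_continuous_on[OF hs] sub(1)] nz sub(1) h(5)
          by (intro continuous_on_divide) auto
        show "cmod (\<phi> w / \<theta> (s w)) \<le> 1" if w: "w \<in> sphere (T q) t" for w
        proof -
          have "\<theta> (s w) \<noteq> 0" using nz w sub(3) by blast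
          then show ?thesis using h(6) w by (simp add: norm_divide)
        qed
      qed (use h in auto)
      then show "cmod (\<phi> (T q)) \<le> cmod (\<theta> q)"
        using chartD(3)[OF c] assms(2,5) by (simp add: norm_divide)
    qed
  qed (use \<rho> in simp)
qed

text \<open>The quotient \<open>v powr (1 + \<epsilon>) * exp (\<delta> * (cmod T)\<^sup>2) / \<sigma>\<close> has no interior maximum: the factor with \<open>\<delta>\<close>
  makes the logarithm of the numerator strictly subharmonic, and \<open>\<epsilon>\<close> makes the quotient
  tend to 0 at \<open>p\<close>.\<close>

lemma max_principle:
  fixes v \<sigma> :: "'a \<Rightarrow> real"
  assumes K: "compact K" "K \<subseteq> X" and U: "open U" "U \<subseteq> K"
    and \<sigma>: "continuous_on X \<sigma>" "\<And>x. x \<in> X \<Longrightarrow> \<sigma> x \<le> 1" "\<And>x. x \<in> X - {p} \<Longrightarrow> \<sigma> x > 0"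
    "\<And>q. q \<in> U - {p} \<Longrightarrow> dominates \<sigma> q"
    "c > 0" "\<forall>\<^sub>F x in at p. c * cmod (T x - T p) \<le> \<sigma> x"
    and v: "continuous_on K v" "\<And>x. x \<in> K \<Longrightarrow> v x \<ge> 0" "\<And>x. x \<in> K - U \<Longrightarrow> v x \<le> \<sigma> x"
    "\<And>q. q \<in> U - {p} \<Longrightarrow> \<exists>N \<phi>. open N \<and> q \<in> N \<and> N \<subseteq> X \<and> hol N \<phi> \<and> (\<forall>x\<in>N. v x = cmod (\<phi> x))"
    and p: "p \<in> K \<Longrightarrow> v p = 0" "p \<in> K \<Longrightarrow> \<exists>C. \<forall>\<^sub>F x in at p. v x \<le> C * cmod (T x - T p)"
    and x0: "x0 \<in> K" "x0 \<noteq> p"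
  shows "v x0 \<le> \<sigma> x0"
proof (rule ccontr)
  assume "\<not> v x0 \<le> \<sigma> x0"
  then have gt: "v x0 > \<sigma> x0" by simp
  have s0: "\<sigma> x0 > 0" using \<sigma>(3) x0 K(2) by blast
  then have v0: "v x0 > 0" using gt by simp
  have "isCont (\<lambda>\<epsilon>. v x0 powr (1 + \<epsilon>)) 0" using v0 by (intro continuous_intros) auto
  then have "((\<lambda>\<epsilon>. v x0 powr (1 + \<epsilon>)) \<longlongrightarrow> v x0) (at_right 0)"
    using v0 by (simp add: isCont_def filterlim_at_split)
  then have "\<forall>\<^sub>F \<epsilon> in at_right 0. v x0 powr (1 + \<epsilon>) > \<sigma> x0" using gt order_tendstoD(1) by blast
  moreover have "\<forall>\<^sub>F \<epsilon> in at_right (0::real). \<epsilon> > 0" by (simp add: eventually_at_right_less)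
  ultimately have "\<forall>\<^sub>F \<epsilon> in at_right 0. v x0 powr (1 + \<epsilon>) > \<sigma> x0 \<and> \<epsilon> > 0" by (rule eventually_conj)
  then obtain \<epsilon> where \<epsilon>: "\<epsilon> > 0" "v x0 powr (1 + \<epsilon>) > \<sigma> x0"
    using eventually_happens' by (metis (no_types, lifting) trivial_limit_at_right_real)
  \<comment> \<open>\<open>A\<close> is a level that the quotient \<open>Q\<close> reaches at
    \<open>x0\<close>. With the \<delta> below, the exponential factor is at most the square root of
    A on K, so \<open>Q\<close> stays below \<open>A\<close> on K - U, where the remaining factor is
    at most 1.\<close>
  define A where "A = v x0 powr (1 + \<epsilon>) / \<sigma> x0"
  have A1: "A > 1" using \<epsilon> s0 by (simp add: A_def)
  have contT: "continuous_on K T" using cont_T K(2) continuous_on_subset by blast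
  have cont\<sigma>: "continuous_on K \<sigma>" using \<sigma>(1) K(2) continuous_on_subset by blast
  have "compact (T ` K)" using compact_continuous_image[OF contT K(1)] .
  then obtain b where b: "b > 0" "\<And>x. x \<in> K \<Longrightarrow> cmod (T x) \<le> b"
    using compact_imp_bounded bounded_pos by (metis imageI)
  define B where "B = b\<^sup>2"
  have B: "B > 0" "\<And>x. x \<in> K \<Longrightarrow> (cmod (T x))\<^sup>2 \<le> B" using b by (auto simp: B_def intro: power_mono)
  define \<delta> where "\<delta> = ln A / (2 * B)"
  have \<delta>: "\<delta> > 0" using A1 B by (simp add: \<delta>_def)
  have e\<delta>: "exp (\<delta> * (cmod (T x))\<^sup>2) < A" if "x \<in> K" for x
  proof -
    have "\<delta> * (cmod (T x))\<^sup>2 \<le> \<delta> * B" using B that \<delta> by (intro mult_left_mono) auto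
    also have "\<dots> = ln A / 2" using B by (simp add: \<delta>_def)
    also have "\<dots> < ln A" using A1 by simp
    finally show ?thesis using A1 by (metis exp_less_cancel_iff exp_ln less_trans zero_less_one)
  qed
  define Q where "Q = (\<lambda>x. v x powr (1 + \<epsilon>) * exp (\<delta> * (cmod (T x))\<^sup>2) / \<sigma> x)"
  have Q0: "Q x0 \<ge> A"
  proof -
    have "exp (\<delta> * (cmod (T x0))\<^sup>2) \<ge> 1" using \<delta> by simp
    then have "A * 1 \<le> A * exp (\<delta> * (cmod (T x0))\<^sup>2)" using A1 by (intro mult_left_mono) auto
    then show ?thesis by (simp add: Q_def A_def)
  qed
  have Qout: "Q x < A" if "x \<in> K - U" "x \<noteq> p" for x
  proof -
    have xx: "\<sigma> x > 0" "\<sigma> x \<le> 1" "v x \<ge> 0" "v x \<le> \<sigma> x" using that \<sigma> v K by auto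
    have "v x powr (1 + \<epsilon>) = v x * v x powr \<epsilon>" using xx(3)
      by (cases "v x = 0") (auto simp: powr_add)
    also have "\<dots> \<le> v x * 1" using xx \<epsilon> by (intro mult_left_mono powr_le1) auto
    finally have "v x powr (1 + \<epsilon>) / \<sigma> x \<le> 1" using xx by simp
    then have "v x powr (1 + \<epsilon>) / \<sigma> x * exp (\<delta> * (cmod (T x))\<^sup>2) \<le> 1 * exp (\<delta> * (cmod (T x))\<^sup>2)"
      by (intro mult_right_mono) auto
    also have "\<dots> < A" using e\<delta> that by simp
    finally show ?thesis by (simp add: Q_def mult_ac)
  qed
  \<comment> \<open>Near the pole v / \<sigma> is only bounded, by \<bar>C\<bar> / c; the spare
    factor v powr \<epsilon> makes \<open>Q\<close> small. Removing \<open>V\<close> leaves a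
    compact set on which \<open>Q\<close> is continuous.\<close>
  obtain V where V: "open V" "p \<in> V" "\<And>x. x \<in> K \<inter> V \<Longrightarrow> x \<noteq> p \<Longrightarrow> Q x < A"
  proof (cases "p \<in> K")
    case False
    have "open (- K)" using K(1) compact_imp_closed by blast
    then show ?thesis using that[of "- K"] False by blast
  next
    case True
    obtain C where C: "\<forall>\<^sub>F x in at p. v x \<le> C * cmod (T x - T p)" using p(2)[OF True] by blast
    have "(v \<longlongrightarrow> 0) (at p within K)" using v(1) True p(1) by (simp add: continuous_on_def) (metis)
    then have "((\<lambda>x. v x powr \<epsilon>) \<longlongrightarrow> 0) (at p within K)"
      using v(2) \<epsilon> by (intro tendsto_zero_powrI[where b = \<epsilon>]) (auto simp: eventually_at_filter)
    then have "((\<lambda>x. (\<bar>C\<bar> / c) * A * v x powr \<epsilon>) \<longlongrightarrow> (\<bar>C\<bar> / c) * A * 0) (at p within K)" by (intro tendsto_intros)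
    then have "\<forall>\<^sub>F x in at p within K. (\<bar>C\<bar> / c) * A * v x powr \<epsilon> < A"
      using A1 order_tendstoD(2) by fastforce
    moreover have "\<forall>\<^sub>F x in at p within K. v x \<le> C * cmod (T x - T p)" "\<forall>\<^sub>F x in at p within K. c * cmod (T x - T p) \<le> \<sigma> x"
      using C \<sigma>(6) at_le[of K UNIV p] filter_leD by blast+
    moreover have "\<forall>\<^sub>F x in at p within K. x \<in> K \<and> x \<noteq> p" by (auto simp: eventually_at_filter)
    ultimately have "\<forall>\<^sub>F x in at p within K. Q x < A"
    proof eventually_elim
      case (elim x)
      have xx: "\<sigma> x > 0" "v x \<ge> 0" using elim(4) \<sigma>(3) v(2) K by auto
      have "c * v x \<le> c * (\<bar>C\<bar> * cmod (T x - T p))"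
        using elim(2) \<sigma>(5) by (intro mult_left_mono) (auto intro: order_trans[OF _ mult_right_mono])
      also have "\<dots> \<le> \<bar>C\<bar> * \<sigma> x" using mult_left_mono[OF elim(3), of "\<bar>C\<bar>"] by (simp add: mult_ac)
      finally have "v x / \<sigma> x \<le> \<bar>C\<bar> / c" using \<sigma>(5) xx by (simp add: field_simps)
      then have "v x / \<sigma> x * exp (\<delta> * (cmod (T x))\<^sup>2) \<le> \<bar>C\<bar> / c * A"
        using e\<delta>[of x] elim(4) xx \<sigma>(5) by (intro mult_mono) auto
      then have "v x / \<sigma> x * exp (\<delta> * (cmod (T x))\<^sup>2) * v x powr \<epsilon> \<le> \<bar>C\<bar> / c * A * v x powr \<epsilon>"
        by (intro mult_right_mono) auto
      moreover have "Q x = v x / \<sigma> x * exp (\<delta> * (cmod (T x))\<^sup>2) * v x powr \<epsilon>"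
        unfolding Q_def using xx(2) by (cases "v x = 0") (auto simp: powr_add)
      ultimately show ?case using elim(1) by linarith
    qed
    then obtain V where "open V" "p \<in> V" "\<forall>x\<in>V. x \<noteq> p \<longrightarrow> x \<in> K \<longrightarrow> Q x < A"
      unfolding eventually_at_topological by blast
    then show ?thesis using that by blast
  qed
  have "compact (K - V)" using K(1) V(1) compact_diff by blast
  moreover have "continuous_on (K - V) Q"
  proof -
    have "\<forall>x\<in>K - V. \<sigma> x \<noteq> 0" using \<sigma>(3) K(2) V(2) by force
    then show ?thesis unfolding Q_def
      using continuous_on_subset[OF v(1), of "K - V"] continuous_on_subset[OF cont\<sigma>, of "K - V"]
        continuous_on_subset[OF contT, of "K - V"] v(2) \<epsilon>
      by (intro continuous_intros continuous_on_powr') auto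
  qed
  moreover have x0V: "x0 \<in> K - V" using V(3)[of x0] Q0 x0 by auto
  ultimately obtain q where q: "q \<in> K - V" "\<And>x. x \<in> K - V \<Longrightarrow> Q x \<le> Q q"
    using continuous_attains_sup[of "K - V" Q] by blast
  have Qq: "Q q \<ge> A" using q(2)[OF x0V] Q0 by simp
  have Qmax: "Q x \<le> Q q" if "x \<in> K" "x \<noteq> p" for x
    using q(2)[of x] V(3)[of x] that Qq by fastforce
  have qp: "q \<noteq> p" using q(1) V(2) by blast
  have qU: "q \<in> U - {p}" using Qout[of q] Qq q(1) qp by fastforce
  obtain N \<phi> where N: "open N" "q \<in> N" "N \<subseteq> X" "hol N \<phi>" "\<forall>x\<in>N. v x = cmod (\<phi> x)" using v(4)[OF qU] by blast
  have qX: "q \<in> X" using N by blast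
  have \<phi>q: "\<phi> q \<noteq> 0" using Qq A1 N(2,5) \<epsilon> unfolding Q_def by auto
  define N' where "N' = {x \<in> N. \<phi> x \<noteq> 0} \<inter> (U - {p})"
  have "open {x \<in> N. \<phi> x \<noteq> 0}"
    using continuous_open_preimage[OF hol_continuous[OF N(1,3,4)] N(1), of "- {0}"]
    by (simp add: vimage_def Int_def open_Compl)
  then have "open N'" unfolding N'_def using U(1) by (intro open_Int open_delete) auto
  moreover have "q \<in> N'" using \<phi>q N(2) qU by (simp add: N'_def)
  ultimately obtain r s where rs: "chart q r s" "s ` ball (T q) r \<subseteq> N'" using exists_chart[OF qX] by blast
  note c = chartD[OF rs(1)]
  have sN: "s w \<in> N" "\<phi> (s w) \<noteq> 0" "s w \<in> U" "s w \<noteq> p" if "w \<in> ball (T q) r" for w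
  proof -
    have "s w \<in> N'" using rs(2) that by blast
    then show "s w \<in> N" "\<phi> (s w) \<noteq> 0" "s w \<in> U" "s w \<noteq> p" by (auto simp: N'_def)
  qed
  have "(\<lambda>w. \<phi> (s w)) holomorphic_on ball (T q) r"
    by (rule hol_chart[OF rs(1) N(4)]) (use sN(1) in blast)
  moreover have "contractible (ball (T q) r)" by (simp add: convex_imp_contractible)
  ultimately obtain g where g: "g holomorphic_on ball (T q) r" "\<And>w. w \<in> ball (T q) r \<Longrightarrow> \<phi> (s w) = exp (g w)"
    using contractible_imp_holomorphic_log sN(2) by metis
  obtain \<rho> where \<rho>: "\<rho> > 0" "\<And>t. 0 < t \<Longrightarrow> t < \<rho> \<Longrightarrow> t < r \<Longrightarrow> submean \<sigma> q s t" using dominatesD[OF \<sigma>(4)[OF qU] rs(1)] by blast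
  define t where "t = min \<rho> r / 2"
  have t: "0 < t" "t < \<rho>" "t < r" using \<rho>(1) c(1) by (auto simp: t_def)
  define w0 where "w0 = T q"
  \<comment> \<open>On the circle of radius t about \<open>w0\<close>, the square of cmod w equals
    (cmod w0)^2 + 2 Re (cnj w0 (w - w0)) + t^2. So the factor with \<delta> is there the modulus of
    a holomorphic exponential, which at the centre is larger by exp (\<delta> t^2). Maximality of
    \<open>Q\<close> at q gives cmod \<psi> \<le> \<sigma> on the circle, while cmod \<psi> =
    \<sigma> q exp (\<delta> t^2) at the centre.\<close>
  define \<psi> where "\<psi> = (\<lambda>w. exp ((1 + of_real \<epsilon>) * g w + 2 * of_real \<delta> * cnj w0 * (w - w0)
     + of_real (\<delta> * (cmod w0)\<^sup>2 + \<delta> * t\<^sup>2)) / of_real (Q q))"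
  have Qq0: "Q q > 0" using Qq A1 by simp
  have vq: "v (s w) powr (1 + \<epsilon>) = exp ((1 + \<epsilon>) * Re (g w))" if "w \<in> ball (T q) r" for w
  proof -
    have "v (s w) = exp (Re (g w))" using N(5) sN(1)[OF that] g(2)[OF that] by simp
    then show ?thesis by (simp add: powr_def)
  qed
  have \<psi>n: "cmod (\<psi> w) = v (s w) powr (1 + \<epsilon>) * exp (\<delta> * ((cmod w)\<^sup>2 + t\<^sup>2 - (cmod (w - w0))\<^sup>2)) / Q q"
    if "w \<in> ball (T q) r" for w
  proof -
    have eq: "2 * Re (cnj w0 * (w - w0)) + (cmod w0)\<^sup>2 = (cmod w)\<^sup>2 - (cmod (w - w0))\<^sup>2"
      unfolding cmod_power2 by (simp add: algebra_simps power2_eq_square)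
    have "2 * \<delta> * Re (cnj w0 * (w - w0)) + (\<delta> * (cmod w0)\<^sup>2 + \<delta> * t\<^sup>2)
        = \<delta> * (2 * Re (cnj w0 * (w - w0)) + (cmod w0)\<^sup>2) + \<delta> * t\<^sup>2"
      by (simp add: algebra_simps)
    also have "\<dots> = \<delta> * ((cmod w)\<^sup>2 + t\<^sup>2 - (cmod (w - w0))\<^sup>2)"
      unfolding eq by (simp add: algebra_simps)
    finally have E: "Re ((1 + of_real \<epsilon>) * g w + 2 * of_real \<delta> * cnj w0 * (w - w0)
       + of_real (\<delta> * (cmod w0)\<^sup>2 + \<delta> * t\<^sup>2)) = (1 + \<epsilon>) * Re (g w) + \<delta> * ((cmod w)\<^sup>2 + t\<^sup>2 - (cmod (w - w0))\<^sup>2)"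
      by (simp add: algebra_simps)
    show ?thesis unfolding \<psi>_def norm_divide norm_exp_eq_Re vq[OF that] E
        exp_add[of "(1 + \<epsilon>) * Re (g w)" "\<delta> * ((cmod w)\<^sup>2 + t\<^sup>2 - (cmod (w - w0))\<^sup>2)"]
      using Qq0 by (simp only: norm_of_real abs_of_pos)
  qed
  have "cmod (\<psi> (T q)) \<le> \<sigma> q"
  proof (rule submeanD[OF \<rho>(2)[OF t]])
    have "g holomorphic_on cball (T q) t"
      by (rule holomorphic_on_subset[OF g(1)]) (use t(3) in auto)
    then have hol\<psi>: "\<psi> holomorphic_on cball (T q) t" unfolding \<psi>_def
      using Qq0 by (intro holomorphic_intros) auto
    then show "\<psi> holomorphic_on ball (T q) t" using ball_subset_cball holomorphic_on_subset by blast
    show "continuous_on (cball (T q) t) \<psi>" using hol\<psi> holomorphic_on_imp_continuous_on by blast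
    fix w assume w: "w \<in> sphere (T q) t"
    then have wb: "w \<in> ball (T q) r" using t(3) by simp
    have "cmod (w - w0) = t" using w by (simp add: w0_def dist_norm norm_minus_commute)
    then have "cmod (\<psi> w) = v (s w) powr (1 + \<epsilon>) * exp (\<delta> * (cmod (T (s w)))\<^sup>2) / Q q"
      using \<psi>n[OF wb] c(6)[OF wb] by simp
    moreover have sp: "\<sigma> (s w) > 0" using \<sigma>(3) sN[OF wb] U(2) K(2) by blast
    ultimately have "cmod (\<psi> w) = Q (s w) * \<sigma> (s w) / Q q" by (simp add: Q_def)
    also have "\<dots> \<le> Q q * \<sigma> (s w) / Q q"
      using Qmax[of "s w"] sN[OF wb] U(2) sp Qq0 by (intro divide_right_mono mult_right_mono) auto
    finally show "cmod (\<psi> w) \<le> \<sigma> (s w)" using Qq0 by simp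
  qed
  moreover have "cmod (\<psi> (T q)) = \<sigma> q * exp (\<delta> * t\<^sup>2)"
  proof -
    have sq: "\<sigma> q > 0" using \<sigma>(3) qX qp by blast
    have "cmod (\<psi> (T q)) = v q powr (1 + \<epsilon>) * exp (\<delta> * (cmod (T q))\<^sup>2) * exp (\<delta> * t\<^sup>2) / Q q"
      using \<psi>n[of "T q"] c(1,3) by (simp add: w0_def distrib_left exp_add)
    also have "\<dots> = Q q * \<sigma> q * exp (\<delta> * t\<^sup>2) / Q q" using sq by (simp add: Q_def)
    finally show ?thesis using Qq0 by simp
  qed
  moreover have "\<sigma> q > 0" using \<sigma>(3) qX qp by blast
  moreover have "exp (\<delta> * t\<^sup>2) > 1" using \<delta> t by simp
  ultimately show False by (simp add: mult_le_cancel_left1)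
qed

end

section \<open>The Perron family\<close>

context flat_surface
begin

text \<open>The functions \<open>- ln \<sigma>\<close> form the Perron family of Green's function with pole \<open>p\<close>. The lower bound
  near \<open>p\<close> cannot be dropped: it excludes logarithmic poles of \<open>- ln \<sigma>\<close> with
  coefficient above 1.\<close>

definition perron :: "'a \<Rightarrow> ('a \<Rightarrow> real) \<Rightarrow> bool" where
  "perron p \<sigma> \<longleftrightarrow> continuous_on X \<sigma> \<and> (\<forall>x\<in>X. 0 \<le> \<sigma> x \<and> \<sigma> x \<le> 1) \<and> (\<forall>x\<in>X - {p}. \<sigma> x > 0) \<and>
     (\<exists>K. compact K \<and> K \<subseteq> X \<and> (\<forall>x\<in>X - K. \<sigma> x = 1)) \<and>
     (\<exists>c>0. \<forall>\<^sub>F x in at p. c * cmod (T x - T p) \<le> \<sigma> x) \<and> (\<forall>q\<in>X - {p}. dominates \<sigma> q)"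

lemma perronD:
  assumes "perron p \<sigma>"
  shows "continuous_on X \<sigma>" "x \<in> X \<Longrightarrow> 0 \<le> \<sigma> x" "x \<in> X \<Longrightarrow> \<sigma> x \<le> 1" "x \<in> X \<Longrightarrow> x \<noteq> p \<Longrightarrow> \<sigma> x > 0"
    "\<exists>K. compact K \<and> K \<subseteq> X \<and> (\<forall>x\<in>X - K. \<sigma> x = 1)"
    "\<exists>c>0. \<forall>\<^sub>F x in at p. c * cmod (T x - T p) \<le> \<sigma> x"
    "q \<in> X \<Longrightarrow> q \<noteq> p \<Longrightarrow> dominates \<sigma> q"
  using assms unfolding perron_def by simp_all

lemma perron_max_principle:
  assumes "perron p \<sigma>" "compact K" "K \<subseteq> X" "open U" "U \<subseteq> K"
    "continuous_on K v" "\<And>x. x \<in> K \<Longrightarrow> v x \<ge> 0" "\<And>x. x \<in> K - U \<Longrightarrow> v x \<le> \<sigma> x"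
    "\<And>q. q \<in> U - {p} \<Longrightarrow> \<exists>N \<phi>. open N \<and> q \<in> N \<and> N \<subseteq> X \<and> hol N \<phi> \<and> (\<forall>x\<in>N. v x = cmod (\<phi> x))"
    "p \<in> K \<Longrightarrow> v p = 0" "p \<in> K \<Longrightarrow> \<exists>C. \<forall>\<^sub>F x in at p. v x \<le> C * cmod (T x - T p)"
    "x \<in> K"
  shows "v x \<le> \<sigma> x"
proof (cases "x = p")
  case True
  then show ?thesis using perronD(2)[OF assms(1), of p] assms(3,10,12) by auto
next
  case False
  obtain c where c: "c > 0" "\<forall>\<^sub>F x in at p. c * cmod (T x - T p) \<le> \<sigma> x"
    using perronD(6)[OF assms(1)] by blast
  have "dominates \<sigma> q" if "q \<in> U - {p}" for q
    using perronD(7)[OF assms(1), of q] assms(3,5) that by blast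
  moreover have "0 < \<sigma> x" if "x \<in> X - {p}" for x using perronD(4)[OF assms(1)] that by blast
  ultimately show ?thesis
    using max_principle[OF assms(2-5) perronD(1,3)[OF assms(1)] _ _ c assms(6-12) False] by blast
qed

lemma hol_const: "open U \<Longrightarrow> U \<subseteq> X \<Longrightarrow> hol U (\<lambda>_. k)"
  by (rule hol_chartI) auto

lemma perron_min:
  assumes "perron p \<sigma>" "perron p \<tau>"
  shows "perron p (\<lambda>x. min (\<sigma> x) (\<tau> x))"
proof -
  note s = perronD[OF assms(1)] note t = perronD[OF assms(2)]
  obtain K where K: "compact K" "K \<subseteq> X" "\<forall>x\<in>X - K. \<sigma> x = 1" using s(5) by blast
  obtain L where L: "compact L" "L \<subseteq> X" "\<forall>x\<in>X - L. \<tau> x = 1" using t(5) by blast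
  obtain c where c: "c > 0" "\<forall>\<^sub>F x in at p. c * cmod (T x - T p) \<le> \<sigma> x" using s(6) by blast
  obtain d where d: "d > 0" "\<forall>\<^sub>F x in at p. d * cmod (T x - T p) \<le> \<tau> x" using t(6) by blast
  have "\<exists>K. compact K \<and> K \<subseteq> X \<and> (\<forall>x\<in>X - K. min (\<sigma> x) (\<tau> x) = 1)"
    by (intro exI[of _ "K \<union> L"]) (use K L in auto)
  moreover have "\<forall>\<^sub>F x in at p. min c d * cmod (T x - T p) \<le> min (\<sigma> x) (\<tau> x)"
    using c(2) d(2)
  proof eventually_elim
    case (elim x)
    have "min c d * cmod (T x - T p) \<le> c * cmod (T x - T p)" "min c d * cmod (T x - T p) \<le> d * cmod (T x - T p)"
      by (intro mult_right_mono; simp)+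
    then show ?case using elim by simp
  qed
  then have "\<exists>c>0. \<forall>\<^sub>F x in at p. c * cmod (T x - T p) \<le> min (\<sigma> x) (\<tau> x)"
    using c(1) d(1) by (intro exI[of _ "min c d"]) simp
  ultimately show ?thesis unfolding perron_def
    using s(1-4,7) t(1-4,7) by (auto intro!: continuous_on_min dominates_min intro: min.coboundedI1)
qed

lemma chart_disc:
  assumes "chart a r s" "0 < \<rho>" "\<rho> < r"
  shows "compact (s ` cball (T a) \<rho>)" "s ` cball (T a) \<rho> \<subseteq> X" "open (s ` ball (T a) \<rho>)"
    "s ` ball (T a) \<rho> \<subseteq> s ` cball (T a) \<rho>" "chart a \<rho> s" "s ` cball (T a) \<rho> \<subseteq> s ` ball (T a) r"
    "\<And>x. x \<in> s ` cball (T a) \<rho> \<Longrightarrow> s (T x) = x \<and> T x \<in> cball (T a) \<rho>"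
    "\<And>x. x \<in> s ` cball (T a) \<rho> - s ` ball (T a) \<rho> \<Longrightarrow> T x \<in> sphere (T a) \<rho>"
    "\<And>w. w \<in> cball (T a) \<rho> \<Longrightarrow> T (s w) = w \<and> s w \<in> X"
proof -
  note c = chartD[OF assms(1)]
  have sub: "cball (T a) \<rho> \<subseteq> ball (T a) r" "ball (T a) \<rho> \<subseteq> ball (T a) r" using assms(3) by auto
  show "compact (s ` cball (T a) \<rho>)"
    using compact_continuous_image[OF continuous_on_subset[OF c(2) sub(1)] compact_cball] .
  show S: "s ` cball (T a) \<rho> \<subseteq> s ` ball (T a) r" "s ` ball (T a) \<rho> \<subseteq> s ` cball (T a) \<rho>"
    using sub(1) ball_subset_cball by blast+
  show "s ` cball (T a) \<rho> \<subseteq> X" using c(5) sub(1) by blast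
  show ch: "chart a \<rho> s"
    using chart_shrink[OF assms(1) _ sub(2) assms(2)] c(1,3) by simp
  show "open (s ` ball (T a) \<rho>)" using chartD(4)[OF ch] .
  show Tc: "T (s w) = w \<and> s w \<in> X" if "w \<in> cball (T a) \<rho>" for w using c(5,6) sub(1) that by blast
  show "s (T x) = x \<and> T x \<in> cball (T a) \<rho>" if "x \<in> s ` cball (T a) \<rho>" for x
    using that Tc by auto
  show "T x \<in> sphere (T a) \<rho>" if "x \<in> s ` cball (T a) \<rho> - s ` ball (T a) \<rho>" for x
  proof -
    note x = that
    obtain w where w: "w \<in> cball (T a) \<rho>" "x = s w" using x by blast
    then have "w \<notin> ball (T a) \<rho>" using x by blast
    then show ?thesis using w Tc by auto
  qed
qed

lemma patch_continuous:
  assumes "chart a r s" "0 < \<rho>" "\<rho> < r" and u: "continuous_on (cball (T a) \<rho>) u"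
    and \<tau>: "continuous_on X \<tau>" and eq: "\<And>w. w \<in> sphere (T a) \<rho> \<Longrightarrow> u w = (\<tau> (s w) :: real)"
  shows "continuous_on X (\<lambda>x. if x \<in> s ` cball (T a) \<rho> then u (T x) else \<tau> x)"
proof -
  note d = chart_disc[OF assms(1-3)]
  let ?D = "s ` cball (T a) \<rho>" and ?E = "X - s ` ball (T a) \<rho>"
  have X: "?D \<union> ?E = X" using d(2,4) by blast
  have "continuous_on (?D \<union> ?E) (\<lambda>x. if x \<in> ?D then u (T x) else \<tau> x)"
  proof (rule continuous_on_cases_local)
    show "closedin (top_of_set (?D \<union> ?E)) ?D"
      unfolding X using d(1,2) by (intro closed_subset compact_imp_closed) auto
    show "closedin (top_of_set (?D \<union> ?E)) ?E"
      unfolding X closedin_def using d(2,3,4) by (auto simp: openin_open_eq open_X Diff_Diff_Int intro!: open_Int)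
    show "continuous_on ?D (\<lambda>x. u (T x))"
      by (rule continuous_on_compose2[OF u continuous_on_subset[OF cont_T d(2)]]) (use d(7) in blast)
    show "continuous_on ?E \<tau>" using continuous_on_subset[OF \<tau>] by blast
    show "u (T x) = \<tau> x" if x: "x \<in> ?D \<and> x \<notin> ?D \<or> x \<in> ?E \<and> x \<in> ?D" for x
    proof -
      have xs: "x \<in> ?D - s ` ball (T a) \<rho>" using x by blast
      have "s (T x) = x" using d(7) xs by blast
      then show ?thesis using eq[OF d(8)[OF xs]] by simp
    qed
  qed
  then show ?thesis unfolding X .
qed

text \<open>The witness is the distance to \<open>T p\<close> in a chart disc, scaled to 1 at the
  rim and continued by 1. Off p it is locally a minimum of moduli of nonvanishing holomorphic
  functions, or constant.\<close>

lemma perron_exists: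
  assumes "p \<in> X"
  shows "\<exists>\<sigma>. perron p \<sigma>"
proof -
  obtain r s where c: "chart p r s" "s ` ball (T p) r \<subseteq> X" by (rule exists_chart[OF assms open_X assms])
  note c' = chartD[OF c(1)]
  \<comment> \<open>The closed disc has to lie inside the chart, so that the description as a
    minimum also holds in a neighbourhood of the rim.\<close>
  define \<rho> where "\<rho> = r / 2"
  have \<rho>: "0 < \<rho>" "\<rho> < r" using c'(1) by (auto simp: \<rho>_def)
  note d = chart_disc[OF c(1) \<rho>]
  define D where "D = s ` cball (T p) \<rho>"
  define \<sigma> where "\<sigma> = (\<lambda>x. if x \<in> D then cmod (T x - T p) / \<rho> else 1)"
  have Dle: "cmod (T x - T p) \<le> \<rho>" if "x \<in> D" for x
    using d(7)[of x] that by (auto simp: D_def dist_norm norm_minus_commute)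
  have inj: "T x \<noteq> T p" if "x \<in> s ` ball (T p) r" "x \<noteq> p" for x
    using c'(7)[OF that(1)] c'(3) that(2) by auto
  have \<sigma>min: "\<sigma> x = min (cmod ((T x - T p) / of_real \<rho>)) (cmod 1)" if x: "x \<in> s ` ball (T p) r" for x
  proof (cases "x \<in> D")
    case True
    then show ?thesis using Dle[OF True] \<rho> by (simp add: \<sigma>_def norm_divide)
  next
    case False
    have "T x \<notin> cball (T p) \<rho>" using False c'(7)[OF x] unfolding D_def by (metis imageI)
    then have "cmod (T x - T p) / \<rho> \<ge> 1" using \<rho> by (simp add: dist_norm norm_minus_commute)
    then show ?thesis using False \<rho> by (simp add: \<sigma>_def norm_divide)
  qed
  have pD: "p \<in> D" using c'(3) \<rho> unfolding D_def by (metis centre_in_cball imageI less_imp_le)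
  have "continuous_on X \<sigma>" unfolding \<sigma>_def D_def
    by (rule patch_continuous[OF c(1) \<rho>, of "\<lambda>w. cmod (w - T p) / \<rho>" "\<lambda>_. 1"])
      (use \<rho> in \<open>auto intro!: continuous_intros simp: dist_norm norm_minus_commute\<close>)
  moreover have "0 \<le> \<sigma> x \<and> \<sigma> x \<le> 1" for x using Dle[of x] \<rho> by (auto simp: \<sigma>_def)
  moreover have "\<sigma> x > 0" if "x \<in> X - {p}" for x
    using inj[of x] d(6) that \<rho> by (auto simp: \<sigma>_def D_def)
  moreover have "\<exists>K. compact K \<and> K \<subseteq> X \<and> (\<forall>x\<in>X - K. \<sigma> x = 1)"
    by (rule exI[of _ D]) (use d(1,2) in \<open>auto simp: D_def \<sigma>_def\<close>)
  moreover have "\<forall>\<^sub>F x in at p. 1 / \<rho> * cmod (T x - T p) \<le> \<sigma> x"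
    using eventually_at_in_open'[OF d(3) chartD(9)[OF d(5)]]
  proof eventually_elim
    case (elim x)
    then have "x \<in> D" using d(4) by (auto simp: D_def)
    then show ?case by (simp add: \<sigma>_def)
  qed
  then have "\<exists>c>0. \<forall>\<^sub>F x in at p. c * cmod (T x - T p) \<le> \<sigma> x" using \<rho> by (intro exI[of _ "1 / \<rho>"]) simp
  moreover have "dominates \<sigma> q" if q: "q \<in> X - {p}" for q
  proof (cases "q \<in> s ` ball (T p) r")
    case True
    define N where "N = s ` ball (T p) r - {p}"
    have N: "open N" "q \<in> N" "N \<subseteq> X" using c'(4) True q c(2) by (auto simp: N_def open_delete)
    have "hol N (\<lambda>x. (T x - T p) / of_real \<rho>)"
      by (rule hol_compose[OF N(1,3) hol_subset[OF hol_T N(3)], of "\<lambda>z. (z - T p) / of_real \<rho>" UNIV])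
        (use \<rho> in \<open>auto intro!: holomorphic_intros\<close>)
    then have "dominates (\<lambda>x. cmod ((T x - T p) / of_real \<rho>)) q"
      by (rule dominates_cmod[OF N]) (use inj \<rho> in \<open>auto simp: N_def\<close>)
    moreover have "dominates (\<lambda>x. cmod 1) q"
      by (rule dominates_cmod[OF N hol_const[OF N(1,3)]]) simp
    ultimately have "dominates (\<lambda>x. min (cmod ((T x - T p) / of_real \<rho>)) (cmod 1)) q"
      by (rule dominates_min)
    then show ?thesis
      by (rule dominates_mono[OF _ N(1,2)]) (use \<sigma>min N(2) in \<open>simp_all add: N_def\<close>)
  next
    case False
    have N: "open (X - D)" "q \<in> X - D" "X - D \<subseteq> X"
      using d(1) open_X q False d(6) by (auto simp: D_def intro: open_Diff compact_imp_closed)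
    have "dominates (\<lambda>x. cmod 1) q"
      by (rule dominates_cmod[OF N hol_const[OF N(1,3)]]) simp
    then show ?thesis
      by (rule dominates_mono[OF _ N(1,2)]) (use N(2) in \<open>simp_all add: \<sigma>_def\<close>)
  qed
  ultimately show ?thesis unfolding perron_def by blast
qed

text \<open>The value 1 of \<sigma> outside a compact set replaces a boundary condition. With U the
  set where \<sigma> < 1, the inequality is clear on K - U, and the maximum principle carries it
  into U.\<close>

lemma perron_lower:
  assumes "hol X f" "\<And>x. x \<in> X \<Longrightarrow> cmod (f x) \<le> 1" "f p = 0" "p \<in> X" "perron p \<sigma>" "x \<in> X"
  shows "cmod (f x) \<le> \<sigma> x"
proof -
  note s = perronD[OF assms(5)]
  obtain K where K: "compact K" "K \<subseteq> X" "\<forall>x\<in>X - K. \<sigma> x = 1" using s(5) by blast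
  show ?thesis
  proof (cases "x \<in> K")
    case False
    then show ?thesis using K(3) assms(2,6) by simp
  next
    case True
    define U where "U = X \<inter> \<sigma> -` {..<1}"
    have U: "open U" unfolding U_def by (rule continuous_open_preimage[OF s(1) open_X]) simp
    have UK: "U \<subseteq> K"
    proof
      fix y assume "y \<in> U"
      then show "y \<in> K" using K(3) by (cases "y \<in> K") (auto simp: U_def)
    qed
    have out: "\<sigma> y = 1" if "y \<in> K - U" for y
      using that s(3)[of y] K(2) unfolding U_def by force
    show ?thesis
    proof (rule perron_max_principle[OF assms(5) K(1,2) U UK])
      show "continuous_on K (\<lambda>x. cmod (f x))"
        using continuous_on_subset[OF hol_continuous[OF open_X order_refl assms(1)] K(2)]
        by (intro continuous_intros)
      show "cmod (f y) \<le> \<sigma> y" if "y \<in> K - U" for y using out[OF that] assms(2)[of y] K(2) that by auto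
      show "\<exists>N \<phi>. open N \<and> q \<in> N \<and> N \<subseteq> X \<and> hol N \<phi> \<and> (\<forall>x\<in>N. cmod (f x) = cmod (\<phi> x))" if "q \<in> U - {p}" for q
        using open_X assms(1) that UK K(2) by (intro exI[of _ X] exI[of _ f]) auto
      show "\<exists>C. \<forall>\<^sub>F x in at p. cmod (f x) \<le> C * cmod (T x - T p)"
        by (rule hol_bound_near[OF assms(4) order_refl assms(1,3)])
    qed (use assms(3) True in auto)
  qed
qed

text \<open>Allows discs centred at the pole and discs away from it to be treated alike.\<close>

definition pole_factor :: "'a \<Rightarrow> 'a \<Rightarrow> complex \<Rightarrow> complex" where
  "pole_factor p a w = (if a = p then w - T p else 1)"

lemma pole_factor_props:
  "pole_factor p a holomorphic_on S"
  "continuous_on S (pole_factor p a)"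
  "pole_factor p a w = 0 \<longleftrightarrow> a = p \<and> w = T p"
  "w \<in> sphere (T a) \<rho> \<Longrightarrow> cmod (pole_factor p a w) = (if a = p then \<rho> else 1)"
  by (cases "a = p"; auto simp: pole_factor_def[abs_def] dist_norm norm_minus_commute intro!: holomorphic_intros continuous_intros)+

text \<open>The maximum principle in a chart disc. If the centre is the pole, the zero of \<phi>
  supplies the linear bound required there; otherwise the disc avoids the pole.\<close>

lemma disc_max_principle:
  assumes \<sigma>: "perron p \<sigma>" and c: "chart a r s" "0 < \<rho>" "\<rho> < r" and a: "a = p \<or> p \<notin> s ` cball (T a) \<rho>"
    and v: "continuous_on (cball (T a) \<rho>) v" "\<phi> holomorphic_on ball (T a) \<rho>"
      "\<And>w. w \<in> ball (T a) \<rho> \<Longrightarrow> v w = cmod (\<phi> w)" "\<And>w. w \<in> sphere (T a) \<rho> \<Longrightarrow> v w \<ge> 0"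
      "a = p \<Longrightarrow> \<phi> (T p) = 0" "\<And>w. w \<in> sphere (T a) \<rho> \<Longrightarrow> v w \<le> \<sigma> (s w)"
    and w: "w \<in> cball (T a) \<rho>"
  shows "v w \<le> \<sigma> (s w)"
proof -
  note d = chart_disc[OF c]
  have hol: "hol (s ` ball (T a) \<rho>) (\<lambda>x. \<phi> (T x))"
  proof (rule hol_from_chart[OF d(5)])
    show "(\<lambda>w. \<phi> (T (s w))) holomorphic_on ball (T a) \<rho>"
      using v(2) by (rule holomorphic_transform) (use chartD(6)[OF d(5)] in simp)
  qed
  have loc: "v (T x) = cmod (\<phi> (T x))" if "x \<in> s ` ball (T a) \<rho>" for x
    using v(3)[OF chartD(8)[OF d(5) that]] .
  have "v (T (s w)) \<le> \<sigma> (s w)"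
  proof (rule perron_max_principle[OF \<sigma> d(1-4), where v = "\<lambda>x. v (T x)"])
    show "continuous_on (s ` cball (T a) \<rho>) (\<lambda>x. v (T x))"
      by (rule continuous_on_compose2[OF v(1) continuous_on_subset[OF cont_T d(2)]]) (use d(7) in blast)
    show "v (T x) \<ge> 0" if x: "x \<in> s ` cball (T a) \<rho>" for x
      using d(8)[of x] x v(4) loc[of x] by (cases "x \<in> s ` ball (T a) \<rho>") auto
    show "v (T x) \<le> \<sigma> x" if x: "x \<in> s ` cball (T a) \<rho> - s ` ball (T a) \<rho>" for x
    proof -
      have "s (T x) = x" using d(7) x by blast
      then show ?thesis using v(6)[OF d(8)[OF x]] by simp
    qed
    show "\<exists>N \<phi>. open N \<and> q \<in> N \<and> N \<subseteq> X \<and> hol N \<phi> \<and> (\<forall>x\<in>N. v (T x) = cmod (\<phi> x))"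
      if "q \<in> s ` ball (T a) \<rho> - {p}" for q
      by (rule exI[of _ "s ` ball (T a) \<rho>"], rule exI[of _ "\<lambda>x. \<phi> (T x)"])
        (use that d(2,3,4) hol loc in blast)
    show "v (T p) = 0" if "p \<in> s ` cball (T a) \<rho>"
      using a that v(3)[of "T a"] v(5) c(2) by auto
    show "\<exists>C. \<forall>\<^sub>F x in at p. v (T x) \<le> C * cmod (T x - T p)" if p: "p \<in> s ` cball (T a) \<rho>"
    proof -
      have ap: "a = p" using a p by blast
      have pin: "p \<in> s ` ball (T a) \<rho>" using chartD(9)[OF d(5)] ap by simp
      obtain C where "\<forall>\<^sub>F x in at p. cmod (\<phi> (T x)) \<le> C * cmod (T x - T p)"
        using hol_bound_near[OF pin _ hol] d(2,4) v(5)[OF ap] by blast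
      moreover have "\<forall>\<^sub>F x in at p. x \<in> s ` ball (T a) \<rho>" by (rule eventually_at_in_open'[OF d(3) pin])
      ultimately have "\<forall>\<^sub>F x in at p. v (T x) \<le> C * cmod (T x - T p)"
        by eventually_elim (use loc in simp)
      then show ?thesis by blast
    qed
  qed (use w in blast)
  then show ?thesis using d(9)[OF w] by simp
qed

text \<open>Poisson modification; the maximum principle on the disc shows that it decreases
  \<sigma>. The new function dominates inside the disc as the modulus of a nonvanishing holomorphic
  function (off p), and elsewhere because it lies below \<sigma> and equals it at the point in
  question.\<close>

lemma perron_modify:
  assumes \<sigma>: "perron p \<sigma>" and c: "chart a r s" "0 < \<rho>" "\<rho> < r" and a: "a = p \<or> p \<notin> s ` cball (T a) \<rho>"
  shows "\<exists>\<sigma>' \<phi>. perron p \<sigma>' \<and> (\<forall>x\<in>X. \<sigma>' x \<le> \<sigma> x) \<and> \<phi> holomorphic_on ball (T a) \<rho> \<and>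
    (a = p \<longrightarrow> \<phi> (T a) = 0) \<and> (\<forall>w\<in>ball (T a) \<rho>. \<sigma>' (s w) = cmod (\<phi> w))"
proof -
  note d = chart_disc[OF c] note \<sigma>D = perronD[OF \<sigma>] note pf = pole_factor_props
  define \<beta> where "\<beta> = pole_factor p a"
  define D where "D = s ` cball (T a) \<rho>"
  have contS: "continuous_on (cball (T a) \<rho>) s" using chartD(2)[OF c(1)] c(3) by (auto intro: continuous_on_subset)
  have sph: "sphere (T a) \<rho> \<subseteq> cball (T a) \<rho>" by auto
  have \<beta>s: "\<beta> w \<noteq> 0" if "w \<in> sphere (T a) \<rho>" for w using pf(4)[OF that, of p] c(2) unfolding \<beta>_def by (auto split: if_splits)
  have sp: "s w \<noteq> p" if w: "w \<in> sphere (T a) \<rho>" for w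
  proof
    assume "s w = p"
    then have "a = p" using a w sph by blast
    then have "w = T a" using \<open>s w = p\<close> d(9)[of w] w sph by auto
    then show False using w c(2) by simp
  qed
  \<comment> \<open>An outer function has no zeros. Dividing the boundary values by the modulus of
    the pole factor, and multiplying the result by the factor, creates the simple zero wanted when
    the centre is p.\<close>
  obtain \<phi>1 v1 where o: "\<phi>1 holomorphic_on ball (T a) \<rho>" "\<And>w. w \<in> ball (T a) \<rho> \<Longrightarrow> \<phi>1 w \<noteq> 0"
    "continuous_on (cball (T a) \<rho>) v1" "\<And>w. w \<in> ball (T a) \<rho> \<Longrightarrow> v1 w = cmod (\<phi>1 w)"
    "\<And>w. w \<in> sphere (T a) \<rho> \<Longrightarrow> v1 w = \<sigma> (s w) / cmod (\<beta> w)" "\<And>w. w \<in> cball (T a) \<rho> \<Longrightarrow> v1 w > 0"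
  proof (rule outer_function[OF c(2), of "T a" "\<lambda>w. \<sigma> (s w) / cmod (\<beta> w)"])
    show "continuous_on (sphere (T a) \<rho>) (\<lambda>w. \<sigma> (s w) / cmod (\<beta> w))"
    proof (intro continuous_on_divide continuous_on_norm)
      show "continuous_on (sphere (T a) \<rho>) (\<lambda>w. \<sigma> (s w))"
        by (rule continuous_on_compose2[OF \<sigma>D(1) continuous_on_subset[OF contS sph]]) (use d(9) sph in blast)
      show "continuous_on (sphere (T a) \<rho>) \<beta>" unfolding \<beta>_def by (rule pf(2))
    qed (use \<beta>s in simp)
    show "\<sigma> (s w) / cmod (\<beta> w) > 0" if w: "w \<in> sphere (T a) \<rho>" for w
      using \<beta>s[OF w] sp[OF w] \<sigma>D(4)[of "s w"] d(9)[of w] w sph by auto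
  qed blast
  define v where "v = (\<lambda>w. cmod (\<beta> w) * v1 w)"
  define \<phi> where "\<phi> = (\<lambda>w. \<beta> w * \<phi>1 w)"
  define \<sigma>' where "\<sigma>' = (\<lambda>x. if x \<in> D then v (T x) else \<sigma> x)"
  have cv: "continuous_on (cball (T a) \<rho>) v" unfolding v_def
    by (intro continuous_intros o(3)) (simp add: \<beta>_def pf(2))
  have h\<phi>: "\<phi> holomorphic_on ball (T a) \<rho>" unfolding \<phi>_def
    by (intro holomorphic_intros o(1)) (simp add: \<beta>_def pf(1))
  have v\<phi>: "v w = cmod (\<phi> w)" if "w \<in> ball (T a) \<rho>" for w using o(4)[OF that] by (simp add: v_def \<phi>_def norm_mult)
  have \<phi>p: "\<phi> (T p) = 0" if "a = p" using that pf(3)[of p a] by (simp add: \<phi>_def \<beta>_def)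
  have vs: "v w = \<sigma> (s w)" if "w \<in> sphere (T a) \<rho>" for w using o(5)[OF that] \<beta>s[OF that] by (simp add: v_def)
  have v0: "v w \<ge> 0" if "w \<in> cball (T a) \<rho>" for w using o(6)[OF that] by (simp add: v_def)
  have vle: "v w \<le> \<sigma> (s w)" if "w \<in> cball (T a) \<rho>" for w
    by (rule disc_max_principle[OF \<sigma> c a cv h\<phi> v\<phi> v0[OF subsetD[OF sph]] \<phi>p eq_refl[OF vs] that])
  have le: "\<sigma>' x \<le> \<sigma> x" for x
    using vle[of "T x"] d(7)[of x] by (auto simp: \<sigma>'_def D_def)
  have \<sigma>'s: "\<sigma>' (s w) = cmod (\<phi> w)" if w: "w \<in> ball (T a) \<rho>" for w
  proof -
    have "s w \<in> D" using w d(4) unfolding D_def by blast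
    then show ?thesis using d(9)[of w] w v\<phi>[OF w] by (simp add: \<sigma>'_def)
  qed
  have \<beta>0: "\<beta> (T x) \<noteq> 0" if "x \<in> D" "x \<noteq> p" for x
  proof
    assume "\<beta> (T x) = 0"
    then have "a = p" "T x = T a" unfolding \<beta>_def pf(3) by auto
    then show False using d(7)[of x] that chartD(3)[OF c(1)] by (simp add: D_def)
  qed
  have hol: "hol (s ` ball (T a) \<rho>) (\<lambda>x. \<phi> (T x))"
  proof (rule hol_from_chart[OF d(5)])
    show "(\<lambda>w. \<phi> (T (s w))) holomorphic_on ball (T a) \<rho>"
      using h\<phi> by (rule holomorphic_transform) (use chartD(6)[OF d(5)] in simp)
  qed
  obtain K where K: "compact K" "K \<subseteq> X" "\<forall>x\<in>X - K. \<sigma> x = 1" using \<sigma>D(5) by blast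
  have "continuous_on X \<sigma>'" unfolding \<sigma>'_def D_def
    by (rule patch_continuous[OF c cv \<sigma>D(1) vs])
  moreover have "0 \<le> \<sigma>' x \<and> \<sigma>' x \<le> 1" if "x \<in> X" for x
    using v0[of "T x"] d(7)[of x] \<sigma>D(2,3)[OF that] le[of x] by (auto simp: \<sigma>'_def D_def)
  moreover have "\<sigma>' x > 0" if "x \<in> X - {p}" for x
    using that \<sigma>D(4)[of x] \<beta>0[of x] o(6)[of "T x"] d(7)[of x] by (auto simp: \<sigma>'_def D_def v_def)
  moreover have "\<exists>K. compact K \<and> K \<subseteq> X \<and> (\<forall>x\<in>X - K. \<sigma>' x = 1)"
    by (rule exI[of _ "K \<union> D"]) (use K d(1,2) in \<open>auto simp: D_def \<sigma>'_def\<close>)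
  moreover have "\<exists>c>0. \<forall>\<^sub>F x in at p. c * cmod (T x - T p) \<le> \<sigma>' x"
  proof (cases "a = p")
    case True
    \<comment> \<open>At the pole the new function is cmod (T x - T p) times the positive continuous
      \<open>v1\<close>, so the minimum of \<open>v1\<close> serves as the slope c.\<close>
    have "\<exists>x\<in>cball (T a) \<rho>. \<forall>y\<in>cball (T a) \<rho>. v1 x \<le> v1 y"
      by (rule continuous_attains_inf) (use c(2) o(3) in auto)
    then obtain w1 where w1: "w1 \<in> cball (T a) \<rho>" "\<And>y. y \<in> cball (T a) \<rho> \<Longrightarrow> v1 w1 \<le> v1 y" by blast
    have pin: "p \<in> s ` ball (T a) \<rho>" using chartD(9)[OF d(5)] True by simp
    have "\<forall>\<^sub>F x in at p. v1 w1 * cmod (T x - T p) \<le> \<sigma>' x"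
      using eventually_at_in_open'[OF d(3) pin]
    proof eventually_elim
      case (elim x)
      then have "x \<in> D" using d(4) by (auto simp: D_def)
      moreover have "v1 w1 \<le> v1 (T x)" using w1(2) d(7)[of x] \<open>x \<in> D\<close> by (simp add: D_def)
      ultimately show ?case
        using mult_right_mono[of "v1 w1" "v1 (T x)" "cmod (T x - T p)"]
        by (simp add: \<sigma>'_def v_def \<beta>_def pole_factor_def True mult.commute)
    qed
    then show ?thesis using o(6)[OF w1(1)] by blast
  next
    case False
    obtain c where c': "c > 0" "\<forall>\<^sub>F x in at p. c * cmod (T x - T p) \<le> \<sigma> x" using \<sigma>D(6) by blast
    have "open (- D)" using d(1) by (auto simp: D_def intro: compact_imp_closed)
    moreover have "p \<in> - D" using a False by (simp add: D_def)
    ultimately have "\<forall>\<^sub>F x in at p. x \<in> - D" by (rule eventually_at_in_open')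
    then have "\<forall>\<^sub>F x in at p. c * cmod (T x - T p) \<le> \<sigma>' x"
      using c'(2) by eventually_elim (simp add: \<sigma>'_def)
    then show ?thesis using c'(1) by blast
  qed
  moreover have "dominates \<sigma>' q" if q: "q \<in> X - {p}" for q
  proof (cases "q \<in> s ` ball (T a) \<rho>")
    case True
    define N where "N = s ` ball (T a) \<rho> - {p}"
    have N: "open N" "q \<in> N" using d(3) True q by (auto simp: N_def open_delete)
    have N3: "N \<subseteq> X" using d(2,4) unfolding N_def by blast
    have xw: "s (T x) = x \<and> T x \<in> ball (T a) \<rho>" if "x \<in> N" for x
      using chartD(7,8)[OF d(5), of x] that by (auto simp: N_def)
    have "dominates (\<lambda>x. cmod (\<phi> (T x))) q"
    proof (rule dominates_cmod[OF N N3])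
      show "hol N (\<lambda>x. \<phi> (T x))" by (rule hol_subset[OF hol]) (auto simp: N_def)
      show "\<phi> (T x) \<noteq> 0" if x: "x \<in> N" for x
        using \<beta>0[of x] o(2)[of "T x"] xw[OF x] x d(4) unfolding \<phi>_def N_def D_def by auto
    qed
    moreover have "\<sigma>' x = cmod (\<phi> (T x))" if "x \<in> N" for x
      using \<sigma>'s[of "T x"] xw[OF that] by simp
    ultimately show ?thesis using dominates_mono[OF _ N(1,2)] N(2) by simp
  next
    case False
    have "\<sigma>' q = \<sigma> q"
    proof (cases "q \<in> D")
      case True
      then have "T q \<in> sphere (T a) \<rho>" "s (T q) = q" using d(8)[of q] d(7)[of q] False by (auto simp: D_def)
      then show ?thesis using vs[of "T q"] True by (simp add: \<sigma>'_def)
    qed (simp add: \<sigma>'_def)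
    then show ?thesis using dominates_mono[OF \<sigma>D(7)[of q] open_UNIV] le q by simp
  qed
  ultimately have "perron p \<sigma>'" unfolding perron_def by blast
  then show ?thesis using le h\<phi> \<phi>p \<sigma>'s by blast
qed

end

section \<open>Injective holomorphic functions\<close>

context flat_surface
begin

text \<open>The bound is uniform over the Perron family because it comes from f alone:
  \<open>perron_lower\<close> compares \<sigma> with f on a circle where f has no zeros, and
  \<open>disc_max_principle\<close> carries the estimate inside. It prevents limits of the family
  from vanishing off p.\<close>

lemma perron_lower_disc:
  assumes f: "hol X f" "\<not> f constant_on X" "\<And>x. x \<in> X \<Longrightarrow> cmod (f x) \<le> 1" "f p = 0" "p \<in> X"
    and a: "a \<in> X"
  obtains r s \<rho> m where "chart a r s" "0 < \<rho>" "\<rho> < r" "a = p \<or> p \<notin> s ` cball (T a) \<rho>" "m > 0"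
    "\<forall>\<sigma> w. perron p \<sigma> \<longrightarrow> w \<in> cball (T a) \<rho> \<longrightarrow> m * cmod (pole_factor p a w) \<le> \<sigma> (s w)"
proof -
  define U where "U = (if a = p then X else X - {p})"
  have U: "open U" "a \<in> U" using open_X a by (auto simp: U_def open_delete)
  obtain r s where c: "chart a r s" "s ` ball (T a) r \<subseteq> U" by (rule exists_chart[OF a U])
  note c' = chartD[OF c(1)]
  obtain d where d: "d > 0" "\<And>w. w \<noteq> T a \<Longrightarrow> dist w (T a) < d \<Longrightarrow> f (s w) \<noteq> 0"
    using chart_eventually_nonzero[OF f(1,2,4,5) c(1)] unfolding eventually_at by auto
  \<comment> \<open>The radius stays below \<open>d\<close> so that the circle avoids the zeros of
    f, and below \<open>r\<close> so that the closed disc lies in the chart.\<close>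
  define \<rho> where "\<rho> = min d r / 2"
  have \<rho>: "0 < \<rho>" "\<rho> < r" "\<rho> < d" using d(1) c'(1) by (auto simp: \<rho>_def)
  note e = chart_disc[OF c(1) \<rho>(1,2)] note pf = pole_factor_props
  have ap: "a = p \<or> p \<notin> s ` cball (T a) \<rho>" using e(6) c(2) by (cases "a = p") (auto simp: U_def)
  have sX: "s ` ball (T a) r \<subseteq> X" using c'(5) by blast
  have "continuous_on (sphere (T a) \<rho>) (\<lambda>w. cmod (f (s w)))"
    by (intro continuous_on_norm continuous_on_subset[OF holomorphic_on_imp_continuous_on[OF hol_chart[OF c(1) f(1) sX]]])
      (use \<rho>(2) in auto)
  moreover have "sphere (T a) \<rho> \<noteq> {}" using \<rho> by simp
  ultimately have "\<exists>w\<in>sphere (T a) \<rho>. \<forall>y\<in>sphere (T a) \<rho>. cmod (f (s w)) \<le> cmod (f (s y))"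
    by (intro continuous_attains_inf) auto
  then obtain w1 where w1: "w1 \<in> sphere (T a) \<rho>" "\<And>y. y \<in> sphere (T a) \<rho> \<Longrightarrow> cmod (f (s w1)) \<le> cmod (f (s y))"
    by blast
  define b where "b = (if a = p then \<rho> else 1)"
  define m where "m = cmod (f (s w1)) / b"
  have b: "b > 0" using \<rho> by (simp add: b_def)
  have "f (s w1) \<noteq> 0" using d(2)[of w1] w1(1) \<rho> by (auto simp: dist_commute)
  then have m: "m > 0" using b by (simp add: m_def)
  have "m * cmod (pole_factor p a w) \<le> \<sigma> (s w)" if \<sigma>: "perron p \<sigma>" and w: "w \<in> cball (T a) \<rho>" for \<sigma> w
  proof (rule disc_max_principle[OF \<sigma> c(1) \<rho>(1,2) ap])
    show "continuous_on (cball (T a) \<rho>) (\<lambda>w. m * cmod (pole_factor p a w))"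
      by (intro continuous_intros pf(2))
    show "(\<lambda>w. of_real m * pole_factor p a w) holomorphic_on ball (T a) \<rho>"
      by (intro holomorphic_intros pf(1))
    show "a = p \<Longrightarrow> of_real m * pole_factor p a (T p) = 0" using pf(3)[of p a "T p"] by simp
    show "m * cmod (pole_factor p a w) \<le> \<sigma> (s w)" if w: "w \<in> sphere (T a) \<rho>" for w
    proof -
      have "s w \<in> X" using e(9)[of w] w by simp
      have "m * cmod (pole_factor p a w) = cmod (f (s w1))"
        unfolding pf(4)[OF w] b_def[symmetric] using b by (simp add: m_def)
      also have "\<dots> \<le> cmod (f (s w))" using w1(2)[OF w] .
      also have "\<dots> \<le> \<sigma> (s w)" by (rule perron_lower[OF f(1,3,4,5) \<sigma> \<open>s w \<in> X\<close>])
      finally show ?thesis .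
    qed
  qed (use m w in \<open>auto simp: norm_mult\<close>)
  then show ?thesis using that[OF c(1) \<rho>(1,2) ap m] by blast
qed

definition env :: "'a \<Rightarrow> 'a \<Rightarrow> real" where
  "env p x = (INF \<sigma>\<in>Collect (perron p). \<sigma> x)"

lemma env_lower: "perron p \<sigma> \<Longrightarrow> x \<in> X \<Longrightarrow> env p x \<le> \<sigma> x"
  unfolding env_def using perronD(2)
  by (intro cINF_lower bdd_belowI2[where m = 0]) auto

lemma env_greatest:
  assumes "p \<in> X" "\<And>\<sigma>. perron p \<sigma> \<Longrightarrow> c \<le> \<sigma> x"
  shows "c \<le> env p x"
  unfolding env_def using perron_exists[OF assms(1)] assms(2) by (intro cINF_greatest) auto

lemma env_approx:
  assumes "p \<in> X" "env p x < c"
  obtains \<sigma> where "perron p \<sigma>" "\<sigma> x < c"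
  using env_greatest[OF assms(1), of c x] assms(2) by (meson not_less)

text \<open>A locally uniform limit \<open>\<Phi>\<close> of disc modifications attains the envelope at one point \<open>w0\<close>. If a member
  of the family were below \<open>\<Phi>\<close> elsewhere, it would produce a limit \<open>\<Psi>\<close> with
  \<open>cmod \<Psi> \<le> cmod \<Phi>\<close> and equality at \<open>w0\<close>, so \<open>\<Psi> / \<Phi>\<close> would be constant.\<close>

lemma env_local:
  assumes f: "hol X f" "\<not> f constant_on X" "\<And>x. x \<in> X \<Longrightarrow> cmod (f x) \<le> 1" "f p = 0" and p: "p \<in> X"
    and a: "a \<in> X"
  obtains N F where "open N" "a \<in> N" "N \<subseteq> X" "hol N F"
    "\<forall>x\<in>N. cmod (F x) = env p x \<and> (F x = 0 \<longleftrightarrow> x = p)"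
proof -
  obtain r s \<rho> m where c: "chart a r s" "0 < \<rho>" "\<rho> < r" and ap: "a = p \<or> p \<notin> s ` cball (T a) \<rho>" and m: "m > 0"
    and low: "\<forall>\<sigma> w. perron p \<sigma> \<longrightarrow> w \<in> cball (T a) \<rho> \<longrightarrow> m * cmod (pole_factor p a w) \<le> \<sigma> (s w)"
    by (rule perron_lower_disc[OF f p a])
  note d = chart_disc[OF c] note pf = pole_factor_props
  define B where "B = ball (T a) \<rho>"
  have sB: "s w \<in> X" if "w \<in> B" for w using d(9)[of w] that by (simp add: B_def)
  have modify: "\<exists>\<sigma>' \<phi>. perron p \<sigma>' \<and> (\<forall>x\<in>X. \<sigma>' x \<le> \<sigma> x) \<and> \<phi> holomorphic_on B \<and>
    (a = p \<longrightarrow> \<phi> (T a) = 0) \<and> (\<forall>w\<in>B. \<sigma>' (s w) = cmod (\<phi> w))" if "perron p \<sigma>" for \<sigma>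
    unfolding B_def by (rule perron_modify[OF that c ap])
  have bounded1: "cmod (\<phi> w) \<le> 1" if "perron p \<sigma>" "\<forall>w\<in>B. \<sigma> (s w) = cmod (\<phi> w)" "w \<in> B" for \<sigma> \<phi> w
    using perronD(3)[OF that(1) sB[OF that(3)]] that(2,3) by simp
  \<comment> \<open>The reference point lies off the centre, hence off the pole when a = p, so it
    belongs to the punctured disc on which the two limits are compared.\<close>
  define w0 where "w0 = T a + of_real (\<rho> / 2)"
  have w0: "w0 \<in> B" "w0 \<noteq> T a" using c(2) by (auto simp: w0_def B_def dist_norm)
  define x0 where "x0 = s w0"
  have "\<exists>\<sigma>. perron p \<sigma> \<and> \<sigma> x0 < env p x0 + 1 / (real n + 1)" for n
    by (rule env_approx[OF p, of x0 "env p x0 + 1 / (real n + 1)"]) auto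
  then obtain \<sigma>0 where \<sigma>0: "\<And>n. perron p (\<sigma>0 n)" "\<And>n. \<sigma>0 n x0 < env p x0 + 1 / (real n + 1)" by metis
  have "\<forall>n. \<exists>\<sigma>' \<phi>. perron p \<sigma>' \<and> (\<forall>x\<in>X. \<sigma>' x \<le> \<sigma>0 n x) \<and> \<phi> holomorphic_on B \<and>
    (a = p \<longrightarrow> \<phi> (T a) = 0) \<and> (\<forall>w\<in>B. \<sigma>' (s w) = cmod (\<phi> w))" using modify \<sigma>0(1) by blast
  then obtain \<sigma> \<phi> where \<sigma>: "\<And>n. perron p (\<sigma> n)" "\<And>n x. x \<in> X \<Longrightarrow> \<sigma> n x \<le> \<sigma>0 n x"
    "\<And>n. \<phi> n holomorphic_on B" "\<And>n. a = p \<Longrightarrow> \<phi> n (T a) = 0" "\<And>n. \<forall>w\<in>B. \<sigma> n (s w) = cmod (\<phi> n w)"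
    by metis
  have montel: "\<exists>g r. g holomorphic_on B \<and> strict_mono (r :: nat \<Rightarrow> nat) \<and> (\<forall>x\<in>B. (\<lambda>n. h (r n) x) \<longlonglongrightarrow> g x)"
    if h: "\<And>n. h n holomorphic_on B" "\<And>n w. w \<in> B \<Longrightarrow> cmod (h n w) \<le> 1" for h :: "nat \<Rightarrow> complex \<Rightarrow> complex"
  proof -
    have bd: "\<exists>b. \<forall>g\<in>range h. \<forall>z\<in>K. cmod (g z) \<le> b" if K: "K \<subseteq> B" for K
      by (rule exI[of _ 1]) (use h(2) K in blast)
    show ?thesis
    proof (rule Montel[of B "range h" h])
      show "open B" by (simp add: B_def)
      show "\<And>g. g \<in> range h \<Longrightarrow> g holomorphic_on B" using h(1) by blast
      show "\<And>K. compact K \<Longrightarrow> K \<subseteq> B \<Longrightarrow> \<exists>b. \<forall>g\<in>range h. \<forall>z\<in>K. cmod (g z) \<le> b" by (rule bd)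
      fix g r assume "g holomorphic_on B" "strict_mono (r :: nat \<Rightarrow> nat)" "\<And>x. x \<in> B \<Longrightarrow> (\<lambda>n. h (r n) x) \<longlonglongrightarrow> g x"
      then show ?thesis by (intro exI[of _ g] exI[of _ r]) simp
    qed simp
  qed
  obtain \<Phi> r1 where \<Phi>: "\<Phi> holomorphic_on B" "strict_mono (r1 :: nat \<Rightarrow> nat)" "\<And>x. x \<in> B \<Longrightarrow> (\<lambda>n. \<phi> (r1 n) x) \<longlonglongrightarrow> \<Phi> x"
    using montel[of \<phi>] \<sigma>(3) bounded1[OF \<sigma>(1,5)] by blast
  have ge: "env p (s w) \<le> cmod l"
    if "z \<longlonglongrightarrow> l" "\<And>n. perron p (\<tau> n) \<and> \<tau> n (s w) = cmod (z n)" "w \<in> B" for z :: "nat \<Rightarrow> complex" and l \<tau> w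
  proof (rule LIMSEQ_le_const[OF tendsto_norm[OF that(1)]])
    show "\<exists>N. \<forall>n\<ge>N. env p (s w) \<le> cmod (z n)"
      using env_lower[OF conjunct1[OF that(2)] sB[OF that(3)]] that(2) by metis
  qed
  have \<Phi>ge: "env p (s w) \<le> cmod (\<Phi> w)" if "w \<in> B" for w
    by (rule ge[OF \<Phi>(3)[OF that], where \<tau> = "\<lambda>n. \<sigma> (r1 n)"]) (use \<sigma>(1,5) that in auto)
  have \<Phi>0: "cmod (\<Phi> w0) = env p x0"
  proof (rule antisym)
    have "(\<lambda>n. env p x0 + 1 / (real n + 1)) \<longlonglongrightarrow> env p x0 + 0"
      by (intro tendsto_intros LIMSEQ_inverse_real_of_nat[unfolded inverse_eq_divide of_nat_Suc add.commute[of 1]])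
    then have lim: "(\<lambda>n. env p x0 + 1 / (real (r1 n) + 1)) \<longlonglongrightarrow> env p x0"
      using LIMSEQ_subseq_LIMSEQ[OF _ \<Phi>(2)] by (fastforce simp: o_def)
    show "cmod (\<Phi> w0) \<le> env p x0"
    proof (rule LIMSEQ_le[OF tendsto_norm[OF \<Phi>(3)[OF w0(1)]] lim], intro exI allI impI)
      fix n
      have "cmod (\<phi> (r1 n) w0) = \<sigma> (r1 n) x0" using \<sigma>(5) w0(1) by (simp add: x0_def)
      also have "\<dots> \<le> \<sigma>0 (r1 n) x0" using \<sigma>(2) sB[OF w0(1)] by (simp add: x0_def)
      also have "\<dots> \<le> env p x0 + 1 / (real (r1 n) + 1)" using \<sigma>0(2) less_imp_le by blast
      finally show "cmod (\<phi> (r1 n) w0) \<le> env p x0 + 1 / (real (r1 n) + 1)" .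
    qed
    show "env p x0 \<le> cmod (\<Phi> w0)" using \<Phi>ge[OF w0(1)] by (simp add: x0_def)
  qed
  define Z where "Z = (if a = p then {T a} else {})"
  have envlow: "m * cmod (pole_factor p a w) \<le> env p (s w)" if "w \<in> B" for w
    by (rule env_greatest[OF p]) (use low that in \<open>auto simp: B_def\<close>)
  have \<Phi>nz: "\<Phi> w \<noteq> 0" if w: "w \<in> B - Z" for w
  proof -
    have "pole_factor p a w \<noteq> 0" using w pf(3)[of p a w] by (auto simp: Z_def split: if_splits)
    then have "0 < m * cmod (pole_factor p a w)" using m by simp
    then have "0 < cmod (\<Phi> w)" using envlow[of w] \<Phi>ge[of w] w by auto
    then show ?thesis by simp
  qed
  have \<Phi>p: "\<Phi> (T a) = 0" if "a = p"
  proof -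
    have "(\<lambda>n. \<phi> (r1 n) (T a)) \<longlonglongrightarrow> \<Phi> (T a)" using \<Phi>(3) c(2) by (simp add: B_def)
    then show ?thesis unfolding \<sigma>(4)[OF that] by (simp add: LIMSEQ_const_iff)
  qed
  have eq: "cmod (\<Phi> w1) = env p (s w1)" if w1: "w1 \<in> B" for w1
  proof (cases "w1 \<in> Z")
    case True
    then have "a = p" "w1 = T a" by (auto simp: Z_def split: if_splits)
    then have "cmod (\<Phi> w1) \<le> env p (s w1)"
      using \<Phi>p env_greatest[OF p, of 0 "s w1"] perronD(2) sB[OF w1] by simp
    then show ?thesis using \<Phi>ge[OF w1] by simp
  next
    case False
    show ?thesis
    proof (rule ccontr)
      assume "cmod (\<Phi> w1) \<noteq> env p (s w1)"
      then have "env p (s w1) < cmod (\<Phi> w1)" using \<Phi>ge[OF w1] by simp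
      then obtain \<tau> where \<tau>: "perron p \<tau>" "\<tau> (s w1) < cmod (\<Phi> w1)" by (rule env_approx[OF p])
      \<comment> \<open>Minima with members of the first sequence keep the new limit below \<Phi>
        everywhere and below \<tau> at \<open>w1\<close>; at \<open>w0\<close> it cannot fall below
        the envelope, which \<Phi> already attains.\<close>
      have "\<forall>n. \<exists>\<sigma>' \<psi>. perron p \<sigma>' \<and> (\<forall>x\<in>X. \<sigma>' x \<le> min (\<tau> x) (\<sigma> (r1 n) x)) \<and> \<psi> holomorphic_on B \<and>
        (a = p \<longrightarrow> \<psi> (T a) = 0) \<and> (\<forall>w\<in>B. \<sigma>' (s w) = cmod (\<psi> w))"
      proof
        fix n
        show "\<exists>\<sigma>' \<psi>. perron p \<sigma>' \<and> (\<forall>x\<in>X. \<sigma>' x \<le> min (\<tau> x) (\<sigma> (r1 n) x)) \<and> \<psi> holomorphic_on B \<and>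
        (a = p \<longrightarrow> \<psi> (T a) = 0) \<and> (\<forall>w\<in>B. \<sigma>' (s w) = cmod (\<psi> w))"
          using modify[OF perron_min[OF \<tau>(1) \<sigma>(1)[of "r1 n"]]] .
      qed
      then obtain \<kappa> \<psi> where \<kappa>: "\<And>n. perron p (\<kappa> n)" "\<And>n x. x \<in> X \<Longrightarrow> \<kappa> n x \<le> min (\<tau> x) (\<sigma> (r1 n) x)"
        "\<And>n. \<psi> n holomorphic_on B" "\<And>n. \<forall>w\<in>B. \<kappa> n (s w) = cmod (\<psi> n w)"
        by metis
      obtain \<Psi> r2 where \<Psi>: "\<Psi> holomorphic_on B" "strict_mono (r2 :: nat \<Rightarrow> nat)" "\<And>x. x \<in> B \<Longrightarrow> (\<lambda>n. \<psi> (r2 n) x) \<longlonglongrightarrow> \<Psi> x"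
        using montel[of \<psi>] \<kappa>(3) bounded1[OF \<kappa>(1,4)] by blast
      have \<psi>le: "cmod (\<psi> n w) \<le> min (\<tau> (s w)) (cmod (\<phi> (r1 n) w))" if "w \<in> B" for n w
        using \<kappa>(2)[OF sB[OF that], of n] \<kappa>(4)[of n] \<sigma>(5)[of "r1 n"] that by simp
      have \<Psi>le: "cmod (\<Psi> w) \<le> cmod (\<Phi> w)" if w: "w \<in> B" for w
      proof (rule LIMSEQ_le[OF tendsto_norm[OF \<Psi>(3)[OF w]]])
        show "(\<lambda>n. cmod (\<phi> (r1 (r2 n)) w)) \<longlonglongrightarrow> cmod (\<Phi> w)"
          using LIMSEQ_subseq_LIMSEQ[OF \<Phi>(3)[OF w] \<Psi>(2)] by (intro tendsto_norm) (simp add: o_def)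
        show "\<exists>N. \<forall>n\<ge>N. cmod (\<psi> (r2 n) w) \<le> cmod (\<phi> (r1 (r2 n)) w)" using \<psi>le[OF w] by auto
      qed
      have "cmod (\<Psi> w1) \<le> \<tau> (s w1)"
        by (rule LIMSEQ_le_const2[OF tendsto_norm[OF \<Psi>(3)[OF w1]]]) (use \<psi>le[OF w1] in auto)
      then have lt: "cmod (\<Psi> w1) < cmod (\<Phi> w1)" using \<tau>(2) by simp
      have "env p x0 \<le> cmod (\<Psi> w0)"
        unfolding x0_def by (rule ge[OF \<Psi>(3)[OF w0(1)], where \<tau> = "\<lambda>n. \<kappa> (r2 n)"]) (use \<kappa>(1,4) w0(1) in auto)
      then have eq0: "cmod (\<Psi> w0) = cmod (\<Phi> w0)" using \<Psi>le[OF w0(1)] \<Phi>0 by simp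
      have BZ: "open (B - Z)" "connected (B - Z)" "w0 \<in> B - Z" "w1 \<in> B - Z"
        using w0 w1 False by (auto simp: Z_def B_def open_delete connected_open_delete)
      have "(\<lambda>w. \<Psi> w / \<Phi> w) constant_on (B - Z)"
      proof (rule maximum_modulus_principle[OF _ BZ(1,2,1) order_refl BZ(3)])
        show "(\<lambda>w. \<Psi> w / \<Phi> w) holomorphic_on B - Z"
          using \<Psi>(1) \<Phi>(1) \<Phi>nz by (intro holomorphic_on_divide) (auto intro: holomorphic_on_subset)
        show "cmod (\<Psi> z / \<Phi> z) \<le> cmod (\<Psi> w0 / \<Phi> w0)" if z: "z \<in> B - Z" for z
          using \<Psi>le[of z] z \<Phi>nz[OF z] \<Phi>nz[OF BZ(3)] eq0 by (simp add: norm_divide)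
      qed
      then have "\<Psi> w1 / \<Phi> w1 = \<Psi> w0 / \<Phi> w0" using BZ(3,4) unfolding constant_on_def by metis
      then have "cmod (\<Psi> w1) / cmod (\<Phi> w1) = cmod (\<Psi> w0) / cmod (\<Phi> w0)" by (metis norm_divide)
      then show False using lt eq0 \<Phi>nz[OF BZ(3)] \<Phi>nz[OF BZ(4)] by simp
    qed
  qed
  show ?thesis
  proof
    show "open (s ` B)" "a \<in> s ` B" "s ` B \<subseteq> X" using d(2,3,4) chartD(9)[OF d(5)] by (auto simp: B_def)
    show "hol (s ` B) (\<lambda>x. \<Phi> (T x))" unfolding B_def
    proof (rule hol_from_chart[OF d(5)])
      show "(\<lambda>w. \<Phi> (T (s w))) holomorphic_on ball (T a) \<rho>"
        using \<Phi>(1)[unfolded B_def] by (rule holomorphic_transform) (use chartD(6)[OF d(5)] in simp)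
    qed
    show "\<forall>x\<in>s ` B. cmod (\<Phi> (T x)) = env p x \<and> (\<Phi> (T x) = 0 \<longleftrightarrow> x = p)"
    proof (intro ballI conjI)
      fix x assume x: "x \<in> s ` B"
      then have xw: "T x \<in> B" "s (T x) = x" using chartD(7,8)[OF d(5)] by (auto simp: B_def)
      show "cmod (\<Phi> (T x)) = env p x" using eq[OF xw(1)] xw(2) by simp
      show "\<Phi> (T x) = 0 \<longleftrightarrow> x = p"
      proof
        assume "\<Phi> (T x) = 0"
        then have "T x \<in> Z" using \<Phi>nz[of "T x"] xw(1) by blast
        then have "a = p" "T x = T a" by (auto simp: Z_def split: if_splits)
        then show "x = p" using xw(2) chartD(3)[OF c(1)] by simp
      next
        assume "x = p"
        then have "p \<in> s ` cball (T a) \<rho>" using x d(4) by (auto simp: B_def)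
        then have "a = p" using ap by blast
        then show "\<Phi> (T x) = 0" using \<Phi>p \<open>x = p\<close> by simp
      qed
    qed
  qed
qed

text \<open>Off p the quotient is holomorphic of constant modulus 1, hence constant, because
  deleting a point leaves the set connected. This is the uniqueness that permits gluing.\<close>

lemma unimodular_multiple:
  assumes U: "open U" "connected U" "U \<subseteq> X" "U \<noteq> {}" and "hol U u" "hol U v"
    and eq: "\<And>x. x \<in> U \<Longrightarrow> cmod (u x) = cmod (v x)" and z: "\<And>x. x \<in> U \<Longrightarrow> u x = 0 \<longleftrightarrow> x = p"
  shows "\<exists>k. cmod k = 1 \<and> (\<forall>x\<in>U. k * u x = v x)"
proof -
  define V where "V = U - {p}"
  have dim: "2 \<le> DIM('a)" using dim_X by simp
  have V: "open V" "connected V" "V \<subseteq> X" "V \<subseteq> U"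
    unfolding V_def using U connected_open_delete[OF U(1,2) dim] by (auto simp: open_delete)
  have z': "v x = 0 \<longleftrightarrow> x = p" if "x \<in> U" for x using eq[OF that] z[OF that] by (metis norm_eq_zero)
  have "V \<noteq> {}"
  proof
    assume "V = {}"
    then have "U = {p}" using U(4) unfolding V_def by blast
    then show False using U(1) not_open_singleton[of p] by simp
  qed
  then obtain x0 where x0: "x0 \<in> V" by blast
  have h: "hol V (\<lambda>x. v x / u x)"
    by (rule hol_divide[OF V(1,3) hol_subset[OF assms(6) V(4)] hol_subset[OF assms(5) V(4)]])
      (use z in \<open>auto simp: V_def\<close>)
  have one: "cmod (v x / u x) = 1" if "x \<in> V" for x
    using eq[of x] z[of x] that by (auto simp: V_def norm_divide)
  define k where "k = v x0 / u x0"
  have "k * u x = v x" if x: "x \<in> U" for x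
  proof (cases "x = p")
    case True
    then show ?thesis using z[OF x] z'[OF x] by simp
  next
    case False
    then have "x \<in> V" using x by (simp add: V_def)
    have "v x / u x = k" unfolding k_def
      by (rule max_modulus_constant[OF V(1-3) h _ x0 one[OF x0] \<open>x \<in> V\<close>]) (use one in auto)
    then show ?thesis using z[OF x] False by (auto simp: field_simps)
  qed
  then show ?thesis using one[OF x0] by (auto simp: k_def)
qed

text \<open>The local functions with modulus \<open>env p\<close> are glued with unimodular
  constants as changes of section. Extremality is \<open>perron_lower\<close> passed to the infimum;
  modulus 1 at one point would force a constant, against the zero at p.\<close>

lemma green_map:
  assumes f: "hol X f" "\<not> f constant_on X" "\<And>x. x \<in> X \<Longrightarrow> cmod (f x) \<le> 1" "f p = 0" and p: "p \<in> X"
  shows "\<exists>F. hol X F \<and> (\<forall>x\<in>X. cmod (F x) < 1 \<and> (F x = 0 \<longleftrightarrow> x = p)) \<and>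
    (\<forall>h. hol X h \<longrightarrow> (\<forall>x\<in>X. cmod (h x) \<le> 1) \<longrightarrow> h p = 0 \<longrightarrow> (\<forall>x\<in>X. cmod (h x) \<le> cmod (F x)))"
proof -
  define Q where "Q = (\<lambda>x u. \<exists>N. open N \<and> x \<in> N \<and> N \<subseteq> X \<and> hol N u \<and>
     (\<forall>y\<in>N. cmod (u y) = env p y \<and> (u y = 0 \<longleftrightarrow> y = p)))"
  interpret local_sections X Q "{\<alpha>. \<exists>k. cmod k = 1 \<and> \<alpha> = (\<lambda>z. k * z)}"
  proof
    show "open X" by (rule open_X)
    show "Q x v" if Q: "Q x u" and N: "open N" "x \<in> N" "\<And>y. y \<in> N \<Longrightarrow> v y = u y" for x u v N
    proof -
      obtain M where M: "open M" "x \<in> M" "M \<subseteq> X" "hol M u" "\<forall>y\<in>M. cmod (u y) = env p y \<and> (u y = 0 \<longleftrightarrow> y = p)"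
        using Q unfolding Q_def by blast
      have MN: "open (M \<inter> N)" "M \<inter> N \<subseteq> X" using M N(1) by auto
      have "hol (M \<inter> N) v"
        by (rule hol_cong[OF MN hol_subset[OF M(4)]]) (use N(3) in auto)
      then show ?thesis unfolding Q_def
        by (intro exI[of _ "M \<inter> N"]) (use MN M N in auto)
    qed
    show "\<exists>N u. open N \<and> x \<in> N \<and> (\<forall>y\<in>N. Q y u)" if x: "x \<in> X" for x
    proof -
      obtain N F where N: "open N" "x \<in> N" "N \<subseteq> X" "hol N F"
        "\<forall>x\<in>N. cmod (F x) = env p x \<and> (F x = 0 \<longleftrightarrow> x = p)" by (rule env_local[OF f p x])
      then have "\<forall>y\<in>N. Q y F" unfolding Q_def by blast
      then show ?thesis using N by blast
    qed
    show "Q x (\<lambda>y. \<alpha> (u y))" if \<alpha>: "\<alpha> \<in> {\<alpha>. \<exists>k. cmod k = 1 \<and> \<alpha> = (\<lambda>z. k * z)}" and Q: "Q x u" for \<alpha> x u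
    proof -
      obtain k where k: "cmod k = 1" "\<alpha> = (\<lambda>z. k * z)" using \<alpha> by blast
      obtain M where M: "open M" "x \<in> M" "M \<subseteq> X" "hol M u" "\<forall>y\<in>M. cmod (u y) = env p y \<and> (u y = 0 \<longleftrightarrow> y = p)"
        using Q unfolding Q_def by blast
      have "hol M (\<lambda>y. k * u y)"
        by (rule hol_compose[OF M(1,3,4), of "\<lambda>z. k * z" UNIV]) (auto intro: holomorphic_intros)
      moreover have "k \<noteq> 0" using k(1) by auto
      ultimately show ?thesis unfolding Q_def k(2)
        by (intro exI[of _ M]) (use M k(1) in \<open>auto simp: norm_mult\<close>)
    qed
    show "\<exists>\<alpha>\<in>{\<alpha>. \<exists>k. cmod k = 1 \<and> \<alpha> = (\<lambda>z. k * z)}. \<forall>y\<in>U. \<alpha> (u y) = v y"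
      if U: "open U" "connected U" "U \<noteq> {}" "U \<subseteq> X" and u: "\<And>y. y \<in> U \<Longrightarrow> Q y u" and v: "\<And>y. y \<in> U \<Longrightarrow> Q y v" for U u v
    proof -
      have "hol U u" by (rule hol_UnionI) (use u in \<open>unfold Q_def, blast\<close>)
      moreover have "hol U v" by (rule hol_UnionI) (use v in \<open>unfold Q_def, blast\<close>)
      moreover have "cmod (u x) = env p x \<and> (u x = 0 \<longleftrightarrow> x = p)" if "x \<in> U" for x
        using u[OF that] unfolding Q_def by blast
      moreover have "cmod (v x) = env p x" if "x \<in> U" for x
        using v[OF that] unfolding Q_def by blast
      ultimately have "\<exists>k. cmod k = 1 \<and> (\<forall>x\<in>U. k * u x = v x)"
        by (intro unimodular_multiple[OF U(1,2,4,3)]) auto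
      then show ?thesis by blast
    qed
  qed
  obtain F where F: "\<forall>x\<in>X. Q x F" using global_section[OF plane] by blast
  have holF: "hol X F" by (rule hol_UnionI) (use F in \<open>unfold Q_def, blast\<close>)
  have Fe: "cmod (F x) = env p x" "F x = 0 \<longleftrightarrow> x = p" if "x \<in> X" for x
    using F that unfolding Q_def by blast+
  have Fle: "cmod (F x) \<le> 1" if "x \<in> X" for x
    using perron_exists[OF p] env_lower[OF _ that] perronD(3)[OF _ that] Fe[OF that] by (metis order_trans)
  have Flt: "cmod (F x) < 1" if x: "x \<in> X" for x
  proof (rule ccontr)
    assume "\<not> cmod (F x) < 1"
    then have "cmod (F x) = 1" using Fle[OF x] by simp
    then have "F p = F x" using max_modulus_constant[OF open_X connected_X order_refl holF Fle x _ p] by simp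
    then show False using Fe[OF p] \<open>cmod (F x) = 1\<close> by simp
  qed
  have big: "cmod (h x) \<le> cmod (F x)" if "hol X h" "\<And>x. x \<in> X \<Longrightarrow> cmod (h x) \<le> 1" "h p = 0" "x \<in> X" for h x
    unfolding Fe(1)[OF that(4)] by (rule env_greatest[OF p]) (use perron_lower that p in blast)
  show ?thesis
    by (rule exI[of _ F]) (use holF Flt Fe(2) big in blast)
qed

theorem injective_hol:
  assumes f: "hol X f" "\<not> f constant_on X" "\<And>x. x \<in> X \<Longrightarrow> cmod (f x) < 1"
  shows "\<exists>F. hol X F \<and> inj_on F X"
proof -
  have "\<exists>F. hol X F \<and> (\<forall>x\<in>X. cmod (F x) < 1 \<and> (F x = 0 \<longleftrightarrow> x = p)) \<and>
    (\<forall>h. hol X h \<longrightarrow> (\<forall>x\<in>X. cmod (h x) \<le> 1) \<longrightarrow> h p = 0 \<longrightarrow> (\<forall>x\<in>X. cmod (h x) \<le> cmod (F x)))"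
    if p: "p \<in> X" for p
  \<comment> \<open>Subtracting \<open>f p\<close> creates the zero at p, and halving returns the
    values to the unit disc.\<close>
  proof (rule green_map[of "\<lambda>x. (f x - f p) / 2", OF _ _ _ _ p])
    show "hol X (\<lambda>x. (f x - f p) / 2)"
      by (rule hol_compose[OF open_X order_refl f(1), of "\<lambda>z. (z - f p) / 2" UNIV]) (auto intro!: holomorphic_intros)
    show "\<not> (\<lambda>x. (f x - f p) / 2) constant_on X"
    proof
      assume "(\<lambda>x. (f x - f p) / 2) constant_on X"
      then obtain k where "\<forall>x\<in>X. (f x - f p) / 2 = k" unfolding constant_on_def by blast
      then have "\<forall>x\<in>X. f x = 2 * k + f p" by (auto simp: field_simps)
      then show False using f(2) unfolding constant_on_def by blast
    qed
    show "cmod ((f x - f p) / 2) \<le> 1" if "x \<in> X" for x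
      using norm_triangle_ineq4[of "f x" "f p"] f(3)[OF that] f(3)[OF p] by (simp add: norm_divide)
  qed simp
  then have "\<exists>G. \<forall>p\<in>X. hol X (G p) \<and> (\<forall>x\<in>X. cmod (G p x) < 1 \<and> (G p x = 0 \<longleftrightarrow> x = p)) \<and>
    (\<forall>h. hol X h \<longrightarrow> (\<forall>x\<in>X. cmod (h x) \<le> 1) \<longrightarrow> h p = 0 \<longrightarrow> (\<forall>x\<in>X. cmod (h x) \<le> cmod (G p x)))"
    by (intro bchoice) blast
  then obtain G where G0: "\<forall>p\<in>X. hol X (G p) \<and> (\<forall>x\<in>X. cmod (G p x) < 1 \<and> (G p x = 0 \<longleftrightarrow> x = p)) \<and>
    (\<forall>h. hol X h \<longrightarrow> (\<forall>x\<in>X. cmod (h x) \<le> 1) \<longrightarrow> h p = 0 \<longrightarrow> (\<forall>x\<in>X. cmod (h x) \<le> cmod (G p x)))" ..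
  have G: "hol X (G p)" "x \<in> X \<Longrightarrow> cmod (G p x) < 1" "x \<in> X \<Longrightarrow> G p x = 0 \<longleftrightarrow> x = p"
    "hol X h \<Longrightarrow> \<forall>x\<in>X. cmod (h x) \<le> 1 \<Longrightarrow> h p = 0 \<Longrightarrow> x \<in> X \<Longrightarrow> cmod (h x) \<le> cmod (G p x)"
    if "p \<in> X" for p h x using G0 that by simp_all
  \<comment> \<open>The disc automorphism applied to \<open>G p\<close> moves the value at q to 0,
    which makes \<open>M p q\<close> a competitor for the extremal \<open>G q\<close>.\<close>
  define M where "M = (\<lambda>p q x. Moebius_function 0 (G p q) (G p x))"
  have M: "hol X (M p q)" "\<forall>x\<in>X. cmod (M p q x) \<le> 1" "M p q q = 0" "cmod (M p q p) = cmod (G p q)"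
    "\<And>x. x \<in> X \<Longrightarrow> cmod (M p q x) \<le> cmod (G q x)" if p: "p \<in> X" and q: "q \<in> X" for p q
  proof -
    show h: "hol X (M p q)" unfolding M_def
      by (rule hol_compose[OF open_X order_refl G(1)[OF p] Moebius_function_holomorphic[OF G(2)[OF p q]]])
        (use G(2)[OF p] in auto)
    show b: "\<forall>x\<in>X. cmod (M p q x) \<le> 1"
      using Moebius_function_norm_lt_1[OF G(2)[OF p q] G(2)[OF p]] by (auto simp: M_def less_imp_le)
    show z: "M p q q = 0" by (simp add: M_def Moebius_function_eq_zero)
    show "cmod (M p q p) = cmod (G p q)" using G(3)[OF p p] by (simp add: M_def Moebius_function_of_zero)
    show "cmod (M p q x) \<le> cmod (G q x)" if "x \<in> X" for x by (rule G(4)[OF q h b z that])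
  qed
  \<comment> \<open>As \<open>G p p = 0\<close>, the automorphism gives \<open>M p q p\<close> the
    modulus of \<open>G p q\<close>. Extremality of \<open>G q\<close> at p bounds it by that of
    \<open>G q p\<close>; exchanging p and q gives equality.\<close>
  have sym: "cmod (G p q) = cmod (G q p)" if "p \<in> X" "q \<in> X" for p q
    using M(4,5)[of p q] M(4,5)[of q p] that by (metis antisym)
  obtain p where p: "p \<in> X" using f(2) unfolding constant_on_def by blast
  have "x = q" if x: "x \<in> X" and q: "q \<in> X" and eq: "G p x = G p q" for x q
  proof (rule ccontr)
    assume "x \<noteq> q"
    have "q \<noteq> p" using G(3)[OF p x] G(3)[OF p q] eq \<open>x \<noteq> q\<close> by auto
    have dim: "2 \<le> DIM('a)" using dim_X by simp
    define V where "V = X - {q}"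
    have V: "open V" "connected V" "V \<subseteq> X" "p \<in> V" "x \<in> V"
      unfolding V_def using connected_open_delete[OF open_X connected_X dim] open_X p x \<open>q \<noteq> p\<close> \<open>x \<noteq> q\<close>
      by (auto simp: open_delete)
    have nz: "G q y \<noteq> 0" if "y \<in> V" for y using G(3)[OF q, of y] that by (auto simp: V_def)
    \<comment> \<open>By the symmetry this quotient has modulus 1 at p, so it is constant off q. A
      second point x with the same value of \<open>G p\<close> would be a zero of it.\<close>
    have "M p q x / G q x = M p q p / G q p"
    proof (rule max_modulus_constant[OF V(1-3) _ _ V(4) _ V(5)])
      show "hol V (\<lambda>x. M p q x / G q x)"
        by (rule hol_divide[OF V(1,3) hol_subset[OF M(1)[OF p q] V(3)] hol_subset[OF G(1)[OF q] V(3)] nz])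
      show "cmod (M p q y / G q y) \<le> 1" if "y \<in> V" for y
        using M(5)[OF p q, of y] nz[OF that] that V(3) by (auto simp: norm_divide)
      show "cmod (M p q p / G q p) = 1"
        using M(4)[OF p q] sym[OF p q] nz[OF V(4)] by (simp add: norm_divide)
    qed
    moreover have "M p q x = 0" using eq by (simp add: M_def Moebius_function_eq_zero)
    ultimately have "cmod (M p q p) = 0" using nz[OF V(4)] by simp
    then show False using M(4)[OF p q] G(3)[OF p q] \<open>q \<noteq> p\<close> by simp
  qed
  then have "inj_on (G p) X" by (auto intro: inj_onI)
  then show ?thesis using G(1)[OF p] by blast
qed

end

section \<open>Gradients of functions of two real variables\<close>

text \<open>The Frechet derivative recorded by its two partial vectors. The values lie in any normed
  space, so that real functions, complex functions and planar maps share one calculus.\<close>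

definition has_grad :: "(real \<times> real \<Rightarrow> 'b::real_normed_vector) \<Rightarrow> 'b \<Rightarrow> 'b \<Rightarrow> real \<times> real \<Rightarrow> bool" where
  "has_grad h A B p \<longleftrightarrow> (h has_derivative (\<lambda>v. fst v *\<^sub>R A + snd v *\<^sub>R B)) (at p)"

lemma has_grad_horizontal:
  assumes "has_grad h A B p"
  shows "((\<lambda>t. h (t, snd p)) has_vector_derivative A) (at (fst p))"
proof -
  have "((\<lambda>t. (t, snd p)) has_derivative (\<lambda>s. (s, 0))) (at (fst p))"
    by (intro derivative_eq_intros) auto
  moreover have "(h has_derivative (\<lambda>v. fst v *\<^sub>R A + snd v *\<^sub>R B)) (at ((\<lambda>t. (t, snd p)) (fst p)))"
    using assms by (simp add: has_grad_def)
  ultimately have "((\<lambda>t. h (t, snd p)) has_derivative (\<lambda>s. fst (s, 0::real) *\<^sub>R A + snd (s, 0::real) *\<^sub>R B)) (at (fst p))"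
    by (rule has_derivative_compose)
  then show ?thesis by (simp add: has_vector_derivative_def)
qed

lemma has_grad_vertical:
  assumes "has_grad h A B p"
  shows "((\<lambda>t. h (fst p, t)) has_vector_derivative B) (at (snd p))"
proof -
  have "((\<lambda>t. (fst p, t)) has_derivative (\<lambda>s. (0, s))) (at (snd p))"
    by (intro derivative_eq_intros) auto
  moreover have "(h has_derivative (\<lambda>v. fst v *\<^sub>R A + snd v *\<^sub>R B)) (at ((\<lambda>t. (fst p, t)) (snd p)))"
    using assms by (simp add: has_grad_def)
  ultimately have "((\<lambda>t. h (fst p, t)) has_derivative (\<lambda>s. fst (0::real, s) *\<^sub>R A + snd (0::real, s) *\<^sub>R B)) (at (snd p))"
    by (rule has_derivative_compose)
  then show ?thesis by (simp add: has_vector_derivative_def)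
qed

lemma has_grad_pd:
  assumes "has_grad h A B p"
  shows "pdx h p = A" "pdy h p = B"
  using has_grad_horizontal[OF assms] has_grad_vertical[OF assms]
  by (auto simp: pdx_def pdy_def has_real_derivative_iff_has_vector_derivative[symmetric] intro: DERIV_imp_deriv)

lemma differentiable_imp_has_grad:
  assumes "h differentiable (at p)"
  shows "has_grad h (pdx h p) (pdy h p) p"
proof -
  obtain h' where h': "(h has_derivative h') (at p)" using assms unfolding differentiable_def by blast
  then interpret bounded_linear h' by (rule has_derivative_bounded_linear)
  have "h' v = fst v *\<^sub>R h' (1, 0) + snd v *\<^sub>R h' (0, 1)" for v
    using add[of "fst v *\<^sub>R (1, 0)" "snd v *\<^sub>R (0, 1)"] scaleR[of "fst v" "(1, 0)"] scaleR[of "snd v" "(0, 1)"]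
    by (cases v) simp
  then have "h' = (\<lambda>v. fst v *\<^sub>R h' (1, 0) + snd v *\<^sub>R h' (0, 1))" by (rule ext)
  then have "has_grad h (h' (1, 0)) (h' (0, 1)) p"
    using h' unfolding has_grad_def by simp
  then show ?thesis using has_grad_pd by fastforce
qed

lemma has_grad_cong:
  assumes "has_grad h A B p" "open D" "p \<in> D" "\<And>z. z \<in> D \<Longrightarrow> k z = h z"
  shows "has_grad k A B p"
  unfolding has_grad_def
  by (rule has_derivative_transform_within_open[OF assms(1)[unfolded has_grad_def] assms(2,3)])
    (use assms(4) in simp)

lemma has_grad_continuous: "has_grad h A B p \<Longrightarrow> isCont h p"
  unfolding has_grad_def by (rule has_derivative_continuous)

named_theorems grad_intros

lemma has_grad_const [grad_intros]: "has_grad (\<lambda>_. k) 0 0 p"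
  unfolding has_grad_def by simp

lemma has_grad_fst [grad_intros]: "has_grad fst 1 0 p"
  unfolding has_grad_def by (auto intro!: derivative_eq_intros)

lemma has_grad_snd [grad_intros]: "has_grad snd 0 1 p"
  unfolding has_grad_def by (auto intro!: derivative_eq_intros)

lemma has_grad_add [grad_intros]:
  "has_grad h A B p \<Longrightarrow> has_grad k C D p \<Longrightarrow> has_grad (\<lambda>z. h z + k z) (A + C) (B + D) p"
  unfolding has_grad_def by (drule (1) has_derivative_add) (simp add: algebra_simps)

lemma has_grad_diff [grad_intros]:
  "has_grad h A B p \<Longrightarrow> has_grad k C D p \<Longrightarrow> has_grad (\<lambda>z. h z - k z) (A - C) (B - D) p"
  unfolding has_grad_def by (drule (1) has_derivative_diff) (simp add: algebra_simps)

lemma has_grad_mult [grad_intros]: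
  fixes h k :: "real \<times> real \<Rightarrow> 'b::real_normed_algebra"
  shows "has_grad h A B p \<Longrightarrow> has_grad k C D p \<Longrightarrow>
    has_grad (\<lambda>z. h z * k z) (h p * C + A * k p) (h p * D + B * k p) p"
  unfolding has_grad_def by (drule (1) has_derivative_mult) (simp add: algebra_simps)

lemma has_grad_sum [grad_intros]:
  "(\<And>i. i \<in> I \<Longrightarrow> has_grad (h i) (A i) (B i) p) \<Longrightarrow>
    has_grad (\<lambda>z. \<Sum>i\<in>I. h i z) (\<Sum>i\<in>I. A i) (\<Sum>i\<in>I. B i) p"
  by (induction I rule: infinite_finite_induct) (auto intro!: grad_intros)

lemma has_grad_linear:
  assumes "bounded_linear L" "has_grad h A B p"
  shows "has_grad (\<lambda>z. L (h z)) (L A) (L B) p"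
proof -
  interpret bounded_linear L by fact
  show ?thesis using has_derivative[OF assms(2)[unfolded has_grad_def]]
    by (simp add: has_grad_def add scaleR)
qed

lemma has_grad_compose_field:
  assumes "has_grad h A B p" "(g has_field_derivative g') (at (h p))"
  shows "has_grad (\<lambda>z. g (h z)) (g' * A) (g' * B) p"
proof -
  have "(g has_derivative (*) g') (at (h p))" using assms(2) by (simp add: has_field_derivative_def)
  from has_derivative_compose[OF assms(1)[unfolded has_grad_def] this]
  show ?thesis by (simp add: has_grad_def algebra_simps)
qed

lemma has_grad_divide:
  fixes h k :: "real \<times> real \<Rightarrow> 'b::real_normed_field"
  assumes "has_grad h A B p" "has_grad k C D p" "k p \<noteq> 0"
  shows "has_grad (\<lambda>z. h z / k z) ((A * k p - h p * C) / (k p)\<^sup>2) ((B * k p - h p * D) / (k p)\<^sup>2) p"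
proof -
  have "((\<lambda>z. inverse z) has_field_derivative - (inverse (k p) ^ Suc (Suc 0))) (at (k p))"
    by (rule DERIV_inverse[OF assms(3)])
  from has_grad_mult[OF assms(1) has_grad_compose_field[OF assms(2) this]]
  show ?thesis using assms(3) unfolding divide_inverse
    by (simp add: field_simps power2_eq_square)
qed

lemma has_grad_sqrt:
  assumes "has_grad h A B p" "h p > 0"
  shows "has_grad (\<lambda>z. sqrt (h z)) (A / (2 * sqrt (h p))) (B / (2 * sqrt (h p))) p"
  using has_grad_compose_field[OF assms(1) DERIV_real_sqrt[OF assms(2)]] by (simp add: field_simps)

lemma has_grad_Complex:
  assumes "has_grad h A B p" "has_grad k C D p"
  shows "has_grad (\<lambda>z. Complex (h z) (k z)) (Complex A C) (Complex B D) p"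
proof -
  have "bounded_linear (\<lambda>x. \<i> * complex_of_real x)"
    by (intro bounded_linear_const_mult bounded_linear_of_real)
  from has_grad_add[OF has_grad_linear[OF bounded_linear_of_real assms(1)] has_grad_linear[OF this assms(2)]]
  show ?thesis by (simp add: Complex_eq)
qed

section \<open>Closure properties of C1 and C2 functions\<close>

lemma C1_onD:
  assumes "C1_on D h"
  shows "p \<in> D \<Longrightarrow> has_grad h (pdx h p) (pdy h p) p" "continuous_on D (pdx h)" "continuous_on D (pdy h)"
    "continuous_on D h"
proof -
  show g: "has_grad h (pdx h p) (pdy h p) p" if "p \<in> D" for p
    using assms that differentiable_imp_has_grad unfolding C1_on_def by blast
  show "continuous_on D h"
    using has_grad_continuous[OF g] by (simp add: continuous_at_imp_continuous_on)
qed (use assms in \<open>auto simp: C1_on_def\<close>)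

lemma C1_onI:
  assumes "\<And>p. p \<in> D \<Longrightarrow> has_grad h (A p) (B p) p" "continuous_on D A" "continuous_on D B"
  shows "C1_on D h"
proof -
  have "h differentiable (at p)" if "p \<in> D" for p
    using assms(1)[OF that] unfolding has_grad_def differentiable_def by blast
  moreover have "continuous_on D (pdx h)" "continuous_on D (pdy h)"
    using assms(2,3) has_grad_pd[OF assms(1)] continuous_on_cong[OF refl] by (metis (no_types, lifting))+
  ultimately show ?thesis by (simp add: C1_on_def)
qed

lemma C1_on_cong:
  assumes "open D" "C1_on D h" "\<And>p. p \<in> D \<Longrightarrow> k p = h p"
  shows "C1_on D k"
  by (rule C1_onI[where A = "pdx h" and B = "pdy h"])
    (use C1_onD[OF assms(2)] has_grad_cong[OF _ assms(1) _ assms(3)] in auto)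

lemma C2_onI:
  assumes "open D" "\<And>p. p \<in> D \<Longrightarrow> has_grad h (A p) (B p) p" "C1_on D A" "C1_on D B"
  shows "C2_on D h"
  unfolding C2_on_def
proof (intro conjI)
  show "C1_on D h" by (rule C1_onI[OF assms(2)]) (use C1_onD(4) assms(3,4) in auto)
  show "C1_on D (pdx h)" "C1_on D (pdy h)"
    using C1_on_cong[OF assms(1,3)] C1_on_cong[OF assms(1,4)] has_grad_pd[OF assms(2)] by auto
qed

lemma C2_onD:
  assumes "C2_on D h"
  shows "C1_on D h" "C1_on D (pdx h)" "C1_on D (pdy h)"
  using assms by (auto simp: C2_on_def)

lemma C1_on_const: "C1_on D (\<lambda>_. k)"
  by (rule C1_onI[OF has_grad_const]) auto

lemma C1_on_add: "C1_on D h \<Longrightarrow> C1_on D k \<Longrightarrow> C1_on D (\<lambda>z. h z + k z)"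
  by (rule C1_onI[OF has_grad_add]) (auto dest: C1_onD intro!: continuous_intros)

lemma C1_on_diff: "C1_on D h \<Longrightarrow> C1_on D k \<Longrightarrow> C1_on D (\<lambda>z. h z - k z)"
  by (rule C1_onI[OF has_grad_diff]) (auto dest: C1_onD intro!: continuous_intros)

lemma C1_on_mult: "C1_on D h \<Longrightarrow> C1_on D k \<Longrightarrow> C1_on D (\<lambda>z. h z * k z)"
  by (rule C1_onI[OF has_grad_mult]) (auto dest: C1_onD intro!: continuous_intros)

lemma C1_on_sum: "(\<And>i. i \<in> I \<Longrightarrow> C1_on D (h i)) \<Longrightarrow> C1_on D (\<lambda>z. \<Sum>i\<in>I. h i z)"
  by (induction I rule: infinite_finite_induct) (auto intro!: C1_on_const C1_on_add)

lemma C1_on_divide: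
  "C1_on D h \<Longrightarrow> C1_on D k \<Longrightarrow> (\<And>z. z \<in> D \<Longrightarrow> k z \<noteq> 0) \<Longrightarrow> C1_on D (\<lambda>z. h z / k z)"
  by (rule C1_onI[OF has_grad_divide]) (auto dest: C1_onD intro!: continuous_intros)

lemma C1_on_sqrt:
  "C1_on D h \<Longrightarrow> (\<And>z. z \<in> D \<Longrightarrow> h z > 0) \<Longrightarrow> C1_on D (\<lambda>z. sqrt (h z))"
  by (rule C1_onI[OF has_grad_sqrt]) (force dest: C1_onD intro!: continuous_intros)+

section \<open>Mixed partial derivatives and potentials of closed forms\<close>

lemma open_contains_square:
  fixes D :: "(real \<times> real) set"
  assumes "open D" "p \<in> D"
  obtains e where "e > 0" "{fst p - e..fst p + e} \<times> {snd p - e..snd p + e} \<subseteq> D"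
proof -
  obtain U V where UV: "open U" "open V" "fst p \<in> U" "snd p \<in> V" "U \<times> V \<subseteq> D"
    by (rule open_prod_elim[OF assms]) auto
  obtain e1 where e1: "e1 > 0" "cball (fst p) e1 \<subseteq> U" using UV open_contains_cball by blast
  obtain e2 where e2: "e2 > 0" "cball (snd p) e2 \<subseteq> V" using UV open_contains_cball by blast
  define e where "e = min e1 e2"
  have "{fst p - e..fst p + e} \<subseteq> cball (fst p) e1" "{snd p - e..snd p + e} \<subseteq> cball (snd p) e2"
    by (auto simp: e_def dist_real_def)
  then have "{fst p - e..fst p + e} \<times> {snd p - e..snd p + e} \<subseteq> D" using e1 e2 UV(5) by blast
  then show ?thesis using that[of e] e1 e2 by (simp add: e_def)
qed

lemma DERIV_within_interior:
  "(f has_real_derivative d) (at x within {a..b}) \<Longrightarrow> a < x \<Longrightarrow> x < b \<Longrightarrow> (f has_real_derivative d) (at x)"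
  by (metis at_within_Icc_at)

lemma horizontal_DERIV:
  assumes "C1_on D h" "(x, y) \<in> D"
  shows "((\<lambda>x. h (x, y)) has_real_derivative pdx h (x, y)) (at x within S)"
  using has_grad_horizontal[OF C1_onD(1)[OF assms]]
  by (simp add: has_real_derivative_iff_has_vector_derivative has_vector_derivative_at_within)

lemma vertical_DERIV:
  assumes "C1_on D h" "(x, y) \<in> D"
  shows "((\<lambda>y. h (x, y)) has_real_derivative pdy h (x, y)) (at y within S)"
  using has_grad_vertical[OF C1_onD(1)[OF assms]]
  by (simp add: has_real_derivative_iff_has_vector_derivative has_vector_derivative_at_within)

lemma DERIV_integral_parameter:
  assumes h: "C1_on D h" and sub: "{a..b} \<times> {c..d} \<subseteq> D" and x: "a < x" "x < b"
  shows "((\<lambda>x. integral {c..d} (\<lambda>t. h (x, t))) has_real_derivative integral {c..d} (\<lambda>t. pdx h (x, t))) (at x)"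
proof -
  have "((\<lambda>x. integral (cbox c d) ((\<lambda>x t. h (x, t)) x)) has_real_derivative
      integral (cbox c d) ((\<lambda>x t. pdx h (x, t)) x)) (at x within {a..b})"
  proof (rule leibniz_rule_field_derivative)
    show "((\<lambda>x. h (x, t)) has_real_derivative pdx h (x, t)) (at x within {a..b})"
      if "x \<in> {a..b}" "t \<in> cbox c d" for x t
      by (rule horizontal_DERIV[OF h]) (use that sub in auto)
    show "(\<lambda>t. h (x, t)) integrable_on cbox c d" if "x \<in> {a..b}" for x
      by (intro integrable_continuous continuous_on_compose2[OF C1_onD(4)[OF h]] continuous_intros)
        (use that sub in auto)
    show "continuous_on ({a..b} \<times> cbox c d) (\<lambda>(x, t). pdx h (x, t))"
      using continuous_on_subset[OF C1_onD(2)[OF h] sub] by simp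
  qed (use x in auto)
  then show ?thesis using DERIV_within_interior x by simp
qed

text \<open>Schwarz's theorem by integration: a vertical increment of h is the integral of its
  y-derivative. Differentiating in x under the integral and then in the upper limit produces the two
  mixed derivatives.\<close>

lemma mixed_partials:
  assumes "open D" "C2_on D h" "p \<in> D"
  shows "pdy (pdx h) p = pdx (pdy h) p"
proof -
  note c = C2_onD[OF assms(2)]
  obtain e where e: "e > 0" "{fst p - e..fst p + e} \<times> {snd p - e..snd p + e} \<subseteq> D"
    using open_contains_square[OF assms(1,3)] by blast
  define x y where "x = fst p" and "y = snd p"
  have p: "p = (x, y)" by (simp add: x_def y_def)
  have sub: "{x - e..x + e} \<times> {y - e..y + e} \<subseteq> D" using e(2) by (simp add: x_def y_def)
  have eq: "pdx h (x, d) - pdx h (x, y - e) = integral {y - e..d} (\<lambda>t. pdx (pdy h) (x, t))"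
    if d: "d \<in> {y - e..y + e}" for d
  proof -
    have fund: "h (z, d) - h (z, y - e) = integral {y - e..d} (\<lambda>t. pdy h (z, t))" if z: "z \<in> {x - e..x + e}" for z
    proof -
      have "((\<lambda>t. pdy h (z, t)) has_integral h (z, d) - h (z, y - e)) {y - e..d}"
      proof (rule fundamental_theorem_of_calculus)
        show "((\<lambda>t. h (z, t)) has_vector_derivative pdy h (z, t)) (at t within {y - e..d})" if "t \<in> {y - e..d}" for t
        proof -
          have "(z, t) \<in> D" using sub z d that by auto
          from vertical_DERIV[OF c(1) this] show ?thesis
            by (simp add: has_real_derivative_iff_has_vector_derivative)
        qed
      qed (use d in auto)
      then show ?thesis by (simp add: integral_unique)
    qed
    have "((\<lambda>z. h (z, d) - h (z, y - e)) has_real_derivative pdx h (x, d) - pdx h (x, y - e)) (at x)"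
      by (intro DERIV_diff horizontal_DERIV[OF c(1)]) (use sub e d in auto)
    moreover have "((\<lambda>z. integral {y - e..d} (\<lambda>t. pdy h (z, t))) has_real_derivative
        integral {y - e..d} (\<lambda>t. pdx (pdy h) (x, t))) (at x)"
      by (rule DERIV_integral_parameter[OF c(3), of "x - e" "x + e"]) (use sub e d in auto)
    then have "((\<lambda>z. h (z, d) - h (z, y - e)) has_real_derivative
        integral {y - e..d} (\<lambda>t. pdx (pdy h) (x, t))) (at x)"
      by (rule DERIV_cong_ev[THEN iffD1, OF refl _ refl, rotated])
        (use e fund eventually_nhds_in_open[of "{x - e<..<x + e}" x] in \<open>auto elim!: eventually_mono\<close>)
    ultimately show ?thesis by (rule DERIV_unique)
  qed
  have cont: "continuous_on {y - e..y + e} (\<lambda>t. pdx (pdy h) (x, t))"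
    by (intro continuous_on_compose2[OF C1_onD(2)[OF c(3)]] continuous_intros) (use sub e in auto)
  have "((\<lambda>d. integral {y - e..d} (\<lambda>t. pdx (pdy h) (x, t))) has_real_derivative pdx (pdy h) (x, y)) (at y within {y - e..y + e})"
    by (rule integral_has_real_derivative[OF cont]) (use e in auto)
  then have "((\<lambda>d. integral {y - e..d} (\<lambda>t. pdx (pdy h) (x, t))) has_real_derivative pdx (pdy h) (x, y)) (at y)"
    by (rule DERIV_within_interior) (use e in auto)
  then have "((\<lambda>d. pdx h (x, d) - pdx h (x, y - e)) has_real_derivative pdx (pdy h) (x, y)) (at y)"
    by (rule DERIV_cong_ev[THEN iffD1, OF refl _ refl, rotated])
      (use e eq eventually_nhds_in_open[of "{y - e<..<y + e}" y] in \<open>auto elim!: eventually_mono\<close>)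
  moreover have "((\<lambda>d. pdx h (x, d) - pdx h (x, y - e)) has_real_derivative pdy (pdx h) (x, y) - 0) (at y)"
    by (intro DERIV_diff vertical_DERIV[OF c(2)] DERIV_const) (use sub e in auto)
  ultimately show ?thesis unfolding p using DERIV_unique by fastforce
qed

text \<open>An asymmetric criterion for total differentiability: the x-derivative at the point,
  together with a continuous y-derivative around it.\<close>

lemma has_grad_partials:
  fixes u :: "real \<times> real \<Rightarrow> real"
  assumes "open D" "(x, y) \<in> D"
    and ux: "((\<lambda>x. u (x, y)) has_real_derivative A) (at x)"
    and uy: "\<And>x y. (x, y) \<in> D \<Longrightarrow> ((\<lambda>y. u (x, y)) has_real_derivative B (x, y)) (at y)"
    and cB: "continuous_on D B"
  shows "has_grad u A (B (x, y)) (x, y)"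
proof -
  obtain U V where UV: "open U" "open V" "x \<in> U" "y \<in> V" "U \<times> V \<subseteq> D"
    by (rule open_prod_elim[OF assms(1,2)]) auto
  obtain e where e: "e > 0" "ball y e \<subseteq> V" using UV openE by blast
  have sub: "U \<times> ball y e \<subseteq> D" using e UV by blast
  have "((\<lambda>(x, y). curry u x y) has_derivative
      (\<lambda>(tx, ty). (*) A tx + blinfun_apply (blinfun_mult_right (B (x, y))) ty)) (at (x, y) within U \<times> ball y e)"
  proof (rule has_derivative_partialsI[where fy = "\<lambda>x y. blinfun_mult_right (B (x, y))"])
    show "((\<lambda>x. curry u x y) has_derivative (*) A) (at x within U)"
      using ux unfolding has_field_derivative_def curry_def by (rule has_derivative_at_withinI)
    show "(curry u x' has_derivative blinfun_apply (blinfun_mult_right (B (x', y')))) (at y' within ball y e)"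
      if "x' \<in> U" "y' \<in> ball y e" for x' y'
    proof -
      have "(x', y') \<in> D" using sub that by blast
      from uy[OF this] show ?thesis
        by (simp add: has_field_derivative_def curry_def[abs_def] has_derivative_at_withinI)
    qed
    have "isCont B (x, y)" using cB assms(1,2) continuous_on_eq_continuous_at by blast
    then have "isCont (\<lambda>z. blinfun_mult_right (B z)) (x, y)"
      by (rule bounded_linear.continuous[OF bounded_linear_blinfun_mult_right])
    then show "continuous (at (x, y) within U \<times> ball y e) (\<lambda>(x, y). blinfun_mult_right (B (x, y)))"
      by (simp add: continuous_at_imp_continuous_at_within case_prod_beta')
  qed (use e in auto)
  moreover have "open (U \<times> ball y e)" "(x, y) \<in> U \<times> ball y e" using UV e by (auto intro: open_Times)
  ultimately show ?thesis unfolding has_grad_def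
    by (simp add: at_within_open[of "(x, y)" "U \<times> ball y e"] case_prod_beta' mult.commute)
qed

text \<open>The potential is the integral along the bottom edge of a rectangle and then upwards. Its
  y-derivative is immediate; for the x-derivative the vertical integral is differentiated under the
  integral sign, and closedness makes the result telescope to P.\<close>

lemma local_potential:
  assumes D: "open D" "p \<in> D" and P: "C1_on D P" and Q: "C1_on D Q"
    and closed: "\<And>z. z \<in> D \<Longrightarrow> pdy P z = pdx Q z"
  obtains N u where "open N" "p \<in> N" "\<forall>z\<in>N. has_grad u (P z) (Q z) z"
proof -
  obtain e where e: "e > 0" "{fst p - e..fst p + e} \<times> {snd p - e..snd p + e} \<subseteq> D"
    using open_contains_square[OF D] by blast
  define a b where "a = fst p - e" and "b = snd p - e"
  define a' b' where "a' = fst p + e" and "b' = snd p + e"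
  have sub: "{a..a'} \<times> {b..b'} \<subseteq> D" using e(2) by (simp add: a_def b_def a'_def b'_def)
  define N where "N = {a<..<a'} \<times> {b<..<b'}"
  define u where "u = (\<lambda>z. integral {a..fst z} (\<lambda>t. P (t, b)) + integral {b..snd z} (\<lambda>t. Q (fst z, t)))"
  have N: "open N" "p \<in> N" using e(1) by (auto simp: N_def a_def b_def a'_def b'_def mem_Times_iff intro: open_Times)
  have ND: "N \<subseteq> D" using sub by (auto simp: N_def)
  have cQ: "continuous_on {b..b'} (\<lambda>t. Q (x, t))" if "x \<in> {a..a'}" for x
    by (intro continuous_on_compose2[OF C1_onD(4)[OF Q]] continuous_intros) (use sub that in auto)
  have "b < b'" using N by (auto simp: N_def)
  then have cP: "continuous_on {a..a'} (\<lambda>t. P (t, b))"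
    by (intro continuous_on_compose2[OF C1_onD(4)[OF P]] continuous_intros) (use sub in auto)
  have uy: "((\<lambda>y. u (x, y)) has_real_derivative Q (x, y)) (at y)" if "(x, y) \<in> N" for x y
  proof -
    have "((\<lambda>y. integral {b..y} (\<lambda>t. Q (x, t))) has_real_derivative Q (x, y)) (at y within {b..b'})"
      by (rule integral_has_real_derivative[OF cQ]) (use that in \<open>auto simp: N_def\<close>)
    then have "((\<lambda>y. integral {b..y} (\<lambda>t. Q (x, t))) has_real_derivative Q (x, y)) (at y)"
      by (rule DERIV_within_interior) (use that in \<open>auto simp: N_def\<close>)
    from DERIV_add[OF DERIV_const this] show ?thesis by (simp add: u_def)
  qed
  have ux: "((\<lambda>x. u (x, y)) has_real_derivative P (x, y)) (at x)" if z: "(x, y) \<in> N" for x y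
  proof -
    have "((\<lambda>x. integral {a..x} (\<lambda>t. P (t, b))) has_real_derivative P (x, b)) (at x within {a..a'})"
      by (rule integral_has_real_derivative[OF cP]) (use z in \<open>auto simp: N_def\<close>)
    then have 1: "((\<lambda>x. integral {a..x} (\<lambda>t. P (t, b))) has_real_derivative P (x, b)) (at x)"
      by (rule DERIV_within_interior) (use z in \<open>auto simp: N_def\<close>)
    have 2: "((\<lambda>x. integral {b..y} (\<lambda>t. Q (x, t))) has_real_derivative integral {b..y} (\<lambda>t. pdx Q (x, t))) (at x)"
      by (rule DERIV_integral_parameter[OF Q, of a a']) (use sub z in \<open>auto simp: N_def\<close>)
    have "((\<lambda>t. pdx Q (x, t)) has_integral P (x, y) - P (x, b)) {b..y}"
    proof (rule fundamental_theorem_of_calculus)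
      show "((\<lambda>t. P (x, t)) has_vector_derivative pdx Q (x, t)) (at t within {b..y})" if "t \<in> {b..y}" for t
      proof -
        have "(x, t) \<in> D" using sub z that by (auto simp: N_def)
        from vertical_DERIV[OF P this] closed[OF this] show ?thesis
          by (simp add: has_real_derivative_iff_has_vector_derivative)
      qed
    qed (use z in \<open>auto simp: N_def\<close>)
    then have "integral {b..y} (\<lambda>t. pdx Q (x, t)) = P (x, y) - P (x, b)" by (rule integral_unique)
    with DERIV_add[OF 1 2] show ?thesis by (simp add: u_def)
  qed
  have "has_grad u (P z) (Q z) z" if "z \<in> N" for z
    using has_grad_partials[OF N(1), of "fst z" "snd z" u "P z" Q] ux[of "fst z" "snd z"] uy that
      continuous_on_subset[OF C1_onD(4)[OF Q] ND] by simp
  then show ?thesis using that[OF N] by blast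
qed

section \<open>Coordinates and potentials\<close>

context flat_surface
begin

lemma hol_derivative:
  assumes "open U" "U \<subseteq> X" "\<And>q. q \<in> U \<Longrightarrow> ((\<lambda>x. (f x - f q) / (T x - T q)) \<longlongrightarrow> l q) (at q)"
  shows "hol U l"
proof (rule hol_chartI[OF assms(1,2)])
  fix q r s assume *: "q \<in> U" "chart q r s" "s ` ball (T q) r \<subseteq> U"
  have "hol U f" unfolding hol_def using assms(3) by blast
  then have h: "(\<lambda>w. f (s w)) holomorphic_on ball (T q) r" using hol_chart[OF *(2) _ *(3)] by blast
  have "deriv (\<lambda>w. f (s w)) w = l (s w)" if w: "w \<in> ball (T q) r" for w
  proof -
    have "s w \<in> U" using *(3) w by blast
    from chart_field_derivative[OF *(2) w assms(3)[OF this]] show ?thesis by (rule DERIV_imp_deriv)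
  qed
  then show "(\<lambda>w. l (s w)) holomorphic_on ball (T q) r"
    by (rule holomorphic_transform[OF holomorphic_deriv[OF h open_ball]])
qed

lemma open_injective_image:
  assumes "hol X F" "inj_on F X"
  shows "open (F ` X)"
  using invariance_of_domain_gen[OF open_X hol_continuous[OF open_X order_refl assms(1)]] assms(2) dim_X by simp

text \<open>In a chart an injective F is an injective holomorphic function, so its inverse is
  holomorphic as well. Thus F may replace \<open>T\<close> as coordinate, now globally.\<close>

lemma hol_injective_inverse:
  assumes F: "hol X F" "inj_on F X" and f: "hol X f"
  shows "(\<lambda>w. f (inv_into X F w)) holomorphic_on F ` X"
proof -
  have "(\<lambda>w. f (inv_into X F w)) field_differentiable at w" if w: "w \<in> F ` X" for w
  proof -
    obtain q where q: "q \<in> X" "w = F q" using w by blast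
    obtain r s where c: "chart q r s" "s ` ball (T q) r \<subseteq> X" by (rule exists_chart[OF q(1) open_X q(1)])
    note c' = chartD[OF c(1)]
    define k where "k = (\<lambda>w. F (s w))"
    have k: "k holomorphic_on ball (T q) r" unfolding k_def by (rule hol_chart[OF c(1) F(1) c(2)])
    have "inj_on k (ball (T q) r)"
    proof (rule inj_onI)
      fix y z assume yz: "y \<in> ball (T q) r" "z \<in> ball (T q) r" "k y = k z"
      then have "s y = s z" using inj_onD[OF F(2)] c'(5) unfolding k_def by blast
      then show "y = z" using c'(6) yz by metis
    qed
    then obtain g where g: "g holomorphic_on k ` ball (T q) r" "\<And>z. z \<in> ball (T q) r \<Longrightarrow> g (k z) = z"
      by (rule holomorphic_has_inverse[OF k open_ball]) blast
    have op: "open (k ` ball (T q) r)" by (rule open_mapping_thm3[OF k open_ball \<open>inj_on k _\<close>])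
    have "(\<lambda>z. f (s (g z))) holomorphic_on k ` ball (T q) r"
      using holomorphic_on_compose_gen[OF g(1) hol_chart[OF c(1) f c(2)]] g(2) by (force simp: o_def)
    moreover have "f (s (g z)) = f (inv_into X F z)" if "z \<in> k ` ball (T q) r" for z
    proof -
      obtain y where y: "y \<in> ball (T q) r" "z = F (s y)" using \<open>z \<in> k ` ball (T q) r\<close> unfolding k_def by blast
      have "inv_into X F z = s y" unfolding y(2) by (rule inv_into_f_f[OF F(2) c'(5)[OF y(1)]])
      then show ?thesis using g(2)[OF y(1)] y(2) by (simp add: k_def)
    qed
    ultimately have "(\<lambda>w. f (inv_into X F w)) holomorphic_on k ` ball (T q) r"
      by (rule holomorphic_transform)
    moreover have "w \<in> k ` ball (T q) r" unfolding k_def q(2)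
      using c'(1,3) by (intro image_eqI[of _ _ "T q"]) auto
    ultimately show ?thesis using op holomorphic_on_imp_differentiable_at by blast
  qed
  then show ?thesis unfolding holomorphic_on_def using field_differentiable_at_within by blast
qed

end

lemma (in flat_surface) chart_center:
  assumes "q \<in> X"
  obtains r s where "chart q r s" "s ` ball (T q) r \<subseteq> X"
  by (rule exists_chart[OF assms open_X assms])

locale plane_flat_surface = flat_surface X T for X :: "(real \<times> real) set" and T
begin

lemma quotient_has_grad:
  assumes "q \<in> X" "has_grad T Tx Ty q" "((\<lambda>x. (f x - f q) / (T x - T q)) \<longlongrightarrow> l) (at q)"
  shows "has_grad f (l * Tx) (l * Ty) q"
proof -
  obtain r s where c: "chart q r s" "s ` ball (T q) r \<subseteq> X" by (rule chart_center[OF assms(1)])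
  note c' = chartD[OF c(1)]
  have "((\<lambda>w. f (s w)) has_field_derivative l) (at (T q))"
    by (rule chart_field_derivative[OF c(1)]) (use c'(1,3) assms(3) in simp_all)
  from has_grad_cong[OF has_grad_compose_field[OF assms(2) this] c'(4,9)]
  show ?thesis using c'(7) by simp
qed

end

text \<open>The difference f - l T has derivative 0 at q, so its increment is small compared with
  the distance to q, whereas the increment of \<open>T\<close> is eventually at least k / 2 times
  that distance.\<close>

lemma quotient_limit:
  fixes T f :: "real \<times> real \<Rightarrow> complex"
  assumes T: "has_grad T Tx Ty q" and f: "has_grad f (l * Tx) (l * Ty) q"
    and k: "k > 0" "\<And>v. cmod (fst v *\<^sub>R Tx + snd v *\<^sub>R Ty) \<ge> k * norm v"
  shows "((\<lambda>x. (f x - f q) / (T x - T q)) \<longlongrightarrow> l) (at q)"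
proof -
  define T' where "T' = (\<lambda>v. fst v *\<^sub>R Tx + snd v *\<^sub>R Ty)"
  have dT: "(T has_derivative T') (at q)" using T by (simp add: has_grad_def T'_def)
  have "((\<lambda>x. f x - l * T x) has_derivative (\<lambda>v. 0)) (at q)"
    using has_grad_diff[OF f has_grad_mult[OF has_grad_const[of l] T]] by (simp add: has_grad_def)
  then have D: "((\<lambda>x. norm (f x - l * T x - (f q - l * T q)) / norm (x - q)) \<longlongrightarrow> 0) (at q)"
    unfolding has_derivative_iff_norm by simp
  have "((\<lambda>x. norm (T x - T q - T' (x - q)) / norm (x - q)) \<longlongrightarrow> 0) (at q)"
    using dT unfolding has_derivative_iff_norm by simp
  then have "\<forall>\<^sub>F x in at q. norm (T x - T q - T' (x - q)) / norm (x - q) < k / 2"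
    using k(1) by (intro order_tendstoD(2)) auto
  moreover have ne: "\<forall>\<^sub>F x in at q. x \<noteq> q" by (simp add: eventually_at_filter)
  ultimately have low: "\<forall>\<^sub>F x in at q. norm (T x - T q) \<ge> k / 2 * norm (x - q)"
  proof eventually_elim
    case (elim x)
    have "norm (T x - T q - T' (x - q)) < k / 2 * norm (x - q)"
      using elim by (simp add: pos_divide_less_eq)
    moreover have "norm (T' (x - q)) \<ge> k * norm (x - q)" using k(2)[of "x - q"] by (simp add: T'_def)
    moreover have "norm (T' (x - q)) \<le> norm (T x - T q) + norm (T x - T q - T' (x - q))"
      using norm_triangle_ineq4[of "T x - T q" "T x - T q - T' (x - q)"] by simp
    ultimately show ?case by (simp add: field_simps)
  qed
  have "((\<lambda>x. (f x - f q) / (T x - T q) - l) \<longlongrightarrow> 0) (at q)"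
  proof (rule Lim_null_comparison)
    show "((\<lambda>x. 2 / k * (norm (f x - l * T x - (f q - l * T q)) / norm (x - q))) \<longlongrightarrow> 0) (at q)"
      by (rule tendsto_mult_right_zero[OF D])
    show "\<forall>\<^sub>F x in at q. norm ((f x - f q) / (T x - T q) - l) \<le> 2 / k * (norm (f x - l * T x - (f q - l * T q)) / norm (x - q))"
      using low ne
    proof eventually_elim
      case (elim x)
      then have xq: "norm (x - q) > 0" by simp
      then have pos: "k / 2 * norm (x - q) > 0" using k(1) by simp
      then have nz: "T x - T q \<noteq> 0" using elim by auto
      have "(f x - f q) / (T x - T q) - l = (f x - l * T x - (f q - l * T q)) / (T x - T q)"
        using nz by (simp add: field_simps)
      then have "norm ((f x - f q) / (T x - T q) - l) = norm (f x - l * T x - (f q - l * T q)) / norm (T x - T q)"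
        by (simp add: norm_divide)
      also have "\<dots> \<le> norm (f x - l * T x - (f q - l * T q)) / (k / 2 * norm (x - q))"
      proof (rule divide_left_mono)
        show "k / 2 * norm (x - q) \<le> norm (T x - T q)" using elim by simp
        then have "0 < norm (T x - T q)" using pos by linarith
        then show "0 < norm (T x - T q) * (k / 2 * norm (x - q))" using pos by (rule mult_pos_pos)
      qed simp
      finally show ?case by (simp add: field_simps)
    qed
  qed
  then show ?thesis by (simp add: LIM_zero_iff)
qed

text \<open>Two potentials on a connected open set differ by a constant, so
  \<open>global_section\<close> applies with translations as changes of section.\<close>

lemma global_potential:
  assumes D: "open D" "simply_connected D" "D \<noteq> {}" and P: "C1_on D P" and Q: "C1_on D Q"
    and closed: "\<And>z. z \<in> D \<Longrightarrow> pdy P z = pdx Q z"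
  shows "\<exists>u. \<forall>z\<in>D. has_grad u (P z) (Q z) z"
proof -
  interpret local_sections D "\<lambda>z u. has_grad u (P z) (Q z) z" "range (\<lambda>k x. x + k)"
  proof
    show "open D" by (rule D(1))
    show "has_grad v (P x) (Q x) x" if "has_grad u (P x) (Q x) x" "open N" "x \<in> N" "\<And>y. y \<in> N \<Longrightarrow> v y = u y"
      for x u v N
      by (rule has_grad_cong[OF that])
    show "\<exists>N u. open N \<and> x \<in> N \<and> (\<forall>y\<in>N. has_grad u (P y) (Q y) y)" if x: "x \<in> D" for x
      by (rule local_potential[OF D(1) x P Q closed]) blast+
    show "has_grad (\<lambda>y. \<alpha> (u y)) (P x) (Q x) x" if \<alpha>: "\<alpha> \<in> range (\<lambda>k x. x + k)" and u: "has_grad u (P x) (Q x) x" for \<alpha> x u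
    proof -
      obtain k where k: "\<alpha> = (\<lambda>x. x + k)" using \<alpha> by blast
      show ?thesis unfolding k using has_grad_add[OF u has_grad_const[of k]] by simp
    qed
    show "\<exists>\<alpha>\<in>range (\<lambda>k x. x + k). \<forall>y\<in>U. \<alpha> (u y) = v y"
      if U: "open U" "connected U" "U \<noteq> {}" and u: "\<And>y. y \<in> U \<Longrightarrow> has_grad u (P y) (Q y) y"
        and v: "\<And>y. y \<in> U \<Longrightarrow> has_grad v (P y) (Q y) y" for U u v
    proof -
      obtain x0 where x0: "x0 \<in> U" using U(3) by blast
      have "v y - u y = v x0 - u x0" if y: "y \<in> U" for y
      proof (rule has_derivative_zero_unique_connected[OF U(1,2) _ y x0])
        show "((\<lambda>y. v y - u y) has_derivative (\<lambda>x. 0)) (at x)" if "x \<in> U" for x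
          using has_grad_diff[OF v[OF that] u[OF that]] by (simp add: has_grad_def)
      qed
      then have "\<forall>y\<in>U. u y + (v x0 - u x0) = v y" by (auto simp: algebra_simps)
      then show ?thesis by (intro bexI[of _ "\<lambda>x. x + (v x0 - u x0)"]) auto
    qed
  qed
  show ?thesis by (rule global_section[OF simply_connected_homeomorphic_plane[OF D]])
qed

section \<open>Conformal representation\<close>

definition to_complex :: "real \<times> real \<Rightarrow> complex" where
  "to_complex p = Complex (fst p) (snd p)"

lemma has_grad_to_complex: "has_grad to_complex 1 \<i> p"
  using has_grad_Complex[OF has_grad_fst has_grad_snd]
  by (simp add: to_complex_def[abs_def] one_complex.code[symmetric] imaginary_unit.code[symmetric])

lemma has_grad_Re: "has_grad h A B p \<Longrightarrow> has_grad (\<lambda>z. Re (h z)) (Re A) (Re B) p"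
  by (rule has_grad_linear[OF bounded_linear_Re])

lemma has_grad_Im: "has_grad h A B p \<Longrightarrow> has_grad (\<lambda>z. Im (h z)) (Im A) (Im B) p"
  by (rule has_grad_linear[OF bounded_linear_Im])

lemma real_part_has_grad:
  assumes "open U" "K holomorphic_on U" "to_complex p \<in> U"
  shows "has_grad (\<lambda>z. Re (K (to_complex z))) (Re (deriv K (to_complex p))) (- Im (deriv K (to_complex p))) p"
proof -
  have "(K has_field_derivative deriv K (to_complex p)) (at (to_complex p))"
    using holomorphic_derivI[OF assms(2,1,3)] .
  from has_grad_Re[OF has_grad_compose_field[OF has_grad_to_complex this]]
  show ?thesis by simp
qed

lemma continuous_on_to_complex: "continuous_on S to_complex"
  unfolding to_complex_def Complex_eq by (intro continuous_intros)

lemma C1_real_part: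
  assumes "open U" "K holomorphic_on U"
  shows "C1_on {p. to_complex p \<in> U} (\<lambda>z. Re (K (to_complex z)))"
proof (rule C1_onI[OF real_part_has_grad[OF assms]])
  have "continuous_on U (deriv K)"
    using holomorphic_deriv[OF assms(2,1)] holomorphic_on_imp_continuous_on by blast
  then have "continuous_on {p. to_complex p \<in> U} (\<lambda>p. deriv K (to_complex p))"
    by (rule continuous_on_compose2[OF _ continuous_on_to_complex]) auto
  then show "continuous_on {p. to_complex p \<in> U} (\<lambda>p. Re (deriv K (to_complex p)))"
    "continuous_on {p. to_complex p \<in> U} (\<lambda>p. - Im (deriv K (to_complex p)))"
    by (intro continuous_intros; simp)+
qed simp

lemma open_complex_region: "open U \<Longrightarrow> open {p. to_complex p \<in> U}"
  using continuous_open_preimage[OF continuous_on_to_complex open_UNIV] by (simp add: vimage_def)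

lemma harmonic_real_part:
  assumes U: "open U" "K holomorphic_on U" and W: "W = {p. to_complex p \<in> U}"
    and y: "\<And>p. p \<in> W \<Longrightarrow> y p = Re (K (to_complex p))"
  shows "harmonic_on W y"
    and "\<And>p. p \<in> W \<Longrightarrow> has_grad y (Re (deriv K (to_complex p))) (- Im (deriv K (to_complex p))) p"
proof -
  have oW: "open W" unfolding W by (rule open_complex_region[OF U(1)])
  show g: "has_grad y (Re (deriv K (to_complex p))) (- Im (deriv K (to_complex p))) p" if "p \<in> W" for p
    by (rule has_grad_cong[OF real_part_has_grad[OF U] oW that y]) (use that W in auto)
  have K': "deriv K holomorphic_on U" using holomorphic_deriv[OF U(2,1)] .
  \<comment> \<open>The y-derivative of Re K is - Im K' = Re (i K'), so multiplying by i reduces it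
    to the case of real parts.\<close>
  have iK': "(\<lambda>z. \<i> * deriv K z) holomorphic_on U" by (intro holomorphic_intros K')
  have c1: "C1_on W (\<lambda>p. Re (deriv K (to_complex p)))" unfolding W by (rule C1_real_part[OF U(1) K'])
  have c2: "C1_on W (\<lambda>p. - Im (deriv K (to_complex p)))"
    using C1_real_part[OF U(1) iK'] unfolding W by simp
  have "C2_on W y" by (rule C2_onI[OF oW g c1 c2])
  moreover have "pdx (pdx y) p + pdy (pdy y) p = 0" if p: "p \<in> W" for p
  proof -
    have pU: "to_complex p \<in> U" using p W by simp
    have "has_grad (pdx y) (Re (deriv (deriv K) (to_complex p))) (- Im (deriv (deriv K) (to_complex p))) p"
      by (rule has_grad_cong[OF real_part_has_grad[OF U(1) K' pU] oW p]) (use g has_grad_pd in blast)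
    moreover have "has_grad (pdy y) (Re (deriv (\<lambda>z. \<i> * deriv K z) (to_complex p)))
        (- Im (deriv (\<lambda>z. \<i> * deriv K z) (to_complex p))) p"
      by (rule has_grad_cong[OF real_part_has_grad[OF U(1) iK' pU] oW p]) (use has_grad_pd(2)[OF g] in simp)
    moreover have "deriv (\<lambda>z. \<i> * deriv K z) (to_complex p) = \<i> * deriv (deriv K) (to_complex p)"
      using holomorphic_on_imp_differentiable_at[OF K' U(1) pU] by (rule deriv_cmult)
    ultimately show ?thesis using has_grad_pd by fastforce
  qed
  ultimately show "harmonic_on W y" by (simp add: harmonic_on_def)
qed

text \<open>The ambient square of a X_x + b X_y is (a^2 + b^2) times the positive conformal factor,
  even for an indefinite signature, so a vanishing combination has zero coefficients.\<close>

lemma conformal_imp_immersion: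
  assumes "conformal_on \<epsilon> m Y W"
  shows "immersion_on m Y W"
  unfolding immersion_on_def
proof (intro ballI allI impI)
  fix w a b assume w: "w \<in> W" and ab: "\<forall>j\<in>{1..m}. a * tan_x Y w j + b * tan_y Y w j = 0"
  obtain r where r: "r > 0" "first_E \<epsilon> m Y w = r" "first_F \<epsilon> m Y w = 0" "first_G \<epsilon> m Y w = r"
    using assms w unfolding conformal_on_def by blast
  have "(\<Sum>j=1..m. \<epsilon> j * (a * tan_x Y w j + b * tan_y Y w j)\<^sup>2) =
      a\<^sup>2 * first_E \<epsilon> m Y w + 2 * a * b * first_F \<epsilon> m Y w + b\<^sup>2 * first_G \<epsilon> m Y w"
    unfolding first_E_def first_F_def first_G_def ambient_def sum_distrib_left sum.distrib[symmetric]
    by (intro sum.cong) (auto simp: power2_eq_square algebra_simps)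
  moreover have "(\<Sum>j=1..m. \<epsilon> j * (a * tan_x Y w j + b * tan_y Y w j)\<^sup>2) = 0" using ab by simp
  ultimately have "(a\<^sup>2 + b\<^sup>2) * r = 0" using r by (simp add: algebra_simps)
  then show "a = 0 \<and> b = 0" using r(1) by (simp add: sum_power2_eq_zero_iff)
qed

lemma inv_into_pair:
  fixes F :: "real \<times> real \<Rightarrow> complex"
  defines "\<Psi> \<equiv> \<lambda>z. (Re (F z), Im (F z))"
  assumes "inj_on F D"
  shows "inj_on \<Psi> D" "\<Psi> ` D = {p. to_complex p \<in> F ` D}"
    "p \<in> \<Psi> ` D \<Longrightarrow> inv_into D \<Psi> p = inv_into D F (to_complex p)" "to_complex (\<Psi> z) = F z"
proof -
  show tc: "to_complex (\<Psi> z) = F z" for z by (simp add: to_complex_def \<Psi>_def)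
  show inj: "inj_on \<Psi> D" using assms(2) tc by (metis inj_on_def)
  have bk: "\<Psi> z = p" if "F z = to_complex p" for z p
    using that by (simp add: \<Psi>_def to_complex_def)
  show "\<Psi> ` D = {p. to_complex p \<in> F ` D}" using tc bk by (auto simp: image_iff) metis
  show "inv_into D \<Psi> p = inv_into D F (to_complex p)" if p: "p \<in> \<Psi> ` D"
  proof -
    obtain z where z: "z \<in> D" "p = \<Psi> z" using p by blast
    show ?thesis unfolding z(2) tc using inv_into_f_f[OF inj z(1)] inv_into_f_f[OF assms(2) z(1)] by simp
  qed
qed

text \<open>Both surfaces are real parts of one curve \<open>h\<close> of functions that are holomorphic for the common
  conformal structure, multiplied by constants \<open>\<kappa>\<close> (1 or \<open>\<i>\<close>) that
  absorb the signature.\<close>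

lemma conformal_representation:
  fixes F :: "real \<times> real \<Rightarrow> complex" and h :: "nat \<Rightarrow> real \<times> real \<Rightarrow> complex"
    and D :: "(real \<times> real) set" and m :: nat
  defines "\<Psi> \<equiv> \<lambda>z. (Re (F z), Im (F z))" and "H \<equiv> \<lambda>j w. h j (inv_into D F w)"
  assumes D: "open D" and F: "inj_on F D" "open (F ` D)" "\<And>z. z \<in> D \<Longrightarrow> has_grad F (Fx z) (Fy z) z"
      "C2_on D (\<lambda>z. Re (F z))" "C2_on D (\<lambda>z. Im (F z))"
    and H: "\<And>j. j \<in> {1..m} \<Longrightarrow> H j holomorphic_on F ` D"
    and null: "\<And>w. w \<in> F ` D \<Longrightarrow> (\<Sum>j=1..m. (deriv (H j) w)\<^sup>2) = 0"
    and m: "m \<ge> 2" and h12: "\<And>z. Re (h 1 z) = fst z" "\<And>z. Re (h 2 z) = snd z"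
    and \<kappa>: "\<kappa> 1 = 1" "\<kappa> 2 = 1" "\<And>j. j \<in> {1..m} \<Longrightarrow> of_real (\<epsilon> j) * (\<kappa> j)\<^sup>2 = (1 :: complex)"
    and X: "\<And>j z. j \<in> {1..m} \<Longrightarrow> X j z = Re (\<kappa> j * h j z)" "\<And>j. j \<in> {1..m} \<Longrightarrow> C2_on D (X j)"
      "spacelike_on \<epsilon> m X D"
  shows "conformal_coordinate \<epsilon> m X D \<Psi>"
    "conformal_harmonic_immersion \<epsilon> m (reparam X D \<Psi>) (\<Psi> ` D)"
    "holomorphic_null_curve \<epsilon> m (induced_curve (reparam X D \<Psi>)) (complex_region (\<Psi> ` D))"
    "\<And>j z. j \<in> {1..m} \<Longrightarrow> z \<in> complex_region (\<Psi> ` D) \<Longrightarrow>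
       induced_curve (reparam X D \<Psi>) j z = \<kappa> j * deriv (H j) z"
proof -
  define W where "W = \<Psi> ` D"
  define Y where "Y = reparam X D \<Psi>"
  note inv = inv_into_pair[OF F(1), folded \<Psi>_def]
  have W: "W = {p. to_complex p \<in> F ` D}" using inv(2) by (simp add: W_def)
  have oW: "open W" unfolding W by (rule open_complex_region[OF F(2)])
  have region: "complex_region W = F ` D"
    unfolding complex_region_def W by (auto simp: to_complex_def)
  have invD: "inv_into D F (to_complex p) \<in> D" if "p \<in> W" for p
    using that inv_into_into[of "to_complex p" F D] unfolding W by simp
  have one: "1 \<in> {1..m}" "2 \<in> {1..m}" using m by auto
  have Kh: "(\<lambda>w. \<kappa> j * H j w) holomorphic_on F ` D" if "j \<in> {1..m}" for j
    by (intro holomorphic_intros H that)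
  have dK: "deriv (\<lambda>w. \<kappa> j * H j w) w = \<kappa> j * deriv (H j) w" if "j \<in> {1..m}" "w \<in> F ` D" for j w
    using holomorphic_on_imp_differentiable_at[OF H[OF that(1)] F(2) that(2)] by (rule deriv_cmult)
  have Yeq: "Y j p = Re (\<kappa> j * H j (to_complex p))" if "j \<in> {1..m}" "p \<in> W" for j p
    using inv(3)[of p] that X(1)[OF that(1)] by (simp add: Y_def reparam_def H_def W_def)
  have harm: "harmonic_on W (Y j)" if "j \<in> {1..m}" for j
    by (rule harmonic_real_part(1)[OF F(2) Kh[OF that] W Yeq[OF that]])
  have gradY: "has_grad (Y j) (Re (\<kappa> j * deriv (H j) (to_complex p))) (- Im (\<kappa> j * deriv (H j) (to_complex p))) p"
    if "j \<in> {1..m}" "p \<in> W" for j p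
    using harmonic_real_part(2)[OF F(2) Kh[OF that(1)] W Yeq[OF that(1)] that(2)] dK[OF that(1)] that(2) W by simp
  have curve: "induced_curve Y j z = \<kappa> j * deriv (H j) z" if "j \<in> {1..m}" "z \<in> F ` D" for j z
  proof -
    have zz: "to_complex (Re z, Im z) = z" by (simp add: to_complex_def)
    then have "(Re z, Im z) \<in> W" using that(2) W by simp
    from has_grad_pd[OF gradY[OF that(1) this]] zz
    show ?thesis by (simp add: induced_curve_def d_xi_def complex_eq_iff)
  qed
  have nullY: "(\<Sum>j=1..m. complex_of_real (\<epsilon> j) * (induced_curve Y j z)\<^sup>2) = 0" if "z \<in> F ` D" for z
  proof -
    have "(\<Sum>j=1..m. complex_of_real (\<epsilon> j) * (induced_curve Y j z)\<^sup>2) = (\<Sum>j=1..m. (deriv (H j) z)\<^sup>2)"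
    proof (rule sum.cong[OF refl])
      fix j assume j: "j \<in> {1..m}"
      have "complex_of_real (\<epsilon> j) * (induced_curve Y j z)\<^sup>2 = (of_real (\<epsilon> j) * (\<kappa> j)\<^sup>2) * (deriv (H j) z)\<^sup>2"
        unfolding curve[OF j that] by (simp add: power_mult_distrib)
      then show "complex_of_real (\<epsilon> j) * (induced_curve Y j z)\<^sup>2 = (deriv (H j) z)\<^sup>2" using \<kappa>(3)[OF j] by simp
    qed
    then show ?thesis using null[OF that] by simp
  qed
  have conf: "conformal_on \<epsilon> m Y W"
    unfolding conformal_on_def
  proof (intro exI[of _ "first_E \<epsilon> m Y"] ballI conjI)
    fix w assume w: "w \<in> W"
    define z where "z = to_complex w"
    have z: "z \<in> F ` D" using w W by (simp add: z_def)
    define \<phi> where "\<phi> = (\<lambda>j. \<kappa> j * deriv (H j) z)"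
    have tx: "tan_x Y w j = Re (\<phi> j)" and ty: "tan_y Y w j = - Im (\<phi> j)" if "j \<in> {1..m}" for j
      using has_grad_pd[OF gradY[OF that w]] by (simp_all add: tan_x_def tan_y_def \<phi>_def z_def)
    have 0: "(\<Sum>j=1..m. complex_of_real (\<epsilon> j) * (\<phi> j)\<^sup>2) = 0"
      using nullY[OF z] curve z by (simp add: \<phi>_def)
    \<comment> \<open>With x-tangent Re \<phi> and y-tangent - Im \<phi>, the real part of the null
      sum is E - G and its imaginary part is - 2 F.\<close>
    have "first_E \<epsilon> m Y w - first_G \<epsilon> m Y w = (\<Sum>j=1..m. Re (of_real (\<epsilon> j) * (\<phi> j)\<^sup>2))"
      unfolding first_E_def first_G_def ambient_def sum_subtractf[symmetric]
      by (intro sum.cong refl) (simp add: tx ty power2_eq_square algebra_simps)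
    also have "\<dots> = 0" using arg_cong[OF 0, of Re] by (simp only: Re_sum zero_complex.sel)
    finally show "first_G \<epsilon> m Y w = first_E \<epsilon> m Y w" by simp
    have "first_F \<epsilon> m Y w = (\<Sum>j=1..m. - (1 / 2) * Im (of_real (\<epsilon> j) * (\<phi> j)\<^sup>2))"
      unfolding first_F_def ambient_def
      by (intro sum.cong refl) (simp add: tx ty power2_eq_square algebra_simps)
    also have "\<dots> = - (1 / 2) * Im (\<Sum>j=1..m. of_real (\<epsilon> j) * (\<phi> j)\<^sup>2)"
      by (simp only: sum_distrib_left[symmetric] Im_sum)
    finally show "first_F \<epsilon> m Y w = 0" unfolding 0 by simp
    \<comment> \<open>Nullity alone does not give positivity for an indefinite \<epsilon>. The
      x-tangent of \<open>Y\<close> at w is the image of (\<alpha>, \<beta>), the derivative of the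
      inverse coordinate map in the first direction, so spacelikeness of \<open>X\<close> at q
      applies once (\<alpha>, \<beta>) is nonzero.\<close>
    define q where "q = inv_into D F z"
    have q: "q \<in> D" "F q = z" using invD[OF w] z f_inv_into_f[OF z] by (simp_all add: q_def z_def)
    define \<alpha> \<beta> where "\<alpha> = Re (\<phi> 1)" and "\<beta> = Re (\<phi> 2)"
    have inner: "has_grad (\<lambda>p. inv_into D F (to_complex p)) (\<alpha>, \<beta>) (- Im (\<phi> 1), - Im (\<phi> 2)) w"
    proof -
      \<comment> \<open>The first two components of the surface are the base coordinates, so the
        inverse coordinate map is itself the pair of the first two components of
        \<open>Y\<close>.\<close>
      have pair: "inv_into D F (to_complex p) = (Y 1 p, Y 2 p)" if "p \<in> W" for p
        using Yeq[OF one(1) that] Yeq[OF one(2) that] \<kappa>(1,2) h12 by (simp add: H_def)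
      have "has_grad (\<lambda>p. (Y 1 p, Y 2 p)) (\<alpha>, \<beta>) (- Im (\<phi> 1), - Im (\<phi> 2)) w"
        using has_derivative_Pair[OF gradY[OF one(1) w, unfolded has_grad_def] gradY[OF one(2) w, unfolded has_grad_def]]
        by (simp add: has_grad_def \<alpha>_def \<beta>_def \<phi>_def z_def)
      then show ?thesis by (rule has_grad_cong[OF _ oW w pair])
    qed
    have chain: "((\<lambda>t. k (inv_into D F (to_complex (t, snd w)))) has_vector_derivative \<alpha> *\<^sub>R A + \<beta> *\<^sub>R B) (at (fst w))"
      if "has_grad k A B q" for k :: "real \<times> real \<Rightarrow> 'b::real_normed_vector" and A B
    proof -
      have "(k has_derivative (\<lambda>v. fst v *\<^sub>R A + snd v *\<^sub>R B)) (at (inv_into D F (to_complex w)))"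
        using that by (simp add: has_grad_def q_def z_def)
      from has_derivative_compose[OF inner[unfolded has_grad_def] this]
      have "has_grad (\<lambda>p. k (inv_into D F (to_complex p))) (\<alpha> *\<^sub>R A + \<beta> *\<^sub>R B) (- Im (\<phi> 1) *\<^sub>R A - Im (\<phi> 2) *\<^sub>R B) w"
        by (simp add: has_grad_def algebra_simps)
      from has_grad_horizontal[OF this] show ?thesis .
    qed
    \<comment> \<open>Otherwise the chain rule would give F composed with its inverse the derivative
      0 in the first direction, while for the identity it is 1.\<close>
    have "(\<alpha>, \<beta>) \<noteq> (0, 0)"
    proof
      assume "(\<alpha>, \<beta>) = (0, 0)"
      have "((\<lambda>t. F (inv_into D F (to_complex (t, snd w)))) has_vector_derivative 0) (at (fst w))"
        using chain[OF F(3)[OF q(1)]] \<open>(\<alpha>, \<beta>) = (0, 0)\<close> by simp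
      moreover have "((\<lambda>t. F (inv_into D F (to_complex (t, snd w)))) has_vector_derivative 1) (at (fst w))"
      proof -
        have "has_grad (\<lambda>p. F (inv_into D F (to_complex p))) 1 \<i> w"
          by (rule has_grad_cong[OF has_grad_to_complex oW w]) (use f_inv_into_f[of _ F D] W in simp)
        from has_grad_horizontal[OF this] show ?thesis .
      qed
      ultimately show False using vector_derivative_unique_at by fastforce
    qed
    have tan: "tan_x Y w j = \<alpha> * pdx (X j) q + \<beta> * pdy (X j) q" if j: "j \<in> {1..m}" for j
    proof -
      have "has_grad (Y j) (Re (\<phi> j)) (- Im (\<phi> j)) w"
        using gradY[OF j w] by (simp only: \<phi>_def z_def)
      then have "has_grad (\<lambda>p. X j (inv_into D F (to_complex p))) (Re (\<phi> j)) (- Im (\<phi> j)) w"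
        by (rule has_grad_cong[OF _ oW w])
          (use Yeq[OF j] X(1)[OF j] in \<open>simp add: H_def\<close>)
      then have "((\<lambda>t. X j (inv_into D F (to_complex (t, snd w)))) has_vector_derivative Re (\<phi> j)) (at (fst w))"
        by (rule has_grad_horizontal)
      then show ?thesis
        using vector_derivative_unique_at[OF _ chain[OF C1_onD(1)[OF C2_onD(1)[OF X(2)[OF j]] q(1)]]] tx[OF j] by simp
    qed
    have "first_E \<epsilon> m Y w = (\<Sum>j=1..m. \<epsilon> j * (\<alpha> * pdx (X j) q + \<beta> * pdy (X j) q) * (\<alpha> * pdx (X j) q + \<beta> * pdy (X j) q))"
      unfolding first_E_def ambient_def by (intro sum.cong refl) (simp add: tan)
    also have "\<dots> = first_E \<epsilon> m X q * \<alpha>\<^sup>2 + 2 * first_F \<epsilon> m X q * \<alpha> * \<beta> + first_G \<epsilon> m X q * \<beta>\<^sup>2"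
      unfolding first_E_def first_F_def first_G_def ambient_def tan_x_def tan_y_def
        sum_distrib_left sum_distrib_right sum.distrib[symmetric]
      by (intro sum.cong) (auto simp: power2_eq_square algebra_simps)
    finally show "0 < first_E \<epsilon> m Y w"
      using X(3) q(1) \<open>(\<alpha>, \<beta>) \<noteq> (0, 0)\<close> unfolding spacelike_on_def by auto
  qed (rule refl)
  \<comment> \<open>The components of the inverse are the real parts of the holomorphic
    \<open>H 1\<close> and \<open>H 2\<close>, hence harmonic and in particular C2.\<close>
  have inv_comp: "C2_on W (fst \<circ> inv_into D \<Psi>)" "C2_on W (snd \<circ> inv_into D \<Psi>)"
  proof -
    have "harmonic_on W (fst \<circ> inv_into D \<Psi>)"
      by (rule harmonic_real_part(1)[OF F(2) H[OF one(1)] W]) (use inv(3) h12 in \<open>simp add: H_def W_def\<close>)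
    moreover have "harmonic_on W (snd \<circ> inv_into D \<Psi>)"
      by (rule harmonic_real_part(1)[OF F(2) H[OF one(2)] W]) (use inv(3) h12 in \<open>simp add: H_def W_def\<close>)
    ultimately show "C2_on W (fst \<circ> inv_into D \<Psi>)" "C2_on W (snd \<circ> inv_into D \<Psi>)"
      by (auto simp: harmonic_on_def)
  qed
  have "fst \<circ> \<Psi> = (\<lambda>z. Re (F z))" "snd \<circ> \<Psi> = (\<lambda>z. Im (F z))" by (auto simp: \<Psi>_def)
  then have "C2_diffeo_on D \<Psi>"
    unfolding C2_diffeo_on_def using inv(1) oW F(4,5) inv_comp by (simp add: W_def)
  then show "conformal_coordinate \<epsilon> m X D \<Psi>"
    using conf by (simp add: conformal_coordinate_def Y_def W_def)
  show "conformal_harmonic_immersion \<epsilon> m (reparam X D \<Psi>) (\<Psi> ` D)"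
    using conf conformal_imp_immersion[OF conf] harm
    by (simp add: conformal_harmonic_immersion_def Y_def W_def)
  show "induced_curve (reparam X D \<Psi>) j z = \<kappa> j * deriv (H j) z"
    if "j \<in> {1..m}" "z \<in> complex_region (\<Psi> ` D)" for j z
    using curve[OF that(1), of z] that(2) region by (simp add: Y_def W_def)
  have "induced_curve Y j holomorphic_on F ` D" if "j \<in> {1..m}" for j
  proof -
    have "(\<lambda>z. \<kappa> j * deriv (H j) z) holomorphic_on F ` D"
      by (intro holomorphic_intros holomorphic_deriv[OF H[OF that] F(2)])
    then show ?thesis by (rule holomorphic_transform) (use curve[OF that] in simp)
  qed
  then show "holomorphic_null_curve \<epsilon> m (induced_curve (reparam X D \<Psi>)) (complex_region (\<Psi> ` D))"
    using nullY region by (simp add: holomorphic_null_curve_def Y_def W_def)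
qed

section \<open>Minimal graphs\<close>

lemma has_grad_eqI: "has_grad h A B p \<Longrightarrow> A = A' \<Longrightarrow> B = B' \<Longrightarrow> has_grad h A' B' p"
  by simp

lemma sum_graph_indices:
  fixes h :: "nat \<Rightarrow> 'a::comm_monoid_add"
  shows "(\<Sum>j=1..n + 2. h j) = h 1 + h 2 + (\<Sum>k=1..n. h (k + 2))"
  by (induction n) (simp_all add: numeral_2_eq_2 add.assoc)

lemma graph_of_simps:
  "graph_of f (Suc 0) = fst" "graph_of f 2 = snd" "k \<ge> 1 \<Longrightarrow> graph_of f (k + 2) = f k"
  "k \<ge> 1 \<Longrightarrow> graph_of f (Suc (Suc k)) = f k"
  by (auto simp: graph_of_def fun_eq_iff)

lemma pd_coordinates:
  "pdx fst = (\<lambda>_. 1)" "pdy fst = (\<lambda>_. 0)" "pdx snd = (\<lambda>_. 0)" "pdy snd = (\<lambda>_. 1)"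
  "pdx (\<lambda>_. c) = (\<lambda>_. 0)" "pdy (\<lambda>_. c) = (\<lambda>_. 0)"
  using has_grad_pd[OF has_grad_fst] has_grad_pd[OF has_grad_snd] has_grad_pd[OF has_grad_const, of c]
  by (auto simp: fun_eq_iff)

locale minimal_graph =
  fixes n :: nat and D :: "(real \<times> real) set" and f :: "nat \<Rightarrow> real \<times> real \<Rightarrow> real"
  assumes open_D: "open D" and connected_D: "connected D" and simply_connected_D: "simply_connected D"
    and nonempty_D: "D \<noteq> {}"
    and minimal: "minimal_surface (n + 2) (graph_of f) D"
begin

definition E where "E = (\<lambda>z. 1 + (\<Sum>l=1..n. (pdx (f l) z)\<^sup>2))"
definition F where "F = (\<lambda>z. \<Sum>l=1..n. pdx (f l) z * pdy (f l) z)"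
definition G where "G = (\<lambda>z. 1 + (\<Sum>l=1..n. (pdy (f l) z)\<^sup>2))"
definition H where "H = (\<lambda>z. E z * G z - (F z)\<^sup>2)"
definition \<omega> where "\<omega> = (\<lambda>z. sqrt (H z))"

lemma C2_f: "k \<in> {1..n} \<Longrightarrow> C2_on D (f k)"
  using minimal graph_of_simps(3)[of k f]
  unfolding minimal_surface_def zero_mean_curvature_surface_def by (metis atLeastAtMost_iff le_add2 add_le_mono1 trans_le_add1)

lemma first_forms:
  "first_E euclidean_sig (n + 2) (graph_of f) z = E z"
  "first_F euclidean_sig (n + 2) (graph_of f) z = F z"
  "first_G euclidean_sig (n + 2) (graph_of f) z = G z"
  unfolding first_E_def first_F_def first_G_def ambient_def sum_graph_indices tan_x_def tan_y_def
    euclidean_sig_def E_def F_def G_def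
  by (simp_all add: graph_of_simps pd_coordinates power2_eq_square)

lemma form_pos:
  assumes "z \<in> D" "(a, b) \<noteq> (0, 0)"
  shows "E z * a\<^sup>2 + 2 * F z * a * b + G z * b\<^sup>2 > 0"
  using minimal assms
  unfolding minimal_surface_def zero_mean_curvature_surface_def spacelike_on_def first_forms by blast

lemma E_pos: "E z > 0"
  unfolding E_def by (intro add_pos_nonneg sum_nonneg) auto

lemma H_pos: "z \<in> D \<Longrightarrow> H z > 0"
proof -
  assume z: "z \<in> D"
  have "E z * (- F z)\<^sup>2 + 2 * F z * (- F z) * E z + G z * (E z)\<^sup>2 > 0"
    by (rule form_pos[OF z]) (use E_pos[of z] in auto)
  moreover have "E z * (- F z)\<^sup>2 + 2 * F z * (- F z) * E z + G z * (E z)\<^sup>2 = E z * H z"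
    by (simp add: H_def power2_eq_square algebra_simps)
  ultimately show ?thesis using E_pos[of z] zero_less_mult_pos by metis
qed

lemma \<omega>_pos: "z \<in> D \<Longrightarrow> \<omega> z > 0" and \<omega>_sq: "z \<in> D \<Longrightarrow> (\<omega> z)\<^sup>2 = H z"
  using H_pos[of z] by (auto simp: \<omega>_def)

text \<open>The first two components of a graph have no second derivatives, so there the vanishing
  mean curvature says that the combined tangential corrections are 0. They then drop out of the
  other components as well.\<close>

lemma minimal_equation:
  assumes z: "z \<in> D" and k: "k \<in> {1..n}"
  shows "G z * pdx (pdx (f k)) z - 2 * F z * pdy (pdx (f k)) z + E z * pdy (pdy (f k)) z = 0"
proof -
  let ?X = "graph_of f"
  define tang where "tang = (\<lambda>v. ((G z * ambient euclidean_sig (n + 2) v (tan_x ?X z) - F z * ambient euclidean_sig (n + 2) v (tan_y ?X z)) / H z,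
     (E z * ambient euclidean_sig (n + 2) v (tan_y ?X z) - F z * ambient euclidean_sig (n + 2) v (tan_x ?X z)) / H z))"
  have np: "normal_part euclidean_sig (n + 2) ?X z v j = v j - fst (tang v) * tan_x ?X z j - snd (tang v) * tan_y ?X z j" for v j
    unfolding normal_part_def Let_def first_forms tang_def H_def by simp
  define v1 where "v1 = (\<lambda>i. pdx (pdx (?X i)) z)"
  define v2 where "v2 = (\<lambda>i. pdy (pdx (?X i)) z)"
  define v3 where "v3 = (\<lambda>i. pdy (pdy (?X i)) z)"
  have mc: "G z * (v1 j - fst (tang v1) * tan_x ?X z j - snd (tang v1) * tan_y ?X z j)
      - 2 * F z * (v2 j - fst (tang v2) * tan_x ?X z j - snd (tang v2) * tan_y ?X z j)
      + E z * (v3 j - fst (tang v3) * tan_x ?X z j - snd (tang v3) * tan_y ?X z j) = 0"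
    if "j \<in> {1..n + 2}" for j
  proof -
    have "mean_curvature euclidean_sig (n + 2) ?X z j = 0"
      using minimal z that unfolding minimal_surface_def zero_mean_curvature_surface_def by blast
    then show ?thesis
      unfolding mean_curvature_def Let_def first_forms np H_def[symmetric] v1_def v2_def v3_def
      using H_pos[OF z] by (simp add: H_def)
  qed
  have 1: "G z * fst (tang v1) - 2 * F z * fst (tang v2) + E z * fst (tang v3) = 0"
    using mc[of 1] by (simp add: v1_def v2_def v3_def tan_x_def tan_y_def graph_of_simps pd_coordinates algebra_simps)
  have 2: "G z * snd (tang v1) - 2 * F z * snd (tang v2) + E z * snd (tang v3) = 0"
    using mc[of 2] by (simp add: v1_def v2_def v3_def tan_x_def tan_y_def graph_of_simps pd_coordinates algebra_simps)
  let ?p = "pdx (f k) z" and ?q = "pdy (f k) z"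
  have t: "tan_x ?X z (k + 2) = ?p" "tan_y ?X z (k + 2) = ?q" and v: "v1 (k + 2) = pdx (pdx (f k)) z"
    "v2 (k + 2) = pdy (pdx (f k)) z" "v3 (k + 2) = pdy (pdy (f k)) z"
    using k by (simp_all only: tan_x_def tan_y_def v1_def v2_def v3_def graph_of_simps(3) atLeastAtMost_iff)
  have "G z * v1 (k + 2) - 2 * F z * v2 (k + 2) + E z * v3 (k + 2)
      = ?p * (G z * fst (tang v1) - 2 * F z * fst (tang v2) + E z * fst (tang v3))
      + ?q * (G z * snd (tang v1) - 2 * F z * snd (tang v2) + E z * snd (tang v3))"
    using mc[of "k + 2"] k unfolding t by (simp add: algebra_simps)
  then show ?thesis unfolding 1 2 v by simp
qed

lemma C1_EFG: "C1_on D E" "C1_on D F" "C1_on D G" "C1_on D H" "C1_on D \<omega>"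
proof -
  note c = C2_onD[OF C2_f]
  show E: "C1_on D E" unfolding E_def power2_eq_square
    by (intro C1_on_add C1_on_const C1_on_sum C1_on_mult c(2))
  show F: "C1_on D F" unfolding F_def by (intro C1_on_sum C1_on_mult c(2,3))
  show G: "C1_on D G" unfolding G_def power2_eq_square
    by (intro C1_on_add C1_on_const C1_on_sum C1_on_mult c(3))
  show H: "C1_on D H" unfolding H_def power2_eq_square by (intro C1_on_diff C1_on_mult E F G)
  show "C1_on D \<omega>" unfolding \<omega>_def by (intro C1_on_sqrt H H_pos)
qed

lemma C1_quotients: "C1_on D (\<lambda>z. E z / \<omega> z)" "C1_on D (\<lambda>z. F z / \<omega> z)" "C1_on D (\<lambda>z. G z / \<omega> z)"
  using \<omega>_pos by (force intro!: C1_on_divide C1_EFG)+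

text \<open>Multiplied by 2 \<omega>^3, both identities become polynomial. The sums
  \<open>A\<close>, \<open>B\<close>, \<open>C\<close> pair the second derivatives with f_x, the
  primed ones with f_y; the two sides differ by a combination, with coefficients 2 E, 2 F or 2 G, of
  the minimal surface equation paired in these two ways.\<close>

lemma closed_forms:
  assumes z: "z \<in> D"
  shows "pdy (\<lambda>z. E z / \<omega> z) z = pdx (\<lambda>z. F z / \<omega> z) z"
    and "pdy (\<lambda>z. F z / \<omega> z) z = pdx (\<lambda>z. G z / \<omega> z) z"
proof -
  note c = C2_onD[OF C2_f]
  define p q where "p = (\<lambda>l. pdx (f l) z)" and "q = (\<lambda>l. pdy (f l) z)"
  define r s t where "r = (\<lambda>l. pdx (pdx (f l)) z)" and "s = (\<lambda>l. pdy (pdx (f l)) z)" and "t = (\<lambda>l. pdy (pdy (f l)) z)"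
  have gp: "has_grad (pdx (f l)) (r l) (s l) z" if "l \<in> {1..n}" for l
    using C1_onD(1)[OF c(2)[OF that] z] by (simp add: r_def s_def)
  have gq: "has_grad (pdy (f l)) (s l) (t l) z" if "l \<in> {1..n}" for l
    using C1_onD(1)[OF c(3)[OF that] z] mixed_partials[OF open_D C2_f[OF that] z] by (simp add: s_def t_def)
  define A where "A = (\<Sum>l=1..n. p l * r l)"
  define B where "B = (\<Sum>l=1..n. p l * s l)"
  define C where "C = (\<Sum>l=1..n. p l * t l)"
  define A' where "A' = (\<Sum>l=1..n. q l * r l)"
  define B' where "B' = (\<Sum>l=1..n. q l * s l)"
  define C' where "C' = (\<Sum>l=1..n. q l * t l)"
  have me: "G z * r l - 2 * F z * s l + E z * t l = 0" if "l \<in> {1..n}" for l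
    using minimal_equation[OF z that] by (simp add: r_def s_def t_def)
  have eq1: "G z * A - 2 * F z * B + E z * C = 0"
  proof -
    have "G z * A - 2 * F z * B + E z * C = (\<Sum>l=1..n. p l * (G z * r l - 2 * F z * s l + E z * t l))"
      unfolding A_def B_def C_def sum_distrib_left sum.distrib[symmetric] sum_subtractf[symmetric]
      by (intro sum.cong) (auto simp: algebra_simps)
    also have "\<dots> = 0" using me by simp
    finally show ?thesis .
  qed
  have eq2: "G z * A' - 2 * F z * B' + E z * C' = 0"
  proof -
    have "G z * A' - 2 * F z * B' + E z * C' = (\<Sum>l=1..n. q l * (G z * r l - 2 * F z * s l + E z * t l))"
      unfolding A'_def B'_def C'_def sum_distrib_left sum.distrib[symmetric] sum_subtractf[symmetric]
      by (intro sum.cong) (auto simp: algebra_simps)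
    also have "\<dots> = 0" using me by simp
    finally show ?thesis .
  qed
  have gE: "has_grad E (2 * A) (2 * B) z" unfolding E_def power2_eq_square
    by (rule has_grad_eqI[OF has_grad_add[OF has_grad_const has_grad_sum[OF has_grad_mult[OF gp gp]]]])
      (simp_all add: A_def B_def p_def sum_distrib_left algebra_simps)
  have gF: "has_grad F (A' + B) (B' + C) z" unfolding F_def
    by (rule has_grad_eqI[OF has_grad_sum[OF has_grad_mult[OF gp gq]]])
      (simp_all add: A'_def B'_def B_def C_def p_def q_def sum.distrib[symmetric] algebra_simps)
  have gG: "has_grad G (2 * B') (2 * C') z" unfolding G_def power2_eq_square
    by (rule has_grad_eqI[OF has_grad_add[OF has_grad_const has_grad_sum[OF has_grad_mult[OF gq gq]]]])
      (simp_all add: B'_def C'_def q_def sum_distrib_left algebra_simps)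
  define Hx Hy where "Hx = 2 * A * G z + 2 * E z * B' - 2 * F z * (A' + B)"
    and "Hy = 2 * B * G z + 2 * E z * C' - 2 * F z * (B' + C)"
  have gH: "has_grad H Hx Hy z" unfolding H_def power2_eq_square
    by (rule has_grad_eqI[OF has_grad_diff[OF has_grad_mult[OF gE gG] has_grad_mult[OF gF gF]]])
      (simp_all add: Hx_def Hy_def algebra_simps)
  have g\<omega>: "has_grad \<omega> (Hx / (2 * \<omega> z)) (Hy / (2 * \<omega> z)) z"
    unfolding \<omega>_def by (rule has_grad_sqrt[OF gH H_pos[OF z]])
  have w: "\<omega> z > 0" "\<omega> z * \<omega> z = H z" using \<omega>_pos[OF z] \<omega>_sq[OF z] by (auto simp: power2_eq_square)
  have quot: "(a * \<omega> z - b * (d / (2 * \<omega> z))) / (\<omega> z)\<^sup>2 = (a' * \<omega> z - b' * (d' / (2 * \<omega> z))) / (\<omega> z)\<^sup>2"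
    if "2 * a * H z - b * d = 2 * a' * H z - b' * d'" for a b d a' b' d'
  proof -
    have e: "x * \<omega> z - y * (u / (2 * \<omega> z)) = (2 * x * H z - y * u) / (2 * \<omega> z)" for x y u
      unfolding w(2)[symmetric] using w(1) by (simp add: field_simps)
    show ?thesis unfolding e that ..
  qed
  have wn: "\<omega> z \<noteq> 0" using w(1) by simp
  show "pdy (\<lambda>z. E z / \<omega> z) z = pdx (\<lambda>z. F z / \<omega> z) z"
    unfolding has_grad_pd(2)[OF has_grad_divide[OF gE g\<omega> wn]] has_grad_pd(1)[OF has_grad_divide[OF gF g\<omega> wn]]
  proof (rule quot)
    have "2 * (A' + B) * H z - F z * Hx - (2 * (2 * B) * H z - E z * Hy)
        = 2 * E z * (G z * A' - 2 * F z * B' + E z * C') - 2 * F z * (G z * A - 2 * F z * B + E z * C)"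
      by (simp add: H_def Hx_def Hy_def power2_eq_square algebra_simps)
    then show "2 * (2 * B) * H z - E z * Hy = 2 * (A' + B) * H z - F z * Hx" unfolding eq1 eq2 by simp
  qed
  show "pdy (\<lambda>z. F z / \<omega> z) z = pdx (\<lambda>z. G z / \<omega> z) z"
    unfolding has_grad_pd(2)[OF has_grad_divide[OF gF g\<omega> wn]] has_grad_pd(1)[OF has_grad_divide[OF gG g\<omega> wn]]
  proof (rule quot)
    have "2 * (B' + C) * H z - F z * Hy - (2 * (2 * B') * H z - G z * Hx)
        = 2 * G z * (G z * A - 2 * F z * B + E z * C) - 2 * F z * (G z * A' - 2 * F z * B' + E z * C')"
      by (simp add: H_def Hx_def Hy_def power2_eq_square algebra_simps)
    then show "2 * (B' + C) * H z - F z * Hy = 2 * (2 * B') * H z - G z * Hx" unfolding eq1 eq2 by simp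
  qed
qed

lemma potentials_exist:
  "\<exists>a b. \<forall>z\<in>D. has_grad a (E z / \<omega> z) (F z / \<omega> z) z \<and> has_grad b (F z / \<omega> z) (G z / \<omega> z) z"
  using global_potential[OF open_D simply_connected_D nonempty_D C1_quotients(1,2) closed_forms(1)]
    global_potential[OF open_D simply_connected_D nonempty_D C1_quotients(2,3) closed_forms(2)] by blast

end

section \<open>The coordinate T and its Cauchy-Riemann equation\<close>

locale minimal_graph_potentials = minimal_graph n D f for n D f +
  fixes a b :: "real \<times> real \<Rightarrow> real"
  assumes grad_a: "\<And>z. z \<in> D \<Longrightarrow> has_grad a (E z / \<omega> z) (F z / \<omega> z) z"
    and grad_b: "\<And>z. z \<in> D \<Longrightarrow> has_grad b (F z / \<omega> z) (G z / \<omega> z) z"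
begin

definition T :: "real \<times> real \<Rightarrow> complex" where
  "T = (\<lambda>z. Complex (fst z + a z) (- (snd z + b z)))"
definition Tx where "Tx = (\<lambda>z. Complex (1 + E z / \<omega> z) (- (F z / \<omega> z)))"
definition Ty where "Ty = (\<lambda>z. Complex (F z / \<omega> z) (- (1 + G z / \<omega> z)))"

lemma grad_T: "z \<in> D \<Longrightarrow> has_grad T (Tx z) (Ty z) z"
  unfolding T_def
  using has_grad_Complex[OF has_grad_add[OF has_grad_fst grad_a]
      has_grad_diff[OF has_grad_const[of 0] has_grad_add[OF has_grad_snd grad_b]]]
  by (simp add: Tx_def Ty_def)

lemma Tx_nonzero: "z \<in> D \<Longrightarrow> Tx z \<noteq> 0"
  using \<omega>_pos[of z] divide_pos_pos[OF E_pos[of z], of "\<omega> z"] by (auto simp: Tx_def complex_eq_iff)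

text \<open>\<open>T\<close> is the complex conjugate of (x + a) + i (y + b). Hence the real part of
  the product with u + i v is the Euclidean inner product of the derivative of (x + a, y + b) along
  (u, v) with (u, v): the identity plus the first fundamental form divided by \<omega>.\<close>

lemma T_monotone:
  assumes "z \<in> D"
  shows "Re ((u *\<^sub>R Tx z + v *\<^sub>R Ty z) * Complex u v) \<ge> u\<^sup>2 + v\<^sup>2"
proof -
  have "Re ((u *\<^sub>R Tx z + v *\<^sub>R Ty z) * Complex u v) = u\<^sup>2 + v\<^sup>2 + (E z * u\<^sup>2 + 2 * F z * u * v + G z * v\<^sup>2) / \<omega> z"
    using \<omega>_pos[OF assms] by (simp add: Tx_def Ty_def power2_eq_square field_simps)
  moreover have "E z * u\<^sup>2 + 2 * F z * u * v + G z * v\<^sup>2 \<ge> 0"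
    using form_pos[OF assms, of u v] by (cases "(u, v) = (0, 0)") auto
  ultimately show ?thesis using \<omega>_pos[OF assms] by simp
qed

lemma T_expanding:
  assumes "z \<in> D"
  shows "cmod (fst v *\<^sub>R Tx z + snd v *\<^sub>R Ty z) \<ge> 1 * norm v"
proof (cases "v = 0")
  case False
  have nv: "norm v = cmod (Complex (fst v) (snd v))" by (simp add: norm_prod_def cmod_def)
  have "(norm v)\<^sup>2 \<le> Re ((fst v *\<^sub>R Tx z + snd v *\<^sub>R Ty z) * Complex (fst v) (snd v))"
    using T_monotone[OF assms, of "fst v" "snd v"] by (simp add: norm_prod_def)
  also have "\<dots> \<le> cmod ((fst v *\<^sub>R Tx z + snd v *\<^sub>R Ty z) * Complex (fst v) (snd v))" by (rule complex_Re_le_cmod)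
  also have "\<dots> = cmod (fst v *\<^sub>R Tx z + snd v *\<^sub>R Ty z) * norm v" unfolding nv by (rule norm_mult)
  finally show ?thesis using False by (simp add: power2_eq_square)
qed simp

text \<open>Along a segment the component of \<open>T\<close> measured by \<open>T_monotone\<close>
  has positive derivative, so the mean value theorem excludes equal values at the ends.\<close>

lemma inj_T_convex:
  assumes "convex B" "B \<subseteq> D"
  shows "inj_on T B"
proof (rule inj_onI, rule ccontr)
  fix x y assume xy: "x \<in> B" "y \<in> B" "T x = T y" "x \<noteq> y"
  define d where "d = y - x"
  have d: "(fst d)\<^sup>2 + (snd d)\<^sup>2 > 0"
    using xy(4) by (auto simp: d_def sum_power2_gt_zero_iff prod_eq_iff)
  define \<phi> where "\<phi> = (\<lambda>t. Re (T (x + t *\<^sub>R d) * Complex (fst d) (snd d)))"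
  have in_D: "x + t *\<^sub>R d \<in> D" if "0 \<le> t" "t \<le> 1" for t
  proof -
    have "(1 - t) *\<^sub>R x + t *\<^sub>R y \<in> B" using assms(1) xy(1,2) that by (simp add: convex_def)
    then show ?thesis using assms(2) by (auto simp: d_def algebra_simps)
  qed
  define \<phi>' where "\<phi>' = (\<lambda>t. Re ((fst d *\<^sub>R Tx (x + t *\<^sub>R d) + snd d *\<^sub>R Ty (x + t *\<^sub>R d)) * Complex (fst d) (snd d)))"
  have "(\<phi> has_real_derivative \<phi>' t) (at t)" if t: "0 \<le> t" "t \<le> 1" for t
  proof -
    have "((\<lambda>t. x + t *\<^sub>R d) has_derivative (\<lambda>s. s *\<^sub>R d)) (at t)" by (auto intro!: derivative_eq_intros)
    from has_derivative_compose[OF this grad_T[OF in_D[OF t], unfolded has_grad_def]]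
    have "((\<lambda>t. T (x + t *\<^sub>R d)) has_vector_derivative (fst d *\<^sub>R Tx (x + t *\<^sub>R d) + snd d *\<^sub>R Ty (x + t *\<^sub>R d))) (at t)"
      by (simp add: has_vector_derivative_def scaleR_add_right)
    then have "((\<lambda>t. T (x + t *\<^sub>R d) * Complex (fst d) (snd d)) has_vector_derivative
        (fst d *\<^sub>R Tx (x + t *\<^sub>R d) + snd d *\<^sub>R Ty (x + t *\<^sub>R d)) * Complex (fst d) (snd d)) (at t)"
      by (rule has_vector_derivative_mult_left)
    from bounded_linear.has_vector_derivative[OF bounded_linear_Re this]
    show ?thesis unfolding \<phi>_def \<phi>'_def by (simp add: has_real_derivative_iff_has_vector_derivative)
  qed
  then obtain t where t: "0 < t" "t < 1" "\<phi> 1 - \<phi> 0 = (1 - 0) * \<phi>' t"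
    using MVT2[of 0 1 \<phi> \<phi>'] by auto
  have "\<phi> 1 = \<phi> 0" using xy(3) by (simp add: \<phi>_def d_def)
  then have "\<phi>' t = 0" using t by simp
  then show False using T_monotone[OF in_D[of t], of "fst d" "snd d"] t d by (simp add: \<phi>'_def)
qed

sublocale plane_flat_surface D T
proof unfold_locales
  show "DIM(real \<times> real) = 2" by simp
  show "(UNIV :: (real \<times> real) set) homeomorphic D"
    by (rule simply_connected_homeomorphic_plane[OF open_D simply_connected_D nonempty_D])
  show "continuous_on D T"
    using has_grad_continuous[OF grad_T] by (simp add: continuous_at_imp_continuous_on)
  show "\<exists>N. open N \<and> q \<in> N \<and> N \<subseteq> D \<and> inj_on T N" if "q \<in> D" for q
  proof -
    obtain e where "e > 0" "ball q e \<subseteq> D" using open_D \<open>q \<in> D\<close> openE by blast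
    then show ?thesis using inj_T_convex[of "ball q e"] by (intro exI[of _ "ball q e"]) auto
  qed
qed (use open_D connected_D in auto)

lemma EG_eq: "z \<in> D \<Longrightarrow> E z * G z = (\<omega> z)\<^sup>2 + (F z)\<^sup>2"
  using \<omega>_sq[of z] by (simp add: H_def)

text \<open>The Beltrami form of the Cauchy-Riemann equation. For E = G = 1 and F = 0 it reads h_y =
  - i h_x: the orientation is opposite to that of x + i y. It rests on E G = \<omega>^2 +
  F^2.\<close>

lemma T_cauchy_riemann:
  assumes "z \<in> D"
  shows "of_real (E z) * Ty z = Complex (F z) (- \<omega> z) * Tx z"
  using \<omega>_pos[OF assms] EG_eq[OF assms]
  by (simp add: Tx_def Ty_def complex_eq_iff field_simps power2_eq_square)

text \<open>Two solutions of the same Beltrami equation have complex proportional gradients; the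
  factor c / Tx is then the derivative of h with respect to \<open>T\<close>.\<close>

lemma quotient_limitI:
  assumes z: "z \<in> D" and h: "has_grad h c d z" and cr: "of_real (E z) * d = Complex (F z) (- \<omega> z) * c"
  shows "((\<lambda>x. (h x - h z) / (T x - T z)) \<longlongrightarrow> c / Tx z) (at z)"
proof (rule quotient_limit[OF grad_T[OF z] _ zero_less_one T_expanding[OF z]])
  have "of_real (E z) * (d * Tx z) = of_real (E z) * (c * Ty z)"
  proof -
    have "of_real (E z) * (d * Tx z) = (of_real (E z) * d) * Tx z" by simp
    also have "\<dots> = c * (of_real (E z) * Ty z)" unfolding cr T_cauchy_riemann[OF z] by simp
    finally show ?thesis by simp
  qed
  then have "d * Tx z = c * Ty z" using E_pos[of z] by simp
  then have "c / Tx z * Ty z = d" using Tx_nonzero[OF z] by (simp add: field_simps)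
  then show "has_grad h (c / Tx z * Tx z) (c / Tx z * Ty z) z" using h Tx_nonzero[OF z] by simp
qed

end

section \<open>Twin surfaces\<close>

lemma has_grad_unique:
  assumes "has_grad h A B p" "has_grad h A' B' p"
  shows "A = A'"
  using vector_derivative_unique_at[OF has_grad_horizontal[OF assms(1)] has_grad_horizontal[OF assms(2)]] .

context minimal_graph_potentials
begin

lemma injective_hol_exists: "\<exists>\<xi>. hol D \<xi> \<and> inj_on \<xi> D"
proof -
  define S where "S = (\<lambda>z. Complex (fst z - a z) (snd z - b z))"
  define Sx where "Sx = (\<lambda>z. Complex (1 - E z / \<omega> z) (- (F z / \<omega> z)))"
  define Sy where "Sy = (\<lambda>z. Complex (- (F z / \<omega> z)) (1 - G z / \<omega> z))"
  have gS: "has_grad S (Sx z) (Sy z) z" if "z \<in> D" for z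
    unfolding S_def
    using has_grad_Complex[OF has_grad_diff[OF has_grad_fst grad_a[OF that]] has_grad_diff[OF has_grad_snd grad_b[OF that]]]
    by (simp add: Sx_def Sy_def)
  have CR: "of_real (E z) * Sy z = Complex (F z) (- \<omega> z) * Sx z" if "z \<in> D" for z
    using \<omega>_pos[OF that] EG_eq[OF that]
    by (simp add: Sx_def Sy_def complex_eq_iff field_simps power2_eq_square)
  define \<mu> where "\<mu> = (\<lambda>z. Sx z / Tx z)"
  have "hol D \<mu>"
    unfolding \<mu>_def by (rule hol_derivative[OF open_D order_refl quotient_limitI[OF _ gS CR]])
  have \<mu>1: "cmod (\<mu> z) < 1" if z: "z \<in> D" for z
  proof -
    \<comment> \<open>The imaginary parts agree, so this is (1 + E / \<omega>)^2 - (1 - E /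
      \<omega>)^2, and the positivity of E gives the modulus below 1.\<close>
    have "(cmod (Tx z))\<^sup>2 - (cmod (Sx z))\<^sup>2 = 4 * (E z / \<omega> z)"
      unfolding cmod_power2 Tx_def Sx_def complex.sel by (simp add: power2_eq_square algebra_simps)
    moreover have "E z / \<omega> z > 0" using E_pos \<omega>_pos[OF z] by (rule divide_pos_pos)
    ultimately have "(cmod (Sx z))\<^sup>2 < (cmod (Tx z))\<^sup>2" by simp
    then have "cmod (Sx z) < cmod (Tx z)" by (rule power2_less_imp_less) simp
    then show ?thesis using Tx_nonzero[OF z] by (simp add: \<mu>_def norm_divide)
  qed
  show ?thesis
  proof (cases "\<mu> constant_on D")
    case False
    then show ?thesis using injective_hol[OF \<open>hol D \<mu>\<close> _ \<mu>1] by blast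
  next
    case True
    then obtain k where k: "\<And>z. z \<in> D \<Longrightarrow> \<mu> z = k" unfolding constant_on_def by blast
    have Sk: "Sx z = k * Tx z" "Sy z = k * Ty z" if z: "z \<in> D" for z
    proof -
      show x: "Sx z = k * Tx z" using k[OF z] Tx_nonzero[OF z] by (simp add: \<mu>_def field_simps)
      have "of_real (E z) * Sy z = of_real (E z) * (k * Ty z)"
        unfolding CR[OF z] x using T_cauchy_riemann[OF z] by (simp add: algebra_simps)
      then show "Sy z = k * Ty z" using E_pos[of z] by simp
    qed
    have const: "S x - k * T x = S y - k * T y" if "x \<in> D" "y \<in> D" for x y
    proof (rule has_derivative_zero_unique_connected[OF open_D connected_D _ that])
      fix z assume z: "z \<in> D"
      show "((\<lambda>z. S z - k * T z) has_derivative (\<lambda>_. 0)) (at z)"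
        using has_grad_diff[OF gS[OF z] has_grad_mult[OF has_grad_const[of k] grad_T[OF z]]] Sk[OF z]
        by (simp add: has_grad_def)
    qed
    have "inj_on T D"
    proof (rule inj_onI)
      fix x y assume xy: "x \<in> D" "y \<in> D" "T x = T y"
      then have "S x = S y" using const[OF xy(1,2)] by simp
      \<comment> \<open>Re S + Re T is twice the first coordinate and Im S - Im T twice the second,
        so the potentials cancel.\<close>
      then show "x = y" using xy(3) by (auto simp: S_def T_def prod_eq_iff)
    qed
    then show ?thesis using hol_T by blast
  qed
qed

section \<open>Regularity and derivatives in the new coordinate\<close>

lemma hol_gradient:
  assumes "hol D \<xi>"
  shows "\<exists>l. hol D l \<and> (\<forall>z\<in>D. has_grad \<xi> (l z * Tx z) (l z * Ty z) z)"
proof -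
  have "\<exists>l. \<forall>q\<in>D. ((\<lambda>x. (\<xi> x - \<xi> q) / (T x - T q)) \<longlongrightarrow> l q) (at q)"
    using assms unfolding hol_def by (intro bchoice)
  then obtain l where l: "\<And>q. q \<in> D \<Longrightarrow> ((\<lambda>x. (\<xi> x - \<xi> q) / (T x - T q)) \<longlongrightarrow> l q) (at q)" by blast
  show ?thesis
  proof (intro exI[of _ l] conjI ballI)
    show "hol D l" by (rule hol_derivative[OF open_D order_refl l])
    show "has_grad \<xi> (l z * Tx z) (l z * Ty z) z" if "z \<in> D" for z
      by (rule quotient_has_grad[OF that grad_T[OF that] l[OF that]])
  qed
qed

lemma C1_T_components:
  "C1_on D (\<lambda>z. Re (Tx z))" "C1_on D (\<lambda>z. Im (Tx z))" "C1_on D (\<lambda>z. Re (Ty z))" "C1_on D (\<lambda>z. Im (Ty z))"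
proof -
  have neg: "C1_on D (\<lambda>z. - h z)" if "C1_on D h" for h
    using C1_on_diff[OF C1_on_const[of D 0] that] by simp
  show "C1_on D (\<lambda>z. Re (Tx z))" "C1_on D (\<lambda>z. Im (Tx z))" "C1_on D (\<lambda>z. Re (Ty z))" "C1_on D (\<lambda>z. Im (Ty z))"
    using neg[OF C1_quotients(2)] neg[OF C1_on_add[OF C1_on_const[of D 1] C1_quotients(3)]]
      C1_on_add[OF C1_on_const[of D 1] C1_quotients(1)] C1_quotients(2)
    by (simp_all add: Tx_def Ty_def)
qed

lemma continuous_Tx_Ty: "continuous_on D Tx" "continuous_on D Ty"
proof -
  note c = C1_onD(4)[OF C1_T_components(1)] C1_onD(4)[OF C1_T_components(2)]
    C1_onD(4)[OF C1_T_components(3)] C1_onD(4)[OF C1_T_components(4)]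
  have "continuous_on D (\<lambda>z. Complex (Re (Tx z)) (Im (Tx z)))" "continuous_on D (\<lambda>z. Complex (Re (Ty z)) (Im (Ty z)))"
    unfolding Complex_eq by (intro continuous_intros c)+
  then show "continuous_on D Tx" "continuous_on D Ty" by simp_all
qed

lemma hol_imp_C1:
  assumes "hol D h"
  shows "C1_on D (\<lambda>z. Re (h z))" "C1_on D (\<lambda>z. Im (h z))"
proof -
  obtain l where l: "hol D l" "\<And>z. z \<in> D \<Longrightarrow> has_grad h (l z * Tx z) (l z * Ty z) z"
    using hol_gradient[OF assms] by blast
  note c = hol_continuous[OF open_D order_refl l(1)] continuous_Tx_Ty
  have p: "continuous_on D (\<lambda>z. Re (l z * Tx z))" "continuous_on D (\<lambda>z. Re (l z * Ty z))"
    "continuous_on D (\<lambda>z. Im (l z * Tx z))" "continuous_on D (\<lambda>z. Im (l z * Ty z))"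
    by (intro continuous_on_Re continuous_on_Im continuous_on_mult c)+
  show "C1_on D (\<lambda>z. Re (h z))" by (rule C1_onI[OF has_grad_Re[OF l(2)] p(1,2)])
  show "C1_on D (\<lambda>z. Im (h z))" by (rule C1_onI[OF has_grad_Im[OF l(2)] p(3,4)])
qed

text \<open>The gradient of h is (l Tx, l Ty) with l again holomorphic, hence C1 by the previous
  lemma. As f is C2, \<open>Tx\<close> and \<open>Ty\<close> are C1, which gives class C2 for
  h.\<close>

lemma hol_imp_C2:
  assumes "hol D h"
  shows "C2_on D (\<lambda>z. Re (h z))" "C2_on D (\<lambda>z. Im (h z))"
proof -
  obtain l where l: "hol D l" "\<And>z. z \<in> D \<Longrightarrow> has_grad h (l z * Tx z) (l z * Ty z) z"
    using hol_gradient[OF assms] by blast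
  note c = hol_imp_C1[OF l(1)] C1_T_components
  have p: "C1_on D (\<lambda>z. Re (l z * Tx z))" "C1_on D (\<lambda>z. Re (l z * Ty z))"
    "C1_on D (\<lambda>z. Im (l z * Tx z))" "C1_on D (\<lambda>z. Im (l z * Ty z))"
    unfolding times_complex.sel by (intro C1_on_add C1_on_diff C1_on_mult c)+
  show "C2_on D (\<lambda>z. Re (h z))" by (rule C2_onI[OF open_D has_grad_Re[OF l(2)] p(1,2)])
  show "C2_on D (\<lambda>z. Im (h z))" by (rule C2_onI[OF open_D has_grad_Im[OF l(2)] p(3,4)])
qed

text \<open>The chain rule in the x-direction: derivatives with respect to \<xi> are ratios of
  x-derivatives, so the null condition can be tested on x-derivatives alone.\<close>

lemma deriv_in_coordinate:
  assumes \<xi>: "hol D \<xi>" "inj_on \<xi> D" "has_grad \<xi> A B q" and h: "hol D h" "has_grad h C C' q" and q: "q \<in> D"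
  shows "deriv (\<lambda>w. h (inv_into D \<xi> w)) (\<xi> q) * A = C"
proof -
  define K where "K = (\<lambda>w. h (inv_into D \<xi> w))"
  have "(K has_field_derivative deriv K (\<xi> q)) (at (\<xi> q))"
    unfolding K_def using q
    by (intro holomorphic_derivI[OF hol_injective_inverse[OF \<xi>(1,2) h(1)] open_injective_image[OF \<xi>(1,2)]]) auto
  from has_grad_compose_field[OF \<xi>(3) this]
  have "has_grad h (deriv K (\<xi> q) * A) (deriv K (\<xi> q) * B) q"
    by (rule has_grad_cong[OF _ open_D q]) (use inv_into_f_f[OF \<xi>(2)] in \<open>simp add: K_def\<close>)
  then show ?thesis using has_grad_unique h(2) unfolding K_def by blast
qed

lemma gram_sums:
  "(\<Sum>k=1..n. (pdx (f k) z)\<^sup>2) = E z - 1" "(\<Sum>k=1..n. pdx (f k) z * pdy (f k) z) = F z"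
  "(\<Sum>k=1..n. (pdy (f k) z)\<^sup>2) = G z - 1"
  by (simp_all add: E_def F_def G_def)

text \<open>The terms are the squared x-derivatives of x - i b, y + i a and f_k - i g_k, with the
  twin formula inserted for g_k. With e = E / \<omega> and u = F / \<omega>, the imaginary part
  vanishes by e F = u E, and the real part by this together with E G = \<omega>^2 + F^2.\<close>

lemma null_sum:
  assumes z: "z \<in> D"
  shows "(Complex 1 (- (F z / \<omega> z)))\<^sup>2 + (Complex 0 (E z / \<omega> z))\<^sup>2 +
    (\<Sum>k=1..n. (Complex (pdx (f k) z) (- (- (E z / \<omega> z) * pdy (f k) z + F z / \<omega> z * pdx (f k) z)))\<^sup>2) = 0"
proof -
  define e u where "e = E z / \<omega> z" and "u = F z / \<omega> z"
  have w: "\<omega> z > 0" using \<omega>_pos[OF z] .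
  have key: "e * G z * e = E z + e * u * F z"
    using EG_eq[OF z] w by (simp add: e_def u_def field_simps power2_eq_square)
  have "(\<Sum>k=1..n. (pdx (f k) z)\<^sup>2 - (- e * pdy (f k) z + u * pdx (f k) z)\<^sup>2)
      = (\<Sum>k=1..n. (pdx (f k) z)\<^sup>2 - e\<^sup>2 * (pdy (f k) z)\<^sup>2 + 2 * e * u * (pdx (f k) z * pdy (f k) z) - u\<^sup>2 * (pdx (f k) z)\<^sup>2)"
    by (intro sum.cong) (auto simp: power2_eq_square algebra_simps)
  also have "\<dots> = (E z - 1) - e\<^sup>2 * (G z - 1) + 2 * e * u * F z - u\<^sup>2 * (E z - 1)"
    by (simp only: sum.distrib sum_subtractf sum_distrib_left[symmetric] gram_sums)
  finally have re: "(\<Sum>k=1..n. (pdx (f k) z)\<^sup>2 - (- e * pdy (f k) z + u * pdx (f k) z)\<^sup>2)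
      = (E z - 1) - e\<^sup>2 * (G z - 1) + 2 * e * u * F z - u\<^sup>2 * (E z - 1)" .
  have "(\<Sum>k=1..n. pdx (f k) z * (- e * pdy (f k) z + u * pdx (f k) z))
      = (\<Sum>k=1..n. u * (pdx (f k) z)\<^sup>2 - e * (pdx (f k) z * pdy (f k) z))"
    by (intro sum.cong) (auto simp: power2_eq_square algebra_simps)
  also have "\<dots> = u * (E z - 1) - e * F z"
    by (simp only: sum_subtractf sum_distrib_left[symmetric] gram_sums)
  also have "\<dots> = - u" by (simp add: e_def u_def right_diff_distrib diff_divide_distrib mult.commute)
  finally have im: "(\<Sum>k=1..n. pdx (f k) z * (- e * pdy (f k) z + u * pdx (f k) z)) = - u" .
  have sq: "(Complex x (- y))\<^sup>2 = Complex (x\<^sup>2 - y\<^sup>2) (- 2 * (x * y))" "(Complex 0 y)\<^sup>2 = Complex (- y\<^sup>2) 0" for x y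
    by (simp_all add: complex_eq_iff power2_eq_square)
  have csum: "(\<Sum>k=1..n. Complex (x k) (y k)) = Complex (\<Sum>k=1..n. x k) (\<Sum>k=1..n. y k)" for x y
    by (simp add: complex_eq_iff)
  have eF: "e * F z = u * E z" by (simp add: e_def u_def)
  have total: "1 - u\<^sup>2 - e\<^sup>2 + ((E z - 1) - e\<^sup>2 * (G z - 1) + 2 * e * u * F z - u\<^sup>2 * (E z - 1)) = 0"
  proof -
    have "u\<^sup>2 * E z = e * u * F z" using eF by (simp add: power2_eq_square mult_ac)
    moreover have "e\<^sup>2 * G z = E z + e * u * F z" using key by (simp add: power2_eq_square mult_ac)
    ultimately show ?thesis by (simp add: algebra_simps)
  qed
  show ?thesis
    unfolding e_def[symmetric] u_def[symmetric] sq csum sum_distrib_left[symmetric] re im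
    using total by (simp add: complex_eq_iff)
qed

end

theorem theorem21:
  fixes n :: nat
    and \<Omega> :: "(real \<times> real) set"
    and f g :: "nat \<Rightarrow> real \<times> real \<Rightarrow> real"
  assumes "n \<ge> 2"
    and "open \<Omega>" and "connected \<Omega>" and "\<Omega> \<noteq> {}" and "simply_connected \<Omega>"
    and "positive_area_angle n f \<Omega>"
    and "minimal_surface (n + 2) (graph_of f) \<Omega>"
    and "positive_area_angle n g \<Omega>"
    and "is_twin n f g \<Omega>"
    and "maximal_surface (n + 2) (graph_of g) \<Omega>"
  shows "\<exists>\<Psi> :: real \<times> real \<Rightarrow> real \<times> real.
     conformal_coordinate euclidean_sig (n + 2) (graph_of f) \<Omega> \<Psi> \<and>
     conformal_coordinate pseudo_sig (n + 2) (graph_of g) \<Omega> \<Psi> \<and>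
     (let Y = reparam (graph_of f) \<Omega> \<Psi>;
          Y' = reparam (graph_of g) \<Omega> \<Psi>;
          W = \<Psi> ` \<Omega>;
          U = complex_region W;
          \<phi> = induced_curve Y;
          \<phi>' = induced_curve Y'
      in conformal_harmonic_immersion euclidean_sig (n + 2) Y W \<and>
         conformal_harmonic_immersion pseudo_sig (n + 2) Y' W \<and>
         holomorphic_null_curve euclidean_sig (n + 2) \<phi> U \<and>
         holomorphic_null_curve pseudo_sig (n + 2) \<phi>' U \<and>
         (\<forall>z\<in>U. \<phi> 1 z = \<phi>' 1 z \<and> \<phi> 2 z = \<phi>' 2 z \<and>
            (\<forall>k\<in>{1..n}. \<phi> (k + 2) z = - \<i> * \<phi>' (k + 2) z)))"
proof -
  have mg: "minimal_graph n \<Omega> f"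
    by unfold_locales (use assms in auto)
  from minimal_graph.potentials_exist[OF mg] obtain a b where "minimal_graph_potentials n \<Omega> f a b"
    using mg unfolding minimal_graph_potentials_def minimal_graph_potentials_axioms_def by blast
  then interpret minimal_graph_potentials n \<Omega> f a b .
  obtain \<xi> where \<xi>: "hol \<Omega> \<xi>" "inj_on \<xi> \<Omega>" using injective_hol_exists by blast
  obtain l where l: "hol \<Omega> l" "\<And>z. z \<in> \<Omega> \<Longrightarrow> has_grad \<xi> (l z * Tx z) (l z * Ty z) z"
    using hol_gradient[OF \<xi>(1)] by blast
  \<comment> \<open>The real parts of these functions form the minimal graph; keeping the first two
    and multiplying the others by i makes the real parts the twin, since Re (i (f_k - i g_k)) =
    g_k.\<close>
  define h where "h = (\<lambda>j z. if j = 1 then Complex (fst z) (- b z) else if j = 2 then Complex (snd z) (a z)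
    else Complex (f (j - 2) z) (- g (j - 2) z))"
  have h_simps: "h 1 = (\<lambda>z. Complex (fst z) (- b z))" "h 2 = (\<lambda>z. Complex (snd z) (a z))"
    "\<And>k. k \<ge> 1 \<Longrightarrow> h (k + 2) = (\<lambda>z. Complex (f k z) (- g k z))"
    by (auto simp: h_def fun_eq_iff)
  \<comment> \<open>The x-derivative of \<open>h j\<close>, with that of g_k replaced by the twin
    formula to match the shape of \<open>null_sum\<close>.\<close>
  define c where "c = (\<lambda>j z. if j = 1 then Complex 1 (- (F z / \<omega> z)) else if j = 2 then Complex 0 (E z / \<omega> z)
    else Complex (pdx (f (j - 2)) z) (- (- (E z / \<omega> z) * pdy (f (j - 2)) z + F z / \<omega> z * pdx (f (j - 2)) z)))"
  have C2g: "C2_on \<Omega> (g k)" if "k \<in> {1..n}" for k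
    using assms(8) that unfolding positive_area_angle_def by blast
  have twin: "pdx (g k) z = - (E z / \<omega> z) * pdy (f k) z + F z / \<omega> z * pdx (f k) z"
    "pdy (g k) z = G z / \<omega> z * pdx (f k) z - F z / \<omega> z * pdy (f k) z" if "z \<in> \<Omega>" "k \<in> {1..n}" for z k
    using assms(9) that
    unfolding is_twin_def Let_def \<omega>_def H_def E_def F_def G_def by blast+
  have neg: "has_grad (\<lambda>z. - u z) (- A) (- B) z" if "has_grad u A B z" for u :: "real \<times> real \<Rightarrow> real" and A B z
    using has_grad_diff[OF has_grad_const[of 0] that] by simp
  have hg: "\<exists>d. has_grad (h j) (c j z) d z \<and> of_real (E z) * d = Complex (F z) (- \<omega> z) * c j z"
    if j: "j \<in> {1..n + 2}" and z: "z \<in> \<Omega>" for j z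
  proof -
    note w = \<omega>_pos[OF z] and EG = EG_eq[OF z]
    consider "j = 1" | "j = 2" | k where "j = k + 2" "k \<in> {1..n}"
    proof -
      have "j = 1 \<or> j = 2 \<or> (j = (j - 2) + 2 \<and> j - 2 \<in> {1..n})" using j by auto
      then show ?thesis using that by blast
    qed
    then show ?thesis
    proof cases
      case 1
      have "has_grad (h 1) (Complex 1 (- (F z / \<omega> z))) (Complex 0 (- (G z / \<omega> z))) z"
        unfolding h_simps by (intro has_grad_Complex has_grad_fst neg grad_b z)
      moreover have "of_real (E z) * Complex 0 (- (G z / \<omega> z)) = Complex (F z) (- \<omega> z) * Complex 1 (- (F z / \<omega> z))"
        using w EG by (simp add: complex_eq_iff field_simps power2_eq_square)
      ultimately show ?thesis unfolding 1 by (auto simp: c_def)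
    next
      case 2
      have "has_grad (h 2) (Complex 0 (E z / \<omega> z)) (Complex 1 (F z / \<omega> z)) z"
        unfolding h_simps by (intro has_grad_Complex has_grad_snd grad_a z)
      moreover have "of_real (E z) * Complex 1 (F z / \<omega> z) = Complex (F z) (- \<omega> z) * Complex 0 (E z / \<omega> z)"
        using w EG by (simp add: complex_eq_iff field_simps power2_eq_square)
      ultimately show ?thesis unfolding 2 by (auto simp: c_def)
    next
      case (3 k)
      have "has_grad (h j) (Complex (pdx (f k) z) (- pdx (g k) z)) (Complex (pdy (f k) z) (- pdy (g k) z)) z"
        unfolding 3(1) using h_simps(3)[of k] 3(2)
          has_grad_Complex[OF C1_onD(1)[OF C2_onD(1)[OF C2_f[OF 3(2)]] z] neg[OF C1_onD(1)[OF C2_onD(1)[OF C2g[OF 3(2)]] z]]]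
        by simp
      moreover have "of_real (E z) * Complex (pdy (f k) z) (- pdy (g k) z) = Complex (F z) (- \<omega> z) * Complex (pdx (f k) z) (- pdx (g k) z)"
      proof -
        have "E z * (G z / \<omega> z * pdx (f k) z) = \<omega> z * pdx (f k) z + F z * (F z / \<omega> z * pdx (f k) z)"
        proof -
          have "E z * (G z / \<omega> z * pdx (f k) z) = (E z * G z) / \<omega> z * pdx (f k) z" by simp
          also have "\<dots> = \<omega> z * pdx (f k) z + F z * (F z / \<omega> z * pdx (f k) z)"
            unfolding EG using w by (simp add: field_simps power2_eq_square)
          finally show ?thesis .
        qed
        moreover have "\<omega> z * (E z / \<omega> z * pdy (f k) z) = E z * pdy (f k) z" "\<omega> z * (F z / \<omega> z * pdx (f k) z) = F z * pdx (f k) z"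
          using w by simp_all
        ultimately show ?thesis unfolding twin[OF z 3(2)]
          by (simp add: complex_eq_iff algebra_simps)
      qed
      moreover have "c j z = Complex (pdx (f k) z) (- pdx (g k) z)"
        using 3 by (simp add: c_def twin(1)[OF z 3(2)])
      ultimately show ?thesis by metis
    qed
  qed
  have holh: "hol \<Omega> (h j)" if "j \<in> {1..n + 2}" for j
    unfolding hol_def using hg[OF that] quotient_limitI by blast
  have null: "(\<Sum>j=1..n + 2. (deriv (\<lambda>w. h j (inv_into \<Omega> \<xi> w)) w)\<^sup>2) = 0" if w: "w \<in> \<xi> ` \<Omega>" for w
  proof -
    obtain q where q: "q \<in> \<Omega>" "w = \<xi> q" using w by blast
    define A where "A = l q * Tx q"
    have d: "deriv (\<lambda>w. h j (inv_into \<Omega> \<xi> w)) w * A = c j q" if "j \<in> {1..n + 2}" for j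
      using hg[OF that q(1)] deriv_in_coordinate[OF \<xi> l(2)[OF q(1)] holh[OF that] _ q(1)]
      unfolding A_def q(2) by blast
    \<comment> \<open>The chain rule applied to \<open>T\<close> writes the nonzero
      \<open>Tx q\<close> as a multiple of \<open>A\<close>.\<close>
    have "A \<noteq> 0"
      using deriv_in_coordinate[OF \<xi> l(2)[OF q(1)] hol_T grad_T[OF q(1)] q(1)] Tx_nonzero[OF q(1)]
      unfolding A_def by auto
    have "(\<Sum>j=1..n + 2. (deriv (\<lambda>w. h j (inv_into \<Omega> \<xi> w)) w)\<^sup>2) * A\<^sup>2 = (\<Sum>j=1..n + 2. (c j q)\<^sup>2)"
      unfolding sum_distrib_right by (intro sum.cong refl) (metis d power_mult_distrib)
    also have "\<dots> = 0"
      unfolding sum_graph_indices using null_sum[OF q(1)] by (simp add: c_def)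
    finally show ?thesis using \<open>A \<noteq> 0\<close> by simp
  qed
  define \<Psi> where "\<Psi> = (\<lambda>z. (Re (\<xi> z), Im (\<xi> z)))"
  \<comment> \<open>The square of i supplies the sign of the negative directions, so the same null
    sum serves both signatures.\<close>
  define \<kappa> :: "nat \<Rightarrow> complex" where "\<kappa> = (\<lambda>j. if j \<le> 2 then 1 else \<i>)"
  have h12: "Re (h 1 z) = fst z" "Re (h 2 z) = snd z" for z by (simp_all add: h_def)
  have Hhol: "(\<lambda>w. h j (inv_into \<Omega> \<xi> w)) holomorphic_on \<xi> ` \<Omega>" if "j \<in> {1..n + 2}" for j
    by (rule hol_injective_inverse[OF \<xi> holh[OF that]])
  have rep: "conformal_coordinate \<epsilon> (n + 2) X \<Omega> \<Psi>"
    "conformal_harmonic_immersion \<epsilon> (n + 2) (reparam X \<Omega> \<Psi>) (\<Psi> ` \<Omega>)"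
    "holomorphic_null_curve \<epsilon> (n + 2) (induced_curve (reparam X \<Omega> \<Psi>)) (complex_region (\<Psi> ` \<Omega>))"
    "\<And>j z. j \<in> {1..n + 2} \<Longrightarrow> z \<in> complex_region (\<Psi> ` \<Omega>) \<Longrightarrow>
       induced_curve (reparam X \<Omega> \<Psi>) j z = \<kappa> j * deriv (\<lambda>w. h j (inv_into \<Omega> \<xi> w)) z"
    if "\<kappa> 1 = 1" "\<kappa> 2 = 1" "\<And>j. j \<in> {1..n + 2} \<Longrightarrow> of_real (\<epsilon> j) * (\<kappa> j)\<^sup>2 = (1 :: complex)"
      "\<And>j z. j \<in> {1..n + 2} \<Longrightarrow> X j z = Re (\<kappa> j * h j z)" "\<And>j. j \<in> {1..n + 2} \<Longrightarrow> C2_on \<Omega> (X j)"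
      "spacelike_on \<epsilon> (n + 2) X \<Omega>" for \<kappa> \<epsilon> X
    unfolding \<Psi>_def
    by (rule conformal_representation[OF open_D \<xi>(2) open_injective_image[OF \<xi>] l(2) hol_imp_C2[OF \<xi>(1)] Hhol null le_add2 h12 that], assumption+)+
  have Xf: "graph_of f j z = Re (1 * h j z)" if "j \<in> {1..n + 2}" for j z
    using that by (auto simp: graph_of_def h_def)
  have Xg: "graph_of g j z = Re (\<kappa> j * h j z)" if "j \<in> {1..n + 2}" for j z
    using that by (auto simp: graph_of_def h_def \<kappa>_def)
  have surf: "\<And>j. j \<in> {1..n + 2} \<Longrightarrow> C2_on \<Omega> (graph_of f j)" "spacelike_on euclidean_sig (n + 2) (graph_of f) \<Omega>"
    "\<And>j. j \<in> {1..n + 2} \<Longrightarrow> C2_on \<Omega> (graph_of g j)" "spacelike_on pseudo_sig (n + 2) (graph_of g) \<Omega>"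
    using assms(7,10) by (auto simp: minimal_surface_def maximal_surface_def zero_mean_curvature_surface_def)
  have sig: "of_real (euclidean_sig j) * (1 :: complex)\<^sup>2 = 1" "of_real (pseudo_sig j) * (\<kappa> j)\<^sup>2 = 1" for j
    by (auto simp: euclidean_sig_def pseudo_sig_def \<kappa>_def)
  have \<kappa>12: "\<kappa> 1 = 1" "\<kappa> 2 = 1" by (simp_all add: \<kappa>_def)
  note F = rep[of "\<lambda>_. 1", OF refl refl sig(1) Xf surf(1,2)] and G = rep[OF \<kappa>12 sig(2) Xg surf(3,4)]
  \<comment> \<open>The two curves are the same derivatives multiplied by 1 and by \<kappa> j
    respectively; 1 / i = - i is the factor in the twin relation.\<close>
  have rel: "induced_curve (reparam (graph_of f) \<Omega> \<Psi>) j z = (if j \<le> 2 then 1 else - \<i>) * induced_curve (reparam (graph_of g) \<Omega> \<Psi>) j z"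
    if "j \<in> {1..n + 2}" "z \<in> complex_region (\<Psi> ` \<Omega>)" for j z
    using F(4)[OF _ _ that] G(4)[OF _ _ that] by (simp add: \<kappa>_def)
  show ?thesis
    unfolding Let_def
  proof (intro exI[of _ \<Psi>] conjI ballI)
    fix z assume z: "z \<in> complex_region (\<Psi> ` \<Omega>)"
    show "induced_curve (reparam (graph_of f) \<Omega> \<Psi>) 1 z = induced_curve (reparam (graph_of g) \<Omega> \<Psi>) 1 z"
      "induced_curve (reparam (graph_of f) \<Omega> \<Psi>) 2 z = induced_curve (reparam (graph_of g) \<Omega> \<Psi>) 2 z"
      using rel[OF _ z, of 1] rel[OF _ z, of 2] by simp_all
    show "induced_curve (reparam (graph_of f) \<Omega> \<Psi>) (k + 2) z = - \<i> * induced_curve (reparam (graph_of g) \<Omega> \<Psi>) (k + 2) z"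
      if "k \<in> {1..n}" for k
      using rel[OF _ z, of "k + 2"] that by simp
  qed (use F(1-3) G(1-3) in blast)+
qed

end
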